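(* The assignments $\mathsf M\mapsto A(\mathsf M)$, $f\mapsto A(f)$ and $\mathsf M\mapsto\overline A(\mathsf M)$, $f\mapsto \overline A(f)$ are functors from $\mathcal M$ and from $\overline{\mathcal M}$, respectively, to the category of graded-commutative $\Bbbk$-algebras. Moreover, the functor $A$ preserves epimorphisms: if $f$ is an epimorphism in $\mathcal M$, then $A(f)$ is an epimorphism of graded-commutative $\Bbbk$-algebras.
   Context: For a matroid $\mathsf M_i$ on a finite set $S_i$, let $\mathsf M_i^+$ be $\mathsf M_i$ with an added disjoint loop $0$. A weak map $f\colon \mathsf M_1\to\mathsf M_2$ is a map $f\colon S_1\cup\{0\}\to S_2\cup\{0\}$ with $f(0)=0$ such that for all $I\subseteq S_1$, if $f|_I$ is injective and $f(I)$ is independent in $\mathsf M_2^+$ then $I$ is independent in $\mathsf M_1$; it is non-degenerate if $f^{-1}(0)=\{0\}$ and complete if $|C\cap f^{-1}(0)|\ne1$ for every circuit $C$ of $\mathsf M_1$. $\mathcal M$ is the category of matroids on finite sets with complete weak maps as morphisms; $\overline{\mathcal M}$ is its wide subcategory with non-degenerate weak maps as morphisms. For a matroid $\mathsf M$ on $S$ and a field $\Bbbk$: $V(\mathsf M)=\Bbbk^S$ with basis $\{e_s\}$, $E=\Lambda(V(\mathsf M))$, $\partial$ the graded derivation with $\partial(e_s)=1$, $e_C=\prod_{s\in C}e_s$; $A(\mathsf M)=E/I$ with $I$ generated by $\partial(e_C)$ over circuits $C$; $\overline A(\mathsf M)$ is the subalgebra generated by $\overline V(\mathsf M)=\{v:\sum_s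 v_s=0\}$. For a complete weak map $f$, $A(f)\colon A(\mathsf M_1)\to A(\mathsf M_2)$ is the homomorphism induced by $e_s\mapsto e_{f(s)}$ (with $e_{f(s)}=0$ if $f(s)=0$); for non-degenerate $f$, $\overline A(f)$ is its restriction $\overline A(\mathsf M_1)\to\overline A(\mathsf M_2)$.
   Formalization: Complete weak maps are not closed under composition, so M is not literally a category; "A is a functor from M" is stated as all functor laws for every composable pair of complete weak maps, and epimorphism in M as right-cancellability against complete weak maps. *)

theory Defs
  imports "HOL-Algebra.Algebra" "HOL-Algebra.Algebraic_Closure_Type" "HOL-Library.FuncSet"
begin

section \<open>Categories and functors\<close>

text \<open>
  Composition takes the source, middle and target object as arguments, since morphisms are
  represented by extensional functions.
\<close>

record ('o, 'm) cat =
  Obj :: "'o set"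
  Hom :: "'o \<Rightarrow> 'o \<Rightarrow> 'm set"
  Id :: "'o \<Rightarrow> 'm"
  Comp :: "'o \<Rightarrow> 'o \<Rightarrow> 'o \<Rightarrow> 'm \<Rightarrow> 'm \<Rightarrow> 'm"

definition is_category :: "('o, 'm) cat \<Rightarrow> bool" where
  "is_category C \<longleftrightarrow>
     (\<forall>b\<in>Obj C. Id C b \<in> Hom C b b) \<and>
     (\<forall>b\<in>Obj C. \<forall>c\<in>Obj C. \<forall>d\<in>Obj C. \<forall>f\<in>Hom C b c. \<forall>g\<in>Hom C c d.
        Comp C b c d g f \<in> Hom C b d) \<and>
     (\<forall>b\<in>Obj C. \<forall>c\<in>Obj C. \<forall>f\<in>Hom C b c.
        Comp C b b c f (Id C b) = f \<and> Comp C b c c (Id C c) f = f) \<and>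
     (\<forall>a\<in>Obj C. \<forall>b\<in>Obj C. \<forall>c\<in>Obj C. \<forall>d\<in>Obj C.
        \<forall>f\<in>Hom C a b. \<forall>g\<in>Hom C b c. \<forall>h\<in>Hom C c d.
          Comp C a b d (Comp C b c d h g) f = Comp C a c d h (Comp C a b c g f))"

definition functor_laws ::
  "('o, 'm) cat \<Rightarrow> ('p, 'n) cat \<Rightarrow> ('o \<Rightarrow> 'p) \<Rightarrow> ('o \<Rightarrow> 'o \<Rightarrow> 'm \<Rightarrow> 'n) \<Rightarrow> bool" where
  "functor_laws C D F0 F1 \<longleftrightarrow>
     (\<forall>b\<in>Obj C. F0 b \<in> Obj D) \<and>
     (\<forall>b\<in>Obj C. \<forall>c\<in>Obj C. \<forall>f\<in>Hom C b c. F1 b c f \<in> Hom D (F0 b) (F0 c)) \<and>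
     (\<forall>b\<in>Obj C. F1 b b (Id C b) = Id D (F0 b)) \<and>
     (\<forall>b\<in>Obj C. \<forall>c\<in>Obj C. \<forall>d\<in>Obj C. \<forall>f\<in>Hom C b c. \<forall>g\<in>Hom C c d.
        F1 b d (Comp C b c d g f) = Comp D (F0 b) (F0 c) (F0 d) (F1 c d g) (F1 b c f))"

definition is_functor ::
  "('o, 'm) cat \<Rightarrow> ('p, 'n) cat \<Rightarrow> ('o \<Rightarrow> 'p) \<Rightarrow> ('o \<Rightarrow> 'o \<Rightarrow> 'm \<Rightarrow> 'n) \<Rightarrow> bool" where
  "is_functor C D F0 F1 \<longleftrightarrow> is_category C \<and> is_category D \<and> functor_laws C D F0 F1"

definition epimorphism :: "('o, 'm) cat \<Rightarrow> 'o \<Rightarrow> 'o \<Rightarrow> 'm \<Rightarrow> bool" where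
  "epimorphism C b c f \<longleftrightarrow>
     b \<in> Obj C \<and> c \<in> Obj C \<and> f \<in> Hom C b c \<and>
     (\<forall>d\<in>Obj C. \<forall>g\<in>Hom C c d. \<forall>h\<in>Hom C c d.
        Comp C b c d g f = Comp C b c d h f \<longrightarrow> g = h)"

section \<open>Matroids and weak maps\<close>

record 's matroid =
  ground :: "'s set"
  indeps :: "'s set set"

definition is_matroid :: "'s matroid \<Rightarrow> bool" where
  "is_matroid M \<longleftrightarrow>
     finite (ground M) \<and> indeps M \<subseteq> Pow (ground M) \<and> {} \<in> indeps M \<and>
     (\<forall>I\<in>indeps M. \<forall>J. J \<subseteq> I \<longrightarrow> J \<in> indeps M) \<and>
     (\<forall>I\<in>indeps M. \<forall>J\<in>indeps M. card I < card J \<longrightarrow> (\<exists>x\<in>J - I. insert x I \<in> indeps M))"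

definition circuits :: "'s matroid \<Rightarrow> 's set set" where
  "circuits M = {C. C \<subseteq> ground M \<and> C \<notin> indeps M \<and> (\<forall>D. D \<subset> C \<longrightarrow> D \<in> indeps M)}"

text \<open>The added loop $0$ is \<^const>\<open>None\<close>; an element $s$ of the matroid becomes \<^term>\<open>Some s\<close>.\<close>

definition add_loop :: "'s matroid \<Rightarrow> 's option matroid" where
  "add_loop M = \<lparr>ground = insert None (Some ` ground M), indeps = (\<lambda>I. Some ` I) ` indeps M\<rparr>"

definition weak_map :: "'s matroid \<Rightarrow> 't matroid \<Rightarrow> ('s option \<Rightarrow> 't option) \<Rightarrow> bool" where
  "weak_map M1 M2 f \<longleftrightarrow>
     f \<in> ground (add_loop M1) \<rightarrow>\<^sub>E ground (add_loop M2) \<and> f None = None \<and>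
     (\<forall>I. I \<subseteq> ground M1 \<and> inj_on f (Some ` I) \<and> f ` Some ` I \<in> indeps (add_loop M2)
        \<longrightarrow> I \<in> indeps M1)"

definition nondegenerate :: "'s matroid \<Rightarrow> ('s option \<Rightarrow> 't option) \<Rightarrow> bool" where
  "nondegenerate M f \<longleftrightarrow> {x \<in> ground (add_loop M). f x = None} = {None}"

definition complete_map :: "'s matroid \<Rightarrow> ('s option \<Rightarrow> 't option) \<Rightarrow> bool" where
  "complete_map M f \<longleftrightarrow> (\<forall>C\<in>circuits M. card {s \<in> C. f (Some s) = None} \<noteq> 1)"

text \<open>
  Complete weak maps are not closed under composition. Let $M_1$ be the uniform matroid of rank
  2 on $\{0,1,2\}$, let $M_2$ have the same ground set and the bases $\{0,1\},\{0,2\}$, and let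
  $M_3$ be the restriction of $M_2$ to $\{1,2\}$. The identity of $\{0,1,2\}$ is a complete weak
  map from $M_1$ to $M_2$, and so is the map from $M_2$ to $M_3$ that sends the element 0 to the
  added loop and fixes 1 and 2; their composite is a weak map that kills exactly one element of
  the circuit $\{0,1,2\}$ of $M_1$. So this structure does not satisfy \<^const>\<open>is_category\<close>;
  \<^const>\<open>functor_laws\<close> asks for compatibility with every composite of two complete weak maps,
  also when the composite is not complete.
\<close>

definition matroid_cat :: "('s matroid, 's option \<Rightarrow> 's option) cat" where
  "matroid_cat =
     \<lparr>Obj = {M. is_matroid M},
      Hom = (\<lambda>M1 M2. {f. weak_map M1 M2 f \<and> complete_map M1 f}),
      Id = (\<lambda>M. restrict (\<lambda>x. x) (ground (add_loop M))),
      Comp = (\<lambda>M1 M2 M3 g f. compose (ground (add_loop M1)) g f)\<rparr>"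

definition matroid_nd_cat :: "('s matroid, 's option \<Rightarrow> 's option) cat" where
  "matroid_nd_cat =
     matroid_cat\<lparr>Hom := (\<lambda>M1 M2. {f. weak_map M1 M2 f \<and> nondegenerate M1 f})\<rparr>"

section \<open>Graded-commutative algebras\<close>

record ('k, 'a) galg = "('k, 'a) module" +
  hcomp :: "nat \<Rightarrow> 'a set"

definition graded_algebra :: "('k::field, 'a) galg \<Rightarrow> bool" where
  "graded_algebra A \<longleftrightarrow>
     ring A \<and> module (ring_of_type_algebra :: 'k ring) A \<and>
     (\<forall>c. \<forall>x\<in>carrier A. \<forall>y\<in>carrier A.
        c \<odot>\<^bsub>A\<^esub> (x \<otimes>\<^bsub>A\<^esub> y) = (c \<odot>\<^bsub>A\<^esub> x) \<otimes>\<^bsub>A\<^esub> y \<and>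
        c \<odot>\<^bsub>A\<^esub> (x \<otimes>\<^bsub>A\<^esub> y) = x \<otimes>\<^bsub>A\<^esub> (c \<odot>\<^bsub>A\<^esub> y)) \<and>
     (\<forall>n. submodule (hcomp A n) (ring_of_type_algebra :: 'k ring) A) \<and>
     (\<forall>x\<in>carrier A. \<exists>!p. (\<forall>n. p n \<in> hcomp A n) \<and> finite {n. p n \<noteq> \<zero>\<^bsub>A\<^esub>} \<and>
        x = (\<Oplus>\<^bsub>A\<^esub>n\<in>{n. p n \<noteq> \<zero>\<^bsub>A\<^esub>}. p n)) \<and>
     \<one>\<^bsub>A\<^esub> \<in> hcomp A 0 \<and>
     (\<forall>m n. \<forall>x\<in>hcomp A m. \<forall>y\<in>hcomp A n. x \<otimes>\<^bsub>A\<^esub> y \<in> hcomp A (m + n))"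

definition graded_comm_algebra :: "('k::field, 'a) galg \<Rightarrow> bool" where
  "graded_comm_algebra A \<longleftrightarrow> graded_algebra A \<and>
     (\<forall>m n. \<forall>x\<in>hcomp A m. \<forall>y\<in>hcomp A n. x \<otimes>\<^bsub>A\<^esub> y = (- 1) ^ (m * n) \<odot>\<^bsub>A\<^esub> (y \<otimes>\<^bsub>A\<^esub> x))"

definition galg_hom :: "('k::field, 'a) galg \<Rightarrow> ('k, 'b) galg \<Rightarrow> ('a \<Rightarrow> 'b) set" where
  "galg_hom A B = {h \<in> ring_hom A B. h \<in> extensional (carrier A) \<and>
     (\<forall>c. \<forall>x\<in>carrier A. h (c \<odot>\<^bsub>A\<^esub> x) = c \<odot>\<^bsub>B\<^esub> h x) \<and>
     (\<forall>n. h ` hcomp A n \<subseteq> hcomp B n)}"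

definition gca_cat :: "(('k::field, 'a) galg, 'a \<Rightarrow> 'a) cat" where
  "gca_cat =
     \<lparr>Obj = {A. graded_comm_algebra A},
      Hom = galg_hom,
      Id = (\<lambda>A. restrict (\<lambda>x. x) (carrier A)),
      Comp = (\<lambda>A B C g f. compose (carrier A) g f)\<rparr>"

text \<open>
  The category above only contains the algebras whose carrier lies in one fixed type. The next
  definition tests against algebras over a further type \<^typ>\<open>'c\<close>; a statement with \<^typ>\<open>'c\<close> left
  free quantifies over all graded-commutative algebras, and implies \<^const>\<open>epimorphism\<close> in
  \<^const>\<open>gca_cat\<close>.
\<close>

definition gca_epimorphism ::
  "'c itself \<Rightarrow> ('k::field, 'a) galg \<Rightarrow> ('k, 'b) galg \<Rightarrow> ('a \<Rightarrow> 'b) \<Rightarrow> bool" where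
  "gca_epimorphism _ A B f \<longleftrightarrow>
     graded_comm_algebra A \<and> graded_comm_algebra B \<and> f \<in> galg_hom A B \<and>
     (\<forall>C :: ('k, 'c) galg. graded_comm_algebra C \<longrightarrow>
        (\<forall>g\<in>galg_hom B C. \<forall>h\<in>galg_hom B C.
           compose (carrier A) g f = compose (carrier A) h f \<longrightarrow> g = h))"

text \<open>The quotient of a graded algebra by a homogeneous two-sided ideal.\<close>

definition galg_quot :: "('k::field, 'a) galg \<Rightarrow> 'a set \<Rightarrow> ('k, 'a set) galg" where
  "galg_quot A I =
     \<lparr>carrier = carrier (A Quot I), monoid.mult = monoid.mult (A Quot I), monoid.one = monoid.one (A Quot I),
      ring.zero = ring.zero (A Quot I), add = add (A Quot I),
      module.smult = (\<lambda>c U. \<Union>x\<in>U. I +>\<^bsub>A\<^esub> (c \<odot>\<^bsub>A\<^esub> x)),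
      hcomp = (\<lambda>n. (\<lambda>x. I +>\<^bsub>A\<^esub> x) ` hcomp A n)\<rparr>"

definition subalgebra_gen :: "('k::field, 'a) galg \<Rightarrow> 'a set \<Rightarrow> 'a set" where
  "subalgebra_gen A U =
     \<Inter>{H. subring H A \<and> (\<forall>c. \<forall>x\<in>H. c \<odot>\<^bsub>A\<^esub> x \<in> H) \<and> U \<subseteq> H}"

definition graded_derivation :: "('k::field, 'a) galg \<Rightarrow> ('a \<Rightarrow> 'a) \<Rightarrow> bool" where
  "graded_derivation A d \<longleftrightarrow>
     d \<in> carrier A \<rightarrow>\<^sub>E carrier A \<and>
     (\<forall>x\<in>carrier A. \<forall>y\<in>carrier A. d (x \<oplus>\<^bsub>A\<^esub> y) = d x \<oplus>\<^bsub>A\<^esub> d y) \<and>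
     (\<forall>c. \<forall>x\<in>carrier A. d (c \<odot>\<^bsub>A\<^esub> x) = c \<odot>\<^bsub>A\<^esub> d x) \<and>
     d ` hcomp A 0 \<subseteq> {\<zero>\<^bsub>A\<^esub>} \<and> (\<forall>n. d ` hcomp A (Suc n) \<subseteq> hcomp A n) \<and>
     (\<forall>m. \<forall>x\<in>hcomp A m. \<forall>y\<in>carrier A.
        d (x \<otimes>\<^bsub>A\<^esub> y) = (d x \<otimes>\<^bsub>A\<^esub> y) \<oplus>\<^bsub>A\<^esub> ((- 1) ^ m \<odot>\<^bsub>A\<^esub> (x \<otimes>\<^bsub>A\<^esub> d y)))"

section \<open>Exterior and Orlik--Solomon algebras\<close>

text \<open>
  The tensor algebra of $V = k^S$ in its basis of words in $S$: an element is the finitely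
  supported family of its coefficients. Its component of degree 1 is $V$ itself, the coordinate
  $v_s$ of a vector $v$ being its coefficient at the word $[s]$.
\<close>

definition tensor_carrier :: "'s set \<Rightarrow> ('s list \<Rightarrow> 'k::field) set" where
  "tensor_carrier S = {p. finite {w. p w \<noteq> 0} \<and> (\<forall>w. p w \<noteq> 0 \<longrightarrow> set w \<subseteq> S)}"

definition tensor_algebra :: "'s set \<Rightarrow> ('k::field, 's list \<Rightarrow> 'k) galg" where
  "tensor_algebra S =
     \<lparr>carrier = tensor_carrier S,
      monoid.mult = (\<lambda>p q w. \<Sum>i\<le>length w. p (take i w) * q (drop i w)),
      monoid.one = (\<lambda>w. if w = [] then 1 else 0),
      ring.zero = (\<lambda>w. 0),
      add = (\<lambda>p q w. p w + q w),
      module.smult = (\<lambda>c p w. c * p w),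
      hcomp = (\<lambda>n. {p \<in> tensor_carrier S. \<forall>w. p w \<noteq> 0 \<longrightarrow> length w = n})\<rparr>"

definition basis_vec :: "'s \<Rightarrow> 's list \<Rightarrow> 'k::field" where
  "basis_vec s = (\<lambda>w. if w = [s] then 1 else 0)"

definition ext_ideal :: "'s set \<Rightarrow> ('s list \<Rightarrow> 'k::field) set" where
  "ext_ideal S = Idl\<^bsub>tensor_algebra S\<^esub> {v \<otimes>\<^bsub>tensor_algebra S\<^esub> v |v. v \<in> hcomp (tensor_algebra S) 1}"

definition ext_algebra :: "'s set \<Rightarrow> ('k::field, ('s list \<Rightarrow> 'k) set) galg" where
  "ext_algebra S = galg_quot (tensor_algebra S) (ext_ideal S)"

definition ext_vec :: "'s set \<Rightarrow> ('s list \<Rightarrow> 'k::field) \<Rightarrow> ('s list \<Rightarrow> 'k) set" where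
  "ext_vec S v = ext_ideal S +>\<^bsub>tensor_algebra S\<^esub> v"

definition ext_prod :: "'s set \<Rightarrow> 's list \<Rightarrow> ('s list \<Rightarrow> 'k::field) set" where
  "ext_prod S xs =
     foldr (\<lambda>s x. ext_vec S (basis_vec s) \<otimes>\<^bsub>ext_algebra S\<^esub> x) xs \<one>\<^bsub>ext_algebra S\<^esub>"

definition ext_deriv :: "'s set \<Rightarrow> ('s list \<Rightarrow> 'k::field) set \<Rightarrow> ('s list \<Rightarrow> 'k) set" where
  "ext_deriv S = (THE d. graded_derivation (ext_algebra S) d \<and>
     (\<forall>s\<in>S. d (ext_vec S (basis_vec s)) = \<one>\<^bsub>ext_algebra S\<^esub>))"

text \<open>
  The product $e_C$ is determined up to sign by $C$; taking the generators for every ordering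
  of every circuit gives the same ideal as choosing one ordering.
\<close>

definition os_ideal :: "'s matroid \<Rightarrow> ('s list \<Rightarrow> 'k::field) set set" where
  "os_ideal M = Idl\<^bsub>ext_algebra (ground M)\<^esub>
     {ext_deriv (ground M) (ext_prod (ground M) xs) |xs. distinct xs \<and> set xs \<in> circuits M}"

definition os_algebra :: "'s matroid \<Rightarrow> ('k::field, ('s list \<Rightarrow> 'k) set set) galg" where
  "os_algebra M = galg_quot (ext_algebra (ground M)) (os_ideal M)"

definition os_vec :: "'s matroid \<Rightarrow> ('s list \<Rightarrow> 'k::field) \<Rightarrow> ('s list \<Rightarrow> 'k) set set" where
  "os_vec M v = os_ideal M +>\<^bsub>ext_algebra (ground M)\<^esub> ext_vec (ground M) v"

definition reduced_space :: "'s matroid \<Rightarrow> ('s list \<Rightarrow> 'k::field) set" where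
  "reduced_space M =
     {v \<in> hcomp (tensor_algebra (ground M)) 1. (\<Sum>s\<in>ground M. v [s]) = 0}"

definition reduced_os_algebra :: "'s matroid \<Rightarrow> ('k::field, ('s list \<Rightarrow> 'k) set set) galg" where
  "reduced_os_algebra M =
     (let H = subalgebra_gen (os_algebra M) (os_vec M ` reduced_space M)
      in (os_algebra M)\<lparr>carrier := H, hcomp := (\<lambda>n. H \<inter> hcomp (os_algebra M) n)\<rparr>)"

text \<open>The element $e_x$ for $x$ in the ground set of the matroid with its added loop.\<close>

definition os_gen :: "'s matroid \<Rightarrow> 's option \<Rightarrow> ('s list \<Rightarrow> 'k::field) set set" where
  "os_gen M x = (case x of None \<Rightarrow> \<zero>\<^bsub>os_algebra M\<^esub> | Some s \<Rightarrow> os_vec M (basis_vec s))"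

definition os_induced :: "'s matroid \<Rightarrow> 't matroid \<Rightarrow> ('s option \<Rightarrow> 't option) \<Rightarrow>
    (('s list \<Rightarrow> 'k::field) set set \<Rightarrow> ('t list \<Rightarrow> 'k) set set) \<Rightarrow> bool" where
  "os_induced M1 M2 f h \<longleftrightarrow>
     h \<in> galg_hom (os_algebra M1) (os_algebra M2) \<and>
     (\<forall>s\<in>ground M1. h (os_gen M1 (Some s)) = os_gen M2 (f (Some s)))"

definition os_map :: "'s matroid \<Rightarrow> 't matroid \<Rightarrow> ('s option \<Rightarrow> 't option) \<Rightarrow>
    ('s list \<Rightarrow> 'k::field) set set \<Rightarrow> ('t list \<Rightarrow> 'k) set set" where
  "os_map M1 M2 f = (THE h. os_induced M1 M2 f h)"

definition reduced_os_map :: "'s matroid \<Rightarrow> 't matroid \<Rightarrow> ('s option \<Rightarrow> 't option) \<Rightarrow>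
    ('s list \<Rightarrow> 'k::field) set set \<Rightarrow> ('t list \<Rightarrow> 'k) set set" where
  "reduced_os_map M1 M2 f =
     restrict (os_map M1 M2 f)
       (carrier (reduced_os_algebra M1 :: ('k, ('s list \<Rightarrow> 'k) set set) galg))"

end

(* The algebra A(M) is a quotient of the tensor algebra by homogeneous ideals, so a graded homomorphism
   out of it is determined by its values on the elements e_s, and functoriality reduces to the existence
   of A(f). For a circuit C of M1, the image of the derivative of e_C under e_s -> e_{f(s)} vanishes:
   if f kills at least two elements of C, every term retains a killed factor; if f kills none, the image
   is the derivative of e_{f(C)}, which is zero when f is not injective on C, and which otherwise lies in
   the ideal of M2 because f(C) is dependent, hence contains a circuit D, and e_D = e_d * (derivative of
   e_D) for d in D. Completeness excludes the case of exactly one killed element. An epimorphism of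
   matroids hits every element t of the target: otherwise two maps into a matroid consisting of two
   loops (into which every map is a weak map) that differ only at t would agree after composition. *)

theory Submission
  imports Defs
begin

text \<open>The grading is the main obstacle. \<open>graded_comm_algebra\<close> asks for unique
  homogeneous decompositions, and these have to survive two successive quotients and the passage to
  a generated subalgebra; in each case the point is that the ideal or subalgebra contains the
  homogeneous components of its elements. The derivation enters the definitions only as a definite
  description. It is therefore built on words of the tensor algebra, where nothing has to be well
  defined, shown to preserve the ideal of squares, and proved unique on the quotient. The field is
  arbitrary, and in characteristic 2 graded commutativity does not force squares of degree 1 to
  vanish; that property is carried along separately. Since a composite of complete maps may fail to
  be complete, compatibility with composition cannot rest on an existence result for the composite.
  The two induced homomorphisms are composed instead, and uniqueness identifies the result with the
  value of \<open>os_map\<close>.\<close>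

lemma scalar_ring_simps [simp]:
  "carrier (ring_of_type_algebra :: 'k::field ring) = UNIV"
  "a \<oplus>\<^bsub>(ring_of_type_algebra :: 'k ring)\<^esub> b = a + b"
  "a \<otimes>\<^bsub>(ring_of_type_algebra :: 'k ring)\<^esub> b = a * b"
  "\<one>\<^bsub>(ring_of_type_algebra :: 'k ring)\<^esub> = 1"
  "\<zero>\<^bsub>(ring_of_type_algebra :: 'k ring)\<^esub> = 0"
  by (simp_all add: ring_of_type_algebra_def)

section \<open>Graded algebras\<close>

text \<open>Homogeneous decompositions are carried as sums over an initial segment of the degrees.
  Padding with zeros gives two of them the same length, so that they can be added or
  compared.\<close>

lemma (in abelian_monoid) finsum_pad:
  assumes "\<And>n. p n \<in> carrier G" "N \<le> K"
  shows "(\<Oplus>n\<in>{..<N}. p n) = (\<Oplus>n\<in>{..<K}. if n < (N :: nat) then p n else \<zero>)"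
  using assms by (intro add.finprod_mono_neutral_cong_left) auto

text \<open>Only abelian monoids and additivity are involved, so this serves both the projection
  onto a quotient and the inclusion of a subalgebra at a stage where neither structure is known to
  be graded.\<close>

lemma finsum_hom:
  assumes "abelian_monoid A" "abelian_monoid B" "finite F"
    and "\<And>i. i \<in> F \<Longrightarrow> p i \<in> carrier A" "\<phi> \<zero>\<^bsub>A\<^esub> = \<zero>\<^bsub>B\<^esub>" "\<And>x. x \<in> carrier A \<Longrightarrow> \<phi> x \<in> carrier B"
    and "\<And>x y. x \<in> carrier A \<Longrightarrow> y \<in> carrier A \<Longrightarrow> \<phi> (x \<oplus>\<^bsub>A\<^esub> y) = \<phi> x \<oplus>\<^bsub>B\<^esub> \<phi> y"
  shows "\<phi> (\<Oplus>\<^bsub>A\<^esub>i\<in>F. p i) = (\<Oplus>\<^bsub>B\<^esub>i\<in>F. \<phi> (p i))"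
proof -
  interpret A: abelian_monoid A by fact
  interpret B: abelian_monoid B by fact
  show ?thesis using assms(3,4)
  proof (induction F rule: finite_induct)
    case (insert i F)
    have "p \<in> F \<rightarrow> carrier A" "(\<lambda>i. \<phi> (p i)) \<in> F \<rightarrow> carrier B" "p i \<in> carrier A"
      using insert.prems assms by auto
    then show ?case using insert assms by (simp add: A.finsum_insert B.finsum_insert)
  qed (use assms in simp)
qed

text \<open>Two decompositions of one element differ by a decomposition of zero, so uniqueness
  follows once zero decomposes only trivially. Existence is asked in the convenient form of a sum
  over \<open>{..<N}\<close>, without control of the family beyond \<open>N\<close>.\<close>

lemma graded_algebraI:
  fixes A :: "('k::field, 'a) galg" (structure)
  assumes "ring A"
    and smult: "\<And>c x. x \<in> carrier A \<Longrightarrow> c \<odot> x \<in> carrier A"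
      "\<And>c d x. x \<in> carrier A \<Longrightarrow> (c + d) \<odot> x = c \<odot> x \<oplus> d \<odot> x"
      "\<And>c x y. x \<in> carrier A \<Longrightarrow> y \<in> carrier A \<Longrightarrow> c \<odot> (x \<oplus> y) = c \<odot> x \<oplus> c \<odot> y"
      "\<And>c d x. x \<in> carrier A \<Longrightarrow> (c * d) \<odot> x = c \<odot> (d \<odot> x)"
      "\<And>x. x \<in> carrier A \<Longrightarrow> 1 \<odot> x = x"
    and mult: "\<And>c x y. x \<in> carrier A \<Longrightarrow> y \<in> carrier A \<Longrightarrow> c \<odot> (x \<otimes> y) = (c \<odot> x) \<otimes> y"
      "\<And>c x y. x \<in> carrier A \<Longrightarrow> y \<in> carrier A \<Longrightarrow> c \<odot> (x \<otimes> y) = x \<otimes> (c \<odot> y)"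
    and sub: "\<And>n x. x \<in> hcomp A n \<Longrightarrow> x \<in> carrier A"
      "\<And>n. \<zero> \<in> hcomp A n"
      "\<And>n x y. x \<in> hcomp A n \<Longrightarrow> y \<in> hcomp A n \<Longrightarrow> x \<oplus> y \<in> hcomp A n"
      "\<And>n c x. x \<in> hcomp A n \<Longrightarrow> c \<odot> x \<in> hcomp A n"
    and decomp: "\<And>x. x \<in> carrier A \<Longrightarrow> \<exists>p N. (\<forall>n. p n \<in> hcomp A n) \<and> x = (\<Oplus>n\<in>{..<N::nat}. p n)"
    and indep: "\<And>p N n. (\<And>n. p n \<in> hcomp A n) \<Longrightarrow> (\<Oplus>n\<in>{..<N}. p n) = \<zero> \<Longrightarrow> n < N \<Longrightarrow> p n = \<zero>"
    and one: "\<one> \<in> hcomp A 0"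
    and hmult: "\<And>m n x y. x \<in> hcomp A m \<Longrightarrow> y \<in> hcomp A n \<Longrightarrow> x \<otimes> y \<in> hcomp A (m + n)"
  shows "graded_algebra A"
proof -
  interpret ring A by fact
  have cr: "cring (ring_of_type_algebra :: 'k ring)" by (rule cring_from_type_algebra)
  interpret M: module "ring_of_type_algebra :: 'k ring" A
    by (rule moduleI) (use smult cr is_abelian_group in auto)
  have neg: "\<ominus> x = (- 1) \<odot> x" if "x \<in> carrier A" for x
  proof (rule add.inv_equality)
    have "(- 1) \<odot> x \<oplus> x = (- 1 + 1) \<odot> x" using that smult by metis
    then show "(- 1) \<odot> x \<oplus> x = \<zero>" using that M.smult_l_null by simp
  qed (use that smult in auto)
  have submod: "submodule (hcomp A n) (ring_of_type_algebra :: 'k ring) A" for n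
    by (rule M.submoduleI) (use sub neg in auto)
  have upto: "(\<Oplus>n\<in>{n. p n \<noteq> \<zero>}. p n) = (\<Oplus>n\<in>{..<N}. p n)"
    if "\<And>n. p n \<in> hcomp A n" "\<And>n. p n \<noteq> \<zero> \<Longrightarrow> n < N" for p and N :: nat
    by (rule add.finprod_mono_neutral_cong_left) (use that(2) sub(1)[OF that(1)] in blast)+
  have "\<exists>!p. (\<forall>n. p n \<in> hcomp A n) \<and> finite {n. p n \<noteq> \<zero>} \<and> x = (\<Oplus>n\<in>{n. p n \<noteq> \<zero>}. p n)"
    if x: "x \<in> carrier A" for x
  proof -
    obtain q N where q: "\<And>n. q n \<in> hcomp A n" "x = (\<Oplus>n\<in>{..<N::nat}. q n)"
      using decomp[OF x] by blast
    \<comment> \<open>The family \<open>q\<close> is arbitrary from degree \<open>N\<close> on;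
      cutting it off there gives the finite support that the definition demands.\<close>
    define p where "p = (\<lambda>n. if n < N then q n else \<zero>)"
    have p: "\<And>n. p n \<in> hcomp A n" "\<And>n. p n \<noteq> \<zero> \<Longrightarrow> n < N"
      unfolding p_def using q sub by (auto split: if_splits)
    have "x = (\<Oplus>n\<in>{..<N}. p n)"
      unfolding q(2) p_def using sub(1)[OF q(1)] by (intro finsum_cong') auto
    then have px: "x = (\<Oplus>n\<in>{n. p n \<noteq> \<zero>}. p n)" using upto[OF p] by simp
    have fin: "finite {n. p n \<noteq> \<zero>}" using p(2) by (meson finite_nat_set_iff_bounded mem_Collect_eq)
    show ?thesis
    proof (rule ex1I[of _ p])
      fix r assume r: "(\<forall>n. r n \<in> hcomp A n) \<and> finite {n. r n \<noteq> \<zero>} \<and> x = (\<Oplus>n\<in>{n. r n \<noteq> \<zero>}. r n)"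
      then obtain K where K: "\<And>n. r n \<noteq> \<zero> \<Longrightarrow> n < K"
        unfolding finite_nat_set_iff_bounded by blast
      define L where "L = max K N"
      have carr: "r n \<in> carrier A" "p n \<in> carrier A" for n using r p sub by blast+
      have rL: "x = (\<Oplus>n\<in>{..<L}. r n)" using r K upto[of r L] by (fastforce simp: L_def)
      have pL: "x = (\<Oplus>n\<in>{..<L}. p n)" using px p upto[of p L] by (fastforce simp: L_def)
      \<comment> \<open>\<open>L\<close> bounds both supports. Subtraction is written with the
        scalar \<open>- 1\<close> because the assumptions on \<open>hcomp\<close> provide closure
        under scalars.\<close>
      have "(\<Oplus>n\<in>{..<L}. r n \<oplus> (- 1) \<odot> p n) = x \<oplus> (\<Oplus>n\<in>{..<L}. (- 1) \<odot> p n)"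
        using carr rL smult by (subst finsum_addf) auto
      also have "(\<Oplus>n\<in>{..<L}. (- 1) \<odot> p n) = (- 1) \<odot> x"
        using carr pL M.finsum_smult_ldistr[of "{..<L}" "- 1" p] by auto
      finally have z: "(\<Oplus>n\<in>{..<L}. r n \<oplus> (- 1) \<odot> p n) = \<zero>"
        using add.r_inv[OF x] by (simp add: neg[OF x, symmetric])
      have "r n = p n" for n
      proof (cases "n < L")
        case True
        then have "r n \<oplus> (- 1) \<odot> p n = \<zero>"
          using indep[of "\<lambda>n. r n \<oplus> (- 1) \<odot> p n" L n] z r p sub by auto
        then have "r n \<oplus> \<ominus> p n = \<zero>" using neg carr by simp
        then show ?thesis using carr by (metis add.inv_closed add.inv_equality minus_minus)
      next
        case False
        then show ?thesis using K p(2) unfolding L_def by (metis max.strict_coboundedI1 max.strict_coboundedI2)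
      qed
      then show "r = p" by auto
    qed (use p fin px in auto)
  qed
  then show ?thesis
    unfolding graded_algebra_def
    using \<open>ring A\<close> M.module_axioms mult submod one hmult by auto
qed

locale galgebra =
  fixes A :: "('k::field, 'a) galg" (structure)
  assumes graded: "graded_algebra A"

sublocale galgebra \<subseteq> ring A
  using graded unfolding graded_algebra_def by blast

context galgebra
begin

lemma scalar_module: "module (ring_of_type_algebra :: 'k ring) A"
  using graded unfolding graded_algebra_def by blast

interpretation M: module "ring_of_type_algebra :: 'k ring" A
  by (rule scalar_module)

lemma smult_closed [simp, intro]: "x \<in> carrier A \<Longrightarrow> c \<odot> x \<in> carrier A"
  using M.smult_closed by simp

lemma smult_add: "x \<in> carrier A \<Longrightarrow> y \<in> carrier A \<Longrightarrow> c \<odot> (x \<oplus> y) = c \<odot> x \<oplus> c \<odot> y"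
  using M.smult_r_distr by simp

lemma add_smult: "x \<in> carrier A \<Longrightarrow> (c + d) \<odot> x = c \<odot> x \<oplus> d \<odot> x"
  using M.smult_l_distr[of c d x] by simp

lemma smult_smult [simp]: "x \<in> carrier A \<Longrightarrow> c \<odot> (d \<odot> x) = (c * d) \<odot> x"
  using M.smult_assoc1[of c d x] by simp

lemma one_smult [simp]: "x \<in> carrier A \<Longrightarrow> 1 \<odot> x = x"
  using M.smult_one by simp

lemma zero_smult [simp]: "x \<in> carrier A \<Longrightarrow> 0 \<odot> x = \<zero>"
  using M.smult_l_null by simp

lemma smult_zero [simp]: "c \<odot> \<zero> = \<zero>"
  using M.smult_r_null by simp

lemma minus_one_smult: "x \<in> carrier A \<Longrightarrow> (- 1) \<odot> x = \<ominus> x"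
  by (metis add.inv_equality add.left_inverse add_smult one_smult smult_closed zero_smult)

lemma mult_smult [simp]:
  "x \<in> carrier A \<Longrightarrow> y \<in> carrier A \<Longrightarrow> (c \<odot> x) \<otimes> y = c \<odot> (x \<otimes> y)"
  "x \<in> carrier A \<Longrightarrow> y \<in> carrier A \<Longrightarrow> x \<otimes> (c \<odot> y) = c \<odot> (x \<otimes> y)"
  using graded unfolding graded_algebra_def by metis+

lemma finsum_smult:
  "finite F \<Longrightarrow> (\<And>i. i \<in> F \<Longrightarrow> f i \<in> carrier A) \<Longrightarrow> c \<odot> (\<Oplus>i\<in>F. f i) = (\<Oplus>i\<in>F. c \<odot> f i)"
  by (rule M.finsum_smult_ldistr) auto

lemma hcomp_submodule: "submodule (hcomp A n) (ring_of_type_algebra :: 'k ring) A"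
  using graded unfolding graded_algebra_def by blast

lemma hcomp_closed: "x \<in> hcomp A n \<Longrightarrow> x \<in> carrier A"
  using M.submoduleE(1)[OF hcomp_submodule] by auto

lemma hcomp_add: "x \<in> hcomp A n \<Longrightarrow> y \<in> hcomp A n \<Longrightarrow> x \<oplus> y \<in> hcomp A n"
  using M.submoduleE(5)[OF hcomp_submodule] by auto

lemma hcomp_smult: "x \<in> hcomp A n \<Longrightarrow> c \<odot> x \<in> hcomp A n"
  using M.submoduleE(4)[OF hcomp_submodule] by auto

lemma hcomp_zero: "\<zero> \<in> hcomp A n"
  using M.submoduleE(2)[OF hcomp_submodule] hcomp_smult[of _ n 0] hcomp_closed zero_smult
  by (metis ex_in_conv)

lemma one_hcomp: "\<one> \<in> hcomp A 0"
  using graded unfolding graded_algebra_def by blast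

lemma hcomp_mult: "x \<in> hcomp A m \<Longrightarrow> y \<in> hcomp A n \<Longrightarrow> x \<otimes> y \<in> hcomp A (m + n)"
  using graded unfolding graded_algebra_def by blast

lemma finsum_support:
  assumes "\<And>n. p n \<in> hcomp A n" "\<And>n. p n \<noteq> \<zero> \<Longrightarrow> n < N"
  shows "(\<Oplus>n\<in>{n. p n \<noteq> \<zero>}. p n) = (\<Oplus>n\<in>{..<N}. p n)"
  by (rule add.finprod_mono_neutral_cong_left) (use assms(2) hcomp_closed[OF assms(1)] in blast)+

lemma ex_decomp:
  assumes x: "x \<in> carrier A"
  obtains p N where "\<And>n. p n \<in> hcomp A n" "x = (\<Oplus>n\<in>{..<N::nat}. p n)"
proof -
  have "\<exists>!p. (\<forall>n. p n \<in> hcomp A n) \<and> finite {n. p n \<noteq> \<zero>} \<and> x = (\<Oplus>n\<in>{n. p n \<noteq> \<zero>}. p n)"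
    using graded x unfolding graded_algebra_def by blast
  then obtain p where p: "\<And>n. p n \<in> hcomp A n" "finite {n. p n \<noteq> \<zero>}"
    "x = (\<Oplus>n\<in>{n. p n \<noteq> \<zero>}. p n)" by blast
  then obtain N where N: "\<And>n. p n \<noteq> \<zero> \<Longrightarrow> n < N"
    using p(2) unfolding finite_nat_set_iff_bounded by blast
  have "x = (\<Oplus>n\<in>{..<N}. p n)"
    by (rule trans[OF p(3)]) (rule finsum_support[OF p(1) N])
  then show ?thesis by (rule that[OF p(1)])
qed

lemma decomp_unique:
  assumes "\<And>n. p n \<in> hcomp A n" "\<And>n. q n \<in> hcomp A n"
    and "(\<Oplus>n\<in>{..<N::nat}. p n) = (\<Oplus>n\<in>{..<N}. q n)" "n < N"
  shows "p n = q n"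
proof -
  define x where "x = (\<Oplus>n\<in>{..<N}. p n)"
  \<comment> \<open>The uniqueness clause of \<open>graded_algebra\<close> speaks of finitely
    supported families, whereas \<open>p\<close> and \<open>q\<close> may continue beyond degree
    \<open>N\<close>; both are cut off before they are compared.\<close>
  define cut where "cut = (\<lambda>p n. if n < N then p n else \<zero>)"
  have x: "x \<in> carrier A" unfolding x_def using assms(1) hcomp_closed by (intro finsum_closed) blast
  have cut: "(\<forall>n. cut p n \<in> hcomp A n) \<and> finite {n. cut p n \<noteq> \<zero>}
      \<and> x = (\<Oplus>n\<in>{n. cut p n \<noteq> \<zero>}. cut p n)"
    if "\<And>n. p n \<in> hcomp A n" "x = (\<Oplus>n\<in>{..<N}. p n)" for p
  proof (intro conjI allI)
    show h: "cut p n \<in> hcomp A n" for n using that hcomp_zero by (simp add: cut_def)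
    show "finite {n. cut p n \<noteq> \<zero>}" unfolding cut_def
      by (rule finite_subset[of _ "{..<N}"]) auto
    have "(\<Oplus>n\<in>{n. cut p n \<noteq> \<zero>}. cut p n) = (\<Oplus>n\<in>{..<N}. cut p n)"
      by (rule finsum_support) (use h in \<open>auto simp: cut_def split: if_splits\<close>)
    also have "\<dots> = x"
      unfolding that(2) cut_def using that(1) hcomp_closed by (intro finsum_cong') auto
    finally show "x = (\<Oplus>n\<in>{n. cut p n \<noteq> \<zero>}. cut p n)" by simp
  qed
  have "\<exists>!p. (\<forall>n. p n \<in> hcomp A n) \<and> finite {n. p n \<noteq> \<zero>} \<and> x = (\<Oplus>n\<in>{n. p n \<noteq> \<zero>}. p n)"
    using graded x unfolding graded_algebra_def by blast
  then have "cut p = cut q" using cut[of p] cut[of q] assms x_def by auto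
  then show ?thesis using \<open>n < N\<close> unfolding cut_def by metis
qed

text \<open>An additive subgroup \<open>P\<close> is graded exactly when it is contained in
  \<open>homog_sums P\<close>. In this form the condition is proved for ideals and for generated
  subalgebras alike.\<close>

definition homog_sums :: "'a set \<Rightarrow> 'a set" where
  "homog_sums P = {x. \<exists>p N. (\<forall>n. p n \<in> P \<inter> hcomp A n) \<and> x = (\<Oplus>n\<in>{..<N::nat}. p n)}"

lemma homog_sums_closed: "x \<in> homog_sums P \<Longrightarrow> x \<in> carrier A"
  unfolding homog_sums_def using hcomp_closed by (auto intro!: finsum_closed)

lemma homog_sums_single:
  assumes "x \<in> P" "x \<in> hcomp A n" "\<zero> \<in> P"
  shows "x \<in> homog_sums P"
proof -
  have "x = (\<Oplus>i\<in>{..<Suc n}. if n = i then x else \<zero>)"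
    using assms hcomp_closed add.finprod_singleton[of n "{..<Suc n}" "\<lambda>_. x"] by auto
  then show ?thesis
    unfolding homog_sums_def
    by (intro CollectI exI[of _ "\<lambda>i. if n = i then x else \<zero>"] exI[of _ "Suc n"])
       (use assms hcomp_zero in auto)
qed

lemma homog_sums_add:
  assumes "x \<in> homog_sums P" "y \<in> homog_sums P" "\<zero> \<in> P"
    and P: "\<And>x y. x \<in> P \<Longrightarrow> y \<in> P \<Longrightarrow> x \<oplus> y \<in> P"
  shows "x \<oplus> y \<in> homog_sums P"
proof -
  obtain p N where p: "\<And>n. p n \<in> P \<inter> hcomp A n" "x = (\<Oplus>n\<in>{..<N::nat}. p n)"
    using assms(1) unfolding homog_sums_def by blast
  obtain q K where q: "\<And>n. q n \<in> P \<inter> hcomp A n" "y = (\<Oplus>n\<in>{..<K::nat}. q n)"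
    using assms(2) unfolding homog_sums_def by blast
  define L where "L = max N K"
  have carr: "p n \<in> carrier A" "q n \<in> carrier A" for n using p q hcomp_closed by auto
  have "x \<oplus> y = (\<Oplus>n\<in>{..<L}. (if n < N then p n else \<zero>) \<oplus> (if n < K then q n else \<zero>))"
    unfolding p(2) q(2) using carr
    by (subst finsum_addf) (auto simp: finsum_pad[of p N L] finsum_pad[of q K L] L_def)
  then show ?thesis
    unfolding homog_sums_def
    by (intro CollectI exI conjI allI; assumption?) (use p q hcomp_zero hcomp_add assms(3) P in auto)
qed

lemma finsum_additive_closed:
  assumes "finite F" "\<And>i. i \<in> F \<Longrightarrow> f i \<in> P" "\<zero> \<in> P" "P \<subseteq> carrier A"
    and "\<And>x y. x \<in> P \<Longrightarrow> y \<in> P \<Longrightarrow> x \<oplus> y \<in> P"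
  shows "(\<Oplus>i\<in>F. f i) \<in> P"
  using assms(1,2)
proof (induction F rule: finite_induct)
  case (insert i F)
  then have "f \<in> F \<rightarrow> carrier A" "f i \<in> carrier A" using assms by auto
  then show ?case using insert assms by (simp add: finsum_insert)
qed (use assms in simp)

text \<open>\<open>Idl\<close> is an intersection of ideals and offers no induction. This describes
  the same set from below when \<open>U\<close> is homogeneous, adding one product at a time whose
  three factors are all homogeneous, so that every summand has a degree.\<close>

inductive_set homog_ideal :: "'a set \<Rightarrow> 'a set" for U where
  zero: "\<zero> \<in> homog_ideal U"
| step: "x \<in> homog_ideal U \<Longrightarrow> u \<in> U \<Longrightarrow> u \<in> hcomp A k \<Longrightarrow> a \<in> hcomp A m \<Longrightarrow> b \<in> hcomp A n \<Longrightarrow>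
    x \<oplus> a \<otimes> u \<otimes> b \<in> homog_ideal U"

lemma homog_ideal_closed: "x \<in> homog_ideal U \<Longrightarrow> x \<in> carrier A"
  by (induction rule: homog_ideal.induct) (use hcomp_closed in auto)

lemma homog_ideal_add:
  assumes "y \<in> homog_ideal U" "x \<in> homog_ideal U"
  shows "x \<oplus> y \<in> homog_ideal U"
  using assms
proof (induction rule: homog_ideal.induct)
  case (step y u k a m b n)
  have "x \<oplus> (y \<oplus> a \<otimes> u \<otimes> b) = (x \<oplus> y) \<oplus> a \<otimes> u \<otimes> b"
    using step hcomp_closed homog_ideal_closed by (simp add: a_assoc)
  then show ?case using step homog_ideal.step by auto
qed (use homog_ideal_closed in auto)

text \<open>A homogeneous multiplier is absorbed into the outer factor \<open>a\<close> or
  \<open>b\<close>; an arbitrary one is first split into its homogeneous components.\<close>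

lemma homog_ideal_mult:
  assumes "x \<in> homog_ideal U" "c \<in> carrier A"
  shows "c \<otimes> x \<in> homog_ideal U" "x \<otimes> c \<in> homog_ideal U"
proof -
  have left: "c \<otimes> x \<in> homog_ideal U" if c: "c \<in> hcomp A i" for c i
    using assms(1)
  proof (induction rule: homog_ideal.induct)
    case (step x u k a m b n)
    have "c \<otimes> (x \<oplus> a \<otimes> u \<otimes> b) = c \<otimes> x \<oplus> (c \<otimes> a) \<otimes> u \<otimes> b"
      using step hcomp_closed[OF c] hcomp_closed homog_ideal_closed by (simp add: r_distr m_assoc)
    then show ?case
      using homog_ideal.step[OF step.IH step.hyps(2,3) hcomp_mult[OF c step.hyps(4)] step.hyps(5)] by simp
  qed (use homog_ideal.zero c hcomp_closed in auto)
  have right: "x \<otimes> c \<in> homog_ideal U" if c: "c \<in> hcomp A i" for c i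
    using assms(1)
  proof (induction rule: homog_ideal.induct)
    case (step x u k a m b n)
    have "(x \<oplus> a \<otimes> u \<otimes> b) \<otimes> c = x \<otimes> c \<oplus> a \<otimes> u \<otimes> (b \<otimes> c)"
      using step hcomp_closed[OF c] hcomp_closed homog_ideal_closed by (simp add: l_distr m_assoc)
    then show ?case
      using homog_ideal.step[OF step.IH step.hyps(2-4) hcomp_mult[OF step.hyps(5) c]] by simp
  qed (use homog_ideal.zero c hcomp_closed in auto)
  obtain p N where p: "\<And>n. p n \<in> hcomp A n" "c = (\<Oplus>n\<in>{..<N::nat}. p n)"
    using ex_decomp[OF assms(2)] by blast
  have carr: "x \<in> carrier A" "\<And>n. p n \<in> carrier A"
    using assms p hcomp_closed homog_ideal_closed by auto
  have "c \<otimes> x = (\<Oplus>n\<in>{..<N}. p n \<otimes> x)"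
    unfolding p(2) using carr by (intro finsum_ldistr) auto
  also have "\<dots> \<in> homog_ideal U"
    using left[OF p(1)] by (intro finsum_additive_closed)
      (auto intro: homog_ideal.zero homog_ideal_add homog_ideal_closed)
  finally show "c \<otimes> x \<in> homog_ideal U" .
  have "x \<otimes> c = (\<Oplus>n\<in>{..<N}. x \<otimes> p n)"
    unfolding p(2) using carr by (intro finsum_rdistr) auto
  also have "\<dots> \<in> homog_ideal U"
    using right[OF p(1)] by (intro finsum_additive_closed)
      (auto intro: homog_ideal.zero homog_ideal_add homog_ideal_closed)
  finally show "x \<otimes> c \<in> homog_ideal U" .
qed

lemma genideal_eq_homog_ideal:
  assumes "\<And>u. u \<in> U \<Longrightarrow> \<exists>k. u \<in> hcomp A k"
  shows "Idl U = homog_ideal U"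
proof
  have "homog_ideal U \<subseteq> carrier A" using homog_ideal_closed by auto
  moreover have "\<ominus> x \<in> homog_ideal U" if "x \<in> homog_ideal U" for x
    using homog_ideal_mult(1)[OF that, of "\<ominus> \<one>"] homog_ideal_closed[OF that]
    by (simp add: l_minus)
  moreover have "homog_ideal U \<noteq> {}" using homog_ideal.zero by auto
  ultimately have "subgroup (homog_ideal U) (add_monoid A)"
    by (intro add.subgroupI) (auto intro: homog_ideal_add)
  then have "ideal (homog_ideal U) A"
    by (intro idealI) (auto intro: homog_ideal_mult ring_axioms)
  moreover have "U \<subseteq> homog_ideal U"
  proof
    fix u assume u: "u \<in> U"
    then obtain k where k: "u \<in> hcomp A k" using assms by blast
    have "\<zero> \<oplus> \<one> \<otimes> u \<otimes> \<one> \<in> homog_ideal U"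
      by (rule homog_ideal.step[OF _ u k one_hcomp one_hcomp]) (rule homog_ideal.zero)
    then show "u \<in> homog_ideal U" using hcomp_closed[OF k] by simp
  qed
  ultimately show "Idl U \<subseteq> homog_ideal U" by (rule genideal_minimal)
next
  have U: "U \<subseteq> carrier A" using assms hcomp_closed by blast
  interpret I: ideal "Idl U" A using genideal_ideal[OF U] .
  have "x \<in> Idl U" if "x \<in> homog_ideal U" for x using that
    by (induction rule: homog_ideal.induct)
      (use genideal_self[OF U] hcomp_closed I.I_l_closed I.I_r_closed in auto)
  then show "homog_ideal U \<subseteq> Idl U" by blast
qed

end

section \<open>Homomorphisms and quotients\<close>

text \<open>Homomorphisms without the extensionality that \<open>galg_hom\<close> demands, so that
  coset projections and unrestricted compositions qualify.\<close>

definition galg_map :: "('k::field, 'a) galg \<Rightarrow> ('k, 'b) galg \<Rightarrow> ('a \<Rightarrow> 'b) \<Rightarrow> bool" where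
  "galg_map A B h \<longleftrightarrow> h \<in> ring_hom A B \<and> (\<forall>c. \<forall>x\<in>carrier A. h (c \<odot>\<^bsub>A\<^esub> x) = c \<odot>\<^bsub>B\<^esub> h x) \<and>
     (\<forall>n. h ` hcomp A n \<subseteq> hcomp B n)"

lemma galg_hom_iff: "h \<in> galg_hom A B \<longleftrightarrow> galg_map A B h \<and> h \<in> extensional (carrier A)"
  unfolding galg_hom_def galg_map_def by auto

lemma galg_mapI:
  assumes "\<And>x. x \<in> carrier A \<Longrightarrow> h x \<in> carrier B"
    and "\<And>x y. x \<in> carrier A \<Longrightarrow> y \<in> carrier A \<Longrightarrow> h (x \<oplus>\<^bsub>A\<^esub> y) = h x \<oplus>\<^bsub>B\<^esub> h y"
    and "\<And>x y. x \<in> carrier A \<Longrightarrow> y \<in> carrier A \<Longrightarrow> h (x \<otimes>\<^bsub>A\<^esub> y) = h x \<otimes>\<^bsub>B\<^esub> h y"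
    and "h \<one>\<^bsub>A\<^esub> = \<one>\<^bsub>B\<^esub>"
    and "\<And>c x. x \<in> carrier A \<Longrightarrow> h (c \<odot>\<^bsub>A\<^esub> x) = c \<odot>\<^bsub>B\<^esub> h x"
    and "\<And>n x. x \<in> hcomp A n \<Longrightarrow> h x \<in> hcomp B n"
  shows "galg_map A B h"
  using assms unfolding galg_map_def ring_hom_def by auto

lemma galg_mapD:
  assumes "galg_map A B h"
  shows "\<And>x. x \<in> carrier A \<Longrightarrow> h x \<in> carrier B"
    and "\<And>x y. x \<in> carrier A \<Longrightarrow> y \<in> carrier A \<Longrightarrow> h (x \<oplus>\<^bsub>A\<^esub> y) = h x \<oplus>\<^bsub>B\<^esub> h y"
    and "\<And>x y. x \<in> carrier A \<Longrightarrow> y \<in> carrier A \<Longrightarrow> h (x \<otimes>\<^bsub>A\<^esub> y) = h x \<otimes>\<^bsub>B\<^esub> h y"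
    and "h \<one>\<^bsub>A\<^esub> = \<one>\<^bsub>B\<^esub>"
    and "\<And>c x. x \<in> carrier A \<Longrightarrow> h (c \<odot>\<^bsub>A\<^esub> x) = c \<odot>\<^bsub>B\<^esub> h x"
    and "\<And>n x. x \<in> hcomp A n \<Longrightarrow> h x \<in> hcomp B n"
  using assms unfolding galg_map_def ring_hom_def by blast+

lemma galg_map_zero:
  assumes "graded_algebra A" "graded_algebra B" "galg_map A B h"
  shows "h \<zero>\<^bsub>A\<^esub> = \<zero>\<^bsub>B\<^esub>"
proof -
  interpret A: galgebra A by unfold_locales fact
  interpret B: galgebra B by unfold_locales fact
  note h = galg_mapD[OF assms(3)]
  have "h (0 \<odot>\<^bsub>A\<^esub> \<zero>\<^bsub>A\<^esub>) = 0 \<odot>\<^bsub>B\<^esub> h \<zero>\<^bsub>A\<^esub>" by (rule h(5)) simp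
  then show ?thesis using h(1) by simp
qed

lemma galg_map_minus:
  assumes "graded_algebra A" "graded_algebra B" "galg_map A B h" "x \<in> carrier A"
  shows "h (\<ominus>\<^bsub>A\<^esub> x) = \<ominus>\<^bsub>B\<^esub> h x"
proof -
  interpret A: galgebra A by unfold_locales fact
  interpret B: galgebra B by unfold_locales fact
  note h = galg_mapD[OF assms(3)]
  show ?thesis using h(5)[of x "- 1"] h(1) assms(4) by (simp add: A.minus_one_smult B.minus_one_smult)
qed

lemma galg_map_comp:
  assumes "galg_map A B f" "galg_map B C g"
  shows "galg_map A C (\<lambda>x. g (f x))"
  by (rule galg_mapI) (simp_all add: galg_mapD[OF assms(1)] galg_mapD[OF assms(2)])

lemma galg_map_cong:
  assumes "galg_map A B f" "graded_algebra A" "\<And>x. x \<in> carrier A \<Longrightarrow> g x = f x"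
  shows "galg_map A B g"
proof -
  interpret A: galgebra A by unfold_locales fact
  show ?thesis
    by (rule galg_mapI)
      (use assms(3) A.hcomp_closed in \<open>auto simp: galg_mapD[OF assms(1)]\<close>)
qed

text \<open>Turns a check on generators into a statement about the generated ideal: an ideal that
  contains the generators contains all of \<open>Idl\<close>.\<close>

lemma galg_map_kernel_ideal:
  assumes "graded_algebra A" "graded_algebra B" "galg_map A B h"
  shows "ideal {x \<in> carrier A. h x = \<zero>\<^bsub>B\<^esub>} A"
proof -
  interpret A: galgebra A by unfold_locales fact
  interpret B: galgebra B by unfold_locales fact
  note h = galg_mapD[OF assms(3)] galg_map_minus[OF assms] galg_map_zero[OF assms]
  have "subgroup {x \<in> carrier A. h x = \<zero>\<^bsub>B\<^esub>} (add_monoid A)"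
    by (intro A.add.subgroupI) (use h in \<open>auto intro!: exI[of _ "\<zero>\<^bsub>A\<^esub>"]\<close>)
  then show ?thesis
    by (intro idealI) (use h A.ring_axioms in auto)
qed

text \<open>Both quotients of the construction are instances: the tensor algebra by the squares of
  vectors, and the exterior algebra by the derivatives of circuit monomials.\<close>

locale homog_quotient = galgebra A for A :: "('k::field, 'a) galg" (structure) +
  fixes U
  assumes homog_gens: "\<And>u. u \<in> U \<Longrightarrow> \<exists>k. u \<in> hcomp A k"
begin

abbreviation "I \<equiv> Idl U"
abbreviation "Q \<equiv> galg_quot A I"
abbreviation proj :: "'a \<Rightarrow> 'a set" where "proj x \<equiv> I +> x"

lemma gens_closed: "U \<subseteq> carrier A"
  using homog_gens hcomp_closed by blast

lemma gens_in_I: "u \<in> U \<Longrightarrow> u \<in> I"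
  using genideal_self[OF gens_closed] by auto

sublocale I: ideal I A
  using genideal_ideal[OF gens_closed] .

lemma I_closed: "x \<in> I \<Longrightarrow> x \<in> carrier A"
  by (rule I.a_Hcarr)

lemma I_smult: "x \<in> I \<Longrightarrow> c \<odot> x \<in> I"
  using I.I_l_closed[of x "c \<odot> \<one>"] I_closed by simp

lemma I_induct [consumes 1, case_names zero step]:
  assumes "x \<in> I" "P \<zero>"
    and "\<And>x u k a m b n. x \<in> I \<Longrightarrow> P x \<Longrightarrow> u \<in> U \<Longrightarrow> u \<in> hcomp A k \<Longrightarrow> a \<in> hcomp A m \<Longrightarrow>
      b \<in> hcomp A n \<Longrightarrow> P (x \<oplus> a \<otimes> u \<otimes> b)"
  shows "P x"
proof -
  have eq: "I = homog_ideal U" by (rule genideal_eq_homog_ideal) (rule homog_gens)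
  have "x \<in> homog_ideal U" using assms(1) eq by simp
  then show ?thesis
    by (induction rule: homog_ideal.induct) (use assms(2,3) eq in blast)+
qed

text \<open>The summands \<open>a \<otimes> u \<otimes> b\<close> are homogeneous members of
  \<open>I\<close>, hence \<open>I\<close> is a graded ideal; the independence of the components of
  the quotient depends on it.\<close>

lemma I_homog_sums: "x \<in> I \<Longrightarrow> x \<in> homog_sums I"
proof (induction rule: I_induct)
  case zero
  show ?case by (rule homog_sums_single[OF _ hcomp_zero]) auto
next
  case (step x u k a m b n)
  have "a \<otimes> u \<otimes> b \<in> I"
    using gens_in_I step hcomp_closed I.I_l_closed I.I_r_closed by auto
  then have "a \<otimes> u \<otimes> b \<in> homog_sums I"
    by (rule homog_sums_single[OF _ hcomp_mult[OF hcomp_mult[OF \<open>a \<in> _\<close> \<open>u \<in> hcomp A k\<close>] \<open>b \<in> _\<close>]]) simp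
  then show ?case using step by (intro homog_sums_add) auto
qed

lemma proj_eq_iff: "x \<in> carrier A \<Longrightarrow> y \<in> carrier A \<Longrightarrow> proj x = proj y \<longleftrightarrow> x \<ominus> y \<in> I"
  by (rule quotient_eq_iff_same_a_r_cos[OF I.is_ideal, symmetric])

lemma proj_zero: "proj \<zero> = I"
  by (simp add: I.a_rcos_const)

lemma proj_eq_zero_iff: "x \<in> carrier A \<Longrightarrow> proj x = I \<longleftrightarrow> x \<in> I"
  using I.rcos_const_imp_mem I.a_rcos_const by blast

lemma quot_simps:
  "carrier Q = proj ` carrier A" "\<zero>\<^bsub>Q\<^esub> = proj \<zero>" "\<one>\<^bsub>Q\<^esub> = proj \<one>" "hcomp Q n = proj ` hcomp A n"
  "x \<in> carrier A \<Longrightarrow> y \<in> carrier A \<Longrightarrow> proj x \<oplus>\<^bsub>Q\<^esub> proj y = proj (x \<oplus> y)"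
  "x \<in> carrier A \<Longrightarrow> y \<in> carrier A \<Longrightarrow> proj x \<otimes>\<^bsub>Q\<^esub> proj y = proj (x \<otimes> y)"
  using I.a_rcos_sum I.rcoset_mult_add
  by (auto simp: galg_quot_def FactRing_def A_RCOSETS_def RCOSETS_def a_r_coset_def[symmetric] proj_zero)

text \<open>The union in \<open>galg_quot\<close> runs over all representatives of the coset. Since
  \<open>I\<close> is closed under scalars, they all produce the same coset and the union
  collapses.\<close>

lemma quot_smult:
  assumes "x \<in> carrier A"
  shows "c \<odot>\<^bsub>Q\<^esub> proj x = proj (c \<odot> x)"
proof -
  have "proj (c \<odot> y) = proj (c \<odot> x)" if "y \<in> proj x" for y
  proof -
    obtain i where i: "i \<in> I" "y = i \<oplus> x" using \<open>y \<in> proj x\<close> by (auto simp: a_r_coset_def r_coset_def)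
    then have "c \<odot> y = c \<odot> i \<oplus> c \<odot> x" using assms I_closed by (simp add: smult_add)
    moreover have "(c \<odot> i \<oplus> c \<odot> x) \<ominus> c \<odot> x = c \<odot> i"
      using i I_closed assms by (simp add: minus_eq a_assoc r_neg)
    ultimately show ?thesis using I_smult[OF i(1)] assms I_closed i by (subst proj_eq_iff) auto
  qed
  moreover have "x \<in> proj x" using I.a_rcos_self[OF assms] .
  ultimately have "(\<Union>y\<in>proj x. proj (c \<odot> y)) = proj (c \<odot> x)" by (intro UN_constant_eq) blast+
  then show ?thesis by (simp add: galg_quot_def)
qed

lemma ring_quot: "ring Q"
proof -
  interpret R: ring "A Quot I" by (rule I.quotient_is_ring)
  have 1: "abelian_group Q"
    using R.a_assoc R.a_comm R.add.m_closed R.zero_closed R.l_zero R.add.l_inv_ex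
    by (intro abelian_groupI) (simp_all add: galg_quot_def)
  have 2: "monoid Q"
    using R.m_assoc R.one_closed R.m_closed R.l_one R.r_one
    by (intro monoidI) (simp_all add: galg_quot_def)
  show ?thesis
    by (rule ringI[OF 1 2]) (simp_all add: galg_quot_def R.l_distr R.r_distr)
qed

lemma graded_quot: "graded_algebra Q"
proof -
  interpret Q: ring Q by (rule ring_quot)
  have psum: "proj (\<Oplus>n\<in>{..<N}. p n) = (\<Oplus>\<^bsub>Q\<^esub>n\<in>{..<N::nat}. proj (p n))"
    if "\<And>n. p n \<in> carrier A" for p N
    by (rule finsum_hom) (use that in \<open>auto simp: quot_simps abelian_monoid_axioms Q.abelian_monoid_axioms\<close>)
  show ?thesis
  proof (rule graded_algebraI)
    fix x assume "x \<in> carrier Q"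
    then obtain y where y: "y \<in> carrier A" "x = proj y" by (auto simp: quot_simps)
    then obtain p N where p: "\<And>n. p n \<in> hcomp A n" "y = (\<Oplus>n\<in>{..<N::nat}. p n)"
      using ex_decomp by blast
    then have "x = (\<Oplus>\<^bsub>Q\<^esub>n\<in>{..<N}. proj (p n))" using psum[OF hcomp_closed[OF p(1)]] y(2) by simp
    then show "\<exists>p N. (\<forall>n. p n \<in> hcomp Q n) \<and> x = (\<Oplus>\<^bsub>Q\<^esub>n\<in>{..<N::nat}. p n)"
      by (intro exI[of _ "\<lambda>n. proj (p n)"] exI[of _ N]) (auto simp: quot_simps p(1))
  next
    fix q N and n :: nat
    assume q: "\<And>n. q n \<in> hcomp Q n" "(\<Oplus>\<^bsub>Q\<^esub>n\<in>{..<N}. q n) = \<zero>\<^bsub>Q\<^esub>" "n < N"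
    have "\<forall>n. \<exists>y. y \<in> hcomp A n \<and> q n = proj y" using q(1) by (auto simp: quot_simps)
    then obtain p where p: "\<And>n. p n \<in> hcomp A n" "\<And>n. q n = proj (p n)" by metis
    have pc: "\<And>n. p n \<in> carrier A" using p hcomp_closed by blast
    define x where "x = (\<Oplus>n\<in>{..<N}. p n)"
    have "proj x = I" unfolding x_def using psum[OF pc] q(2) by (simp add: p(2) quot_simps proj_zero)
    moreover have "x \<in> carrier A" unfolding x_def using pc by (intro finsum_closed) auto
    ultimately have "x \<in> I" using proj_eq_zero_iff by blast
    then obtain r K where r: "\<And>n. r n \<in> I \<inter> hcomp A n" "x = (\<Oplus>n\<in>{..<K::nat}. r n)"
      using I_homog_sums unfolding homog_sums_def by blast
    have rc: "\<And>n. r n \<in> carrier A" using r hcomp_closed by blast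
    define L where "L = max N K"
    \<comment> \<open>\<open>x\<close> now has two decompositions: the lifted components
      \<open>p n\<close>, and components \<open>r n\<close> that lie in \<open>I\<close> because
      \<open>I\<close> is graded. Uniqueness in \<open>A\<close> identifies them, which puts each
      \<open>p n\<close> into \<open>I\<close>.\<close>
    have "(\<Oplus>n\<in>{..<L}. if n < N then p n else \<zero>) = (\<Oplus>n\<in>{..<L}. if n < K then r n else \<zero>)"
      using finsum_pad[OF pc, of N L] finsum_pad[OF rc, of K L] x_def r(2) by (simp add: L_def)
    then have "(if n < N then p n else \<zero>) = (if n < K then r n else \<zero>)"
      by (rule decomp_unique[rotated 2]) (use p(1) r(1) hcomp_zero q(3) in \<open>auto simp: L_def\<close>)
    then have "p n \<in> I" using r(1) q(3) by (auto split: if_splits)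
    then show "q n = \<zero>\<^bsub>Q\<^esub>" using p(2) proj_eq_zero_iff[OF pc] by (simp add: quot_simps proj_zero)
  qed (use ring_quot hcomp_closed hcomp_zero hcomp_add hcomp_smult one_hcomp hcomp_mult in
     \<open>auto simp: quot_simps quot_smult smult_add add_smult\<close>)
qed

lemma proj_galg_map: "galg_map A Q proj"
  by (rule galg_mapI) (auto simp: quot_simps quot_smult)

lemma graded_comm_quot:
  assumes "graded_comm_algebra A"
  shows "graded_comm_algebra Q"
  unfolding graded_comm_algebra_def
proof (intro conjI allI ballI)
  fix m n x y assume "x \<in> hcomp Q m" "y \<in> hcomp Q n"
  then obtain a b where ab: "a \<in> hcomp A m" "b \<in> hcomp A n" "x = proj a" "y = proj b"
    by (auto simp: quot_simps)
  have "a \<otimes> b = (- 1) ^ (m * n) \<odot> (b \<otimes> a)"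
    using assms ab unfolding graded_comm_algebra_def by blast
  then show "x \<otimes>\<^bsub>Q\<^esub> y = (- 1) ^ (m * n) \<odot>\<^bsub>Q\<^esub> (y \<otimes>\<^bsub>Q\<^esub> x)"
    using hcomp_closed[OF ab(1)] hcomp_closed[OF ab(2)] ab(3,4) by (simp add: quot_simps quot_smult)
qed (rule graded_quot)

text \<open>Functions constant on cosets descend through a choice of representatives. The statement
  asks for no algebraic property, since it also has to carry the derivation, which is not
  multiplicative, to the exterior algebra.\<close>

lemma ex_quot_fun:
  assumes "\<And>x y. x \<in> carrier A \<Longrightarrow> y \<in> carrier A \<Longrightarrow> x \<ominus> y \<in> I \<Longrightarrow> f x = f y"
  obtains g where "\<And>x. x \<in> carrier A \<Longrightarrow> g (proj x) = f x" "g \<in> extensional (carrier Q)"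
proof
  define g where "g = restrict (\<lambda>V. f (SOME x. x \<in> carrier A \<and> proj x = V)) (carrier Q)"
  show "g \<in> extensional (carrier Q)" by (simp add: g_def)
  fix x assume x: "x \<in> carrier A"
  then have "\<exists>y. y \<in> carrier A \<and> proj y = proj x" by blast
  then have "(SOME y. y \<in> carrier A \<and> proj y = proj x) \<in> carrier A \<and>
    proj (SOME y. y \<in> carrier A \<and> proj y = proj x) = proj x" by (rule someI_ex)
  then have "f (SOME y. y \<in> carrier A \<and> proj y = proj x) = f x"
    using assms[OF _ x] proj_eq_iff[OF _ x] by blast
  then show "g (proj x) = f x" using x by (simp add: g_def quot_simps)
qed

lemma quot_universal:
  assumes "graded_algebra B" "galg_map A B h" "\<And>u. u \<in> U \<Longrightarrow> h u = \<zero>\<^bsub>B\<^esub>"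
  obtains g where "g \<in> galg_hom Q B" "\<And>x. x \<in> carrier A \<Longrightarrow> g (proj x) = h x"
proof -
  interpret B: galgebra B by unfold_locales fact
  note h = galg_mapD[OF assms(2)] galg_map_minus[OF graded assms(1,2)]
  have "I \<subseteq> {x \<in> carrier A. h x = \<zero>\<^bsub>B\<^esub>}"
    by (rule genideal_minimal[OF galg_map_kernel_ideal[OF graded assms(1,2)]])
       (use gens_closed assms(3) in auto)
  then have "h x = h y" if "x \<in> carrier A" "y \<in> carrier A" "x \<ominus> y \<in> I" for x y
  proof -
    have "h x \<oplus>\<^bsub>B\<^esub> \<ominus>\<^bsub>B\<^esub> h y = \<zero>\<^bsub>B\<^esub>" using \<open>I \<subseteq> _\<close> that h by (auto simp: minus_eq)
    then show ?thesis using h(1) that by (metis B.add.inv_closed B.minus_equality B.minus_minus)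
  qed
  then obtain g where g: "\<And>x. x \<in> carrier A \<Longrightarrow> g (proj x) = h x" "g \<in> extensional (carrier Q)"
    using ex_quot_fun[of h] by blast
  have "galg_map Q B g"
    by (rule galg_mapI) (use hcomp_closed in \<open>auto simp: quot_simps quot_smult g(1) h\<close>)
  then show ?thesis using that g by (simp add: galg_hom_iff)
qed

end

section \<open>The tensor algebra\<close>

definition word :: "'s list \<Rightarrow> 's list \<Rightarrow> 'k::field" where
  "word w = (\<lambda>u. if u = w then 1 else 0)"

lemma basis_vec_eq_word: "basis_vec s = word [s]"
  by (simp add: basis_vec_def word_def)

lemma word_tensor: "set w \<subseteq> S \<Longrightarrow> word w \<in> tensor_carrier S"
  by (auto simp: word_def tensor_carrier_def)

lemma tensor_simps:
  fixes S :: "'s set" and p q :: "'s list \<Rightarrow> 'k::field"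
  shows "carrier (tensor_algebra S) = (tensor_carrier S :: ('s list \<Rightarrow> 'k) set)"
  "\<zero>\<^bsub>tensor_algebra S\<^esub> = (\<lambda>w::'s list. 0 :: 'k)"
  "p \<oplus>\<^bsub>tensor_algebra S\<^esub> q = (\<lambda>w. p w + q w)"
  "c \<odot>\<^bsub>tensor_algebra S\<^esub> p = (\<lambda>w. c * p w)"
  "\<one>\<^bsub>tensor_algebra S\<^esub> = (word [] :: 's list \<Rightarrow> 'k)"
  "p \<otimes>\<^bsub>tensor_algebra S\<^esub> q = (\<lambda>w. \<Sum>i\<le>length w. p (take i w) * q (drop i w))"
  "hcomp (tensor_algebra S) n = {p :: 's list \<Rightarrow> 'k. p \<in> tensor_carrier S \<and> (\<forall>w. p w \<noteq> 0 \<longrightarrow> length w = n)}"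
  by (simp_all add: tensor_algebra_def word_def)

lemma tensor_add_closed:
  assumes "p \<in> tensor_carrier S" "q \<in> tensor_carrier S"
  shows "(\<lambda>w. p w + q w) \<in> tensor_carrier S"
proof -
  have "{w. p w + q w \<noteq> 0} \<subseteq> {w. p w \<noteq> 0} \<union> {w. q w \<noteq> 0}" by auto
  then show ?thesis using assms unfolding tensor_carrier_def
    by (auto intro: finite_subset)
qed

lemma tensor_smult_closed: "p \<in> tensor_carrier S \<Longrightarrow> (\<lambda>w. c * p w) \<in> tensor_carrier S"
  unfolding tensor_carrier_def by (auto elim: finite_subset[rotated])

lemma tensor_mult_nonzero:
  assumes "(p \<otimes>\<^bsub>tensor_algebra S\<^esub> q) w \<noteq> 0"
  obtains u v where "w = u @ v" "p u \<noteq> 0" "q v \<noteq> 0"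
proof -
  obtain i where "p (take i w) * q (drop i w) \<noteq> 0"
    using assms unfolding tensor_simps by (meson sum.neutral)
  then show ?thesis using that[of "take i w" "drop i w"] by auto
qed

lemma tensor_mult_closed:
  assumes "p \<in> tensor_carrier S" "q \<in> tensor_carrier S"
  shows "p \<otimes>\<^bsub>tensor_algebra S'\<^esub> q \<in> tensor_carrier S"
proof -
  have "{w. (p \<otimes>\<^bsub>tensor_algebra S'\<^esub> q) w \<noteq> 0} \<subseteq> (\<lambda>(u, v). u @ v) ` ({u. p u \<noteq> 0} \<times> {v. q v \<noteq> 0})"
    by (auto elim!: tensor_mult_nonzero intro!: image_eqI[of _ _ "(_, _)"])
  then have "finite {w. (p \<otimes>\<^bsub>tensor_algebra S'\<^esub> q) w \<noteq> 0}"
    using assms by (auto elim!: finite_subset simp: tensor_carrier_def)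
  then show ?thesis
    using assms by (auto simp: tensor_carrier_def elim!: tensor_mult_nonzero) blast+
qed

text \<open>Each coefficient of a product is a finite sum over the splittings of one word, so
  bilinearity holds for arbitrary coefficient families. It reduces later identities to products of
  words.\<close>

lemma tensor_mult_linear:
  "(p \<oplus>\<^bsub>tensor_algebra S\<^esub> q) \<otimes>\<^bsub>tensor_algebra S\<^esub> r = (p \<otimes>\<^bsub>tensor_algebra S\<^esub> r) \<oplus>\<^bsub>tensor_algebra S\<^esub> (q \<otimes>\<^bsub>tensor_algebra S\<^esub> r)"
  "r \<otimes>\<^bsub>tensor_algebra S\<^esub> (p \<oplus>\<^bsub>tensor_algebra S\<^esub> q) = (r \<otimes>\<^bsub>tensor_algebra S\<^esub> p) \<oplus>\<^bsub>tensor_algebra S\<^esub> (r \<otimes>\<^bsub>tensor_algebra S\<^esub> q)"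
  "(c \<odot>\<^bsub>tensor_algebra S\<^esub> p) \<otimes>\<^bsub>tensor_algebra S\<^esub> r = c \<odot>\<^bsub>tensor_algebra S\<^esub> (p \<otimes>\<^bsub>tensor_algebra S\<^esub> r)"
  "r \<otimes>\<^bsub>tensor_algebra S\<^esub> (c \<odot>\<^bsub>tensor_algebra S\<^esub> p) = c \<odot>\<^bsub>tensor_algebra S\<^esub> (r \<otimes>\<^bsub>tensor_algebra S\<^esub> p)"
  "\<zero>\<^bsub>tensor_algebra S\<^esub> \<otimes>\<^bsub>tensor_algebra S\<^esub> r = \<zero>\<^bsub>tensor_algebra S\<^esub>"
  "r \<otimes>\<^bsub>tensor_algebra S\<^esub> \<zero>\<^bsub>tensor_algebra S\<^esub> = \<zero>\<^bsub>tensor_algebra S\<^esub>"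
  by (auto simp: tensor_simps algebra_simps sum.distrib sum_distrib_left intro!: sum.cong)

lemma word_mult: "(word u :: 's list \<Rightarrow> 'k::field) \<otimes>\<^bsub>tensor_algebra S\<^esub> word v = word (u @ v)"
proof
  fix w :: "'s list"
  have "(\<Sum>i\<le>length w. word u (take i w) * word v (drop i w) :: 'k)
      = (\<Sum>i\<le>length w. if i = length u then word (u @ v) w else 0)"
  proof (rule sum.cong)
    fix i assume "i \<in> {..length w}"
    \<comment> \<open>The only splitting of \<open>w\<close> that can produce \<open>u\<close> and
      \<open>v\<close> cuts at position \<open>length u\<close>, so the sum has at most one nonzero
      term.\<close>
    then have iff: "take i w = u \<and> drop i w = v \<longleftrightarrow> i = length u \<and> w = u @ v"
      by (metis append_eq_conv_conj append_take_drop_id atMost_iff length_take min.absorb2)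
    have "word u (take i w) * word v (drop i w) = (if take i w = u \<and> drop i w = v then 1 else 0 :: 'k)"
      by (simp add: word_def)
    also have "\<dots> = (if i = length u then word (u @ v) w else 0)"
      unfolding iff by (simp add: word_def)
    finally show "word u (take i w) * word v (drop i w) = (if i = length u then word (u @ v) w else 0 :: 'k)" .
  qed simp
  also have "\<dots> = word (u @ v) w" by (auto simp: sum.delta word_def)
  finally show "(word u \<otimes>\<^bsub>tensor_algebra S\<^esub> word v) w = (word (u @ v) w :: 'k)"
    by (simp add: tensor_simps)
qed

text \<open>The induction runs over finite subsets of the support, through truncations of
  \<open>p\<close>. The step keeps \<open>p w \<noteq> 0\<close> for the original element
  \<open>p\<close>, from which the homogeneous version reads off the length of
  \<open>w\<close>.\<close>

lemma tensor_induct [consumes 1, case_names zero step]: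
  fixes p :: "'s list \<Rightarrow> 'k::field"
  assumes p: "p \<in> carrier (tensor_algebra S)"
    and "P \<zero>\<^bsub>tensor_algebra S\<^esub>"
    and step: "\<And>q c w. q \<in> carrier (tensor_algebra S) \<Longrightarrow> set w \<subseteq> S \<Longrightarrow> p w \<noteq> 0 \<Longrightarrow> P q \<Longrightarrow>
      P (q \<oplus>\<^bsub>tensor_algebra S\<^esub> c \<odot>\<^bsub>tensor_algebra S\<^esub> word w)"
  shows "P p"
proof -
  have "P (\<lambda>w. if w \<in> F then p w else 0)" if "finite F" "F \<subseteq> {w. p w \<noteq> 0}" for F
    using that
  proof (induction F rule: finite_induct)
    case (insert w F)
    let ?q = "\<lambda>w. if w \<in> F then p w else 0"
    have "?q \<in> carrier (tensor_algebra S)"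
      using p insert by (auto simp: tensor_simps tensor_carrier_def)
    moreover have "set w \<subseteq> S" using p insert by (auto simp: tensor_simps tensor_carrier_def)
    ultimately have "P (?q \<oplus>\<^bsub>tensor_algebra S\<^esub> p w \<odot>\<^bsub>tensor_algebra S\<^esub> word w)"
      using insert by (intro step) auto
    also have "?q \<oplus>\<^bsub>tensor_algebra S\<^esub> p w \<odot>\<^bsub>tensor_algebra S\<^esub> word w = (\<lambda>v. if v \<in> insert w F then p v else 0)"
      using insert by (auto simp: tensor_simps word_def)
    finally show ?case .
  qed (use assms(2) in \<open>simp add: tensor_simps\<close>)
  from this[of "{w. p w \<noteq> 0}"] have "P (\<lambda>w. if p w \<noteq> 0 then p w else 0)"
    using p by (simp add: tensor_simps tensor_carrier_def)
  moreover have "(\<lambda>w. if p w \<noteq> 0 then p w else 0) = p" by auto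
  ultimately show ?thesis by metis
qed

text \<open>Both sides are linear in each factor, so three nested inductions leave only words, where
  the product is concatenation.\<close>

lemma tensor_mult_assoc:
  assumes "p \<in> carrier (tensor_algebra S)" "q \<in> carrier (tensor_algebra S)" "r \<in> carrier (tensor_algebra S)"
  shows "p \<otimes>\<^bsub>tensor_algebra S\<^esub> q \<otimes>\<^bsub>tensor_algebra S\<^esub> r = p \<otimes>\<^bsub>tensor_algebra S\<^esub> (q \<otimes>\<^bsub>tensor_algebra S\<^esub> r)"
  using assms(1)
proof (induction p rule: tensor_induct)
  case (step p c u)
  have "word u \<otimes>\<^bsub>tensor_algebra S\<^esub> q \<otimes>\<^bsub>tensor_algebra S\<^esub> r = word u \<otimes>\<^bsub>tensor_algebra S\<^esub> (q \<otimes>\<^bsub>tensor_algebra S\<^esub> r)"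
    using assms(2)
  proof (induction q rule: tensor_induct)
    case (step q c v)
    have "word u \<otimes>\<^bsub>tensor_algebra S\<^esub> word v \<otimes>\<^bsub>tensor_algebra S\<^esub> r = word u \<otimes>\<^bsub>tensor_algebra S\<^esub> (word v \<otimes>\<^bsub>tensor_algebra S\<^esub> r)"
      using assms(3) by (induction r rule: tensor_induct) (simp_all add: tensor_mult_linear word_mult)
    then show ?case using step.IH by (simp add: tensor_mult_linear)
  qed (simp add: tensor_mult_linear)
  then show ?case using step.IH by (simp add: tensor_mult_linear)
qed (simp add: tensor_mult_linear)

lemma graded_tensor: "graded_algebra (tensor_algebra S :: ('k::field, 's list \<Rightarrow> 'k) galg)"
proof -
  let ?T = "tensor_algebra S :: ('k, 's list \<Rightarrow> 'k) galg"
  have one: "word [] \<otimes>\<^bsub>?T\<^esub> p = p" "p \<otimes>\<^bsub>?T\<^esub> word [] = p" if "p \<in> carrier ?T" for p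
    using that by (induction p rule: tensor_induct) (simp_all add: tensor_mult_linear word_mult)
  have ab: "abelian_group ?T"
  proof (rule abelian_groupI)
    fix p assume "p \<in> carrier ?T"
    then show "\<exists>q\<in>carrier ?T. q \<oplus>\<^bsub>?T\<^esub> p = \<zero>\<^bsub>?T\<^esub>"
      using tensor_smult_closed[of p S "- 1"] by (intro bexI[of _ "\<lambda>w. - 1 * p w"]) (auto simp: tensor_simps)
  qed (auto simp: tensor_simps tensor_add_closed add_ac, simp add: tensor_carrier_def)
  have mon: "monoid ?T"
    by (rule monoidI) (use tensor_mult_closed word_tensor[of "[]" S] one tensor_mult_assoc in
        \<open>auto simp: tensor_simps(1,5)\<close>)
  have ring: "ring ?T"
    by (rule ringI[OF ab mon]) (simp_all add: tensor_mult_linear)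
  interpret ring ?T by fact
  have fs: "(\<Oplus>\<^bsub>?T\<^esub>i\<in>F. f i) w = (\<Sum>i\<in>F. f i w)"
    if "finite F" "\<And>i. f i \<in> tensor_carrier S" for f :: "nat \<Rightarrow> _" and F w
    using that
  proof (induction F rule: finite_induct)
    case (insert i F)
    then show ?case by (subst finsum_insert) (auto simp: tensor_simps)
  qed (simp add: tensor_simps)
  show ?thesis
  proof (rule graded_algebraI[OF ring])
    fix p assume p: "p \<in> carrier ?T"
    \<comment> \<open>\<open>N\<close> exceeds the length of every word in the support;
      \<open>insert 0\<close> makes the maximum meaningful for the zero element.\<close>
    define N where "N = Suc (Max (insert 0 (length ` {w. p w \<noteq> 0})))"
    define q where "q = (\<lambda>n w. if length w = n then p w else 0)"
    have q: "q n \<in> hcomp ?T n" for n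
      using p unfolding q_def tensor_simps tensor_carrier_def by (auto elim: finite_subset[rotated])
    have fin: "finite {w. p w \<noteq> 0}" using p by (simp add: tensor_simps tensor_carrier_def)
    have N: "length w < N" if "p w \<noteq> 0" for w
      unfolding N_def using that fin by (auto simp: less_Suc_eq_le intro!: Max_ge)
    have "p = (\<Oplus>\<^bsub>?T\<^esub>n\<in>{..<N}. q n)"
    proof
      fix w
      have "(\<Oplus>\<^bsub>?T\<^esub>n\<in>{..<N}. q n) w = (\<Sum>n<N. q n w)"
        using q by (intro fs) (auto simp: tensor_simps)
      also have "\<dots> = (if length w < N then p w else 0)" by (simp add: q_def)
      finally show "p w = (\<Oplus>\<^bsub>?T\<^esub>n\<in>{..<N}. q n) w" using N[of w] by auto
    qed
    then show "\<exists>p' N. (\<forall>n. p' n \<in> hcomp ?T n) \<and> p = (\<Oplus>\<^bsub>?T\<^esub>n\<in>{..<N::nat}. p' n)"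
      using q by blast
  next
    fix p N and n :: nat
    assume p: "\<And>n. p n \<in> hcomp ?T n" "(\<Oplus>\<^bsub>?T\<^esub>n\<in>{..<N}. p n) = \<zero>\<^bsub>?T\<^esub>" "n < N"
    show "p n = \<zero>\<^bsub>?T\<^esub>"
    proof
      fix w
      show "p n w = \<zero>\<^bsub>?T\<^esub> w"
      proof (cases "length w = n")
        case True
        \<comment> \<open>Evaluated at a word of length \<open>n\<close>, the sum receives a
          contribution from \<open>p n\<close> only; all other components vanish there.\<close>
        have "0 = (\<Sum>i<N. p i w)"
          using fs[of "{..<N}" p w] p(1,2) by (simp add: tensor_simps)
        also have "\<dots> = (\<Sum>i<N. if i = n then p n w else 0)"
          using p(1) True by (intro sum.cong) (auto simp: tensor_simps)
        also have "\<dots> = p n w" using p(3) by simp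
        finally show ?thesis by (simp add: tensor_simps)
      next
        case False
        then show ?thesis using p(1)[of n] by (auto simp: tensor_simps)
      qed
    qed
  next
    fix m n x y assume "x \<in> hcomp ?T m" "y \<in> hcomp ?T n"
    then show "x \<otimes>\<^bsub>?T\<^esub> y \<in> hcomp ?T (m + n)"
      using tensor_mult_closed[of x S y S]
      by (auto simp: tensor_simps(7) elim!: tensor_mult_nonzero)
  next
    fix c x y
    show "c \<odot>\<^bsub>?T\<^esub> (x \<otimes>\<^bsub>?T\<^esub> y) = (c \<odot>\<^bsub>?T\<^esub> x) \<otimes>\<^bsub>?T\<^esub> y"
      "c \<odot>\<^bsub>?T\<^esub> (x \<otimes>\<^bsub>?T\<^esub> y) = x \<otimes>\<^bsub>?T\<^esub> (c \<odot>\<^bsub>?T\<^esub> y)"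
      by (simp_all only: tensor_mult_linear)
  next
    fix n x y assume *: "x \<in> hcomp ?T n" "y \<in> hcomp ?T n"
    have "length w = n" if "x w + y w \<noteq> 0" for w
      using that * by (cases "x w = 0") (auto simp: tensor_simps)
    then show "x \<oplus>\<^bsub>?T\<^esub> y \<in> hcomp ?T n"
      using * tensor_add_closed[of x S y] by (auto simp: tensor_simps)
  qed (auto simp: tensor_simps(1,2,3,4,5,7) tensor_smult_closed tensor_add_closed algebra_simps
        word_tensor, auto simp: tensor_carrier_def word_def split: if_splits)
qed

lemma word_closed: "set w \<subseteq> S \<Longrightarrow> (word w :: 's list \<Rightarrow> 'k::field) \<in> carrier (tensor_algebra S)"
  by (simp add: word_tensor tensor_simps)

lemma word_hcomp: "set w \<subseteq> S \<Longrightarrow> (word w :: 's list \<Rightarrow> 'k::field) \<in> hcomp (tensor_algebra S) (length w)"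
  using word_tensor[of w S] by (auto simp: tensor_simps word_def)

lemma tensor_hcomp_induct [consumes 1, case_names zero step]:
  fixes p :: "'s list \<Rightarrow> 'k::field"
  assumes p: "p \<in> hcomp (tensor_algebra S) n"
    and "P \<zero>\<^bsub>tensor_algebra S\<^esub>"
    and step: "\<And>q c w. q \<in> hcomp (tensor_algebra S) n \<Longrightarrow> set w \<subseteq> S \<Longrightarrow> length w = n \<Longrightarrow> P q \<Longrightarrow>
      P (q \<oplus>\<^bsub>tensor_algebra S\<^esub> c \<odot>\<^bsub>tensor_algebra S\<^esub> word w)"
  shows "P p"
proof -
  interpret T: galgebra "tensor_algebra S :: ('k, 's list \<Rightarrow> 'k) galg"
    by unfold_locales (rule graded_tensor)
  have "p \<in> carrier (tensor_algebra S)" using p T.hcomp_closed by blast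
  \<comment> \<open>Homogeneity of the partial sums is proved along with \<open>P\<close>, because
    the step of the homogeneous induction requires it.\<close>
  then have "P p \<and> p \<in> hcomp (tensor_algebra S) n"
  proof (induction p rule: tensor_induct)
    case (step q c w)
    have "length w = n" using p step(3) by (simp add: tensor_simps)
    then show ?case
      using step assms(3)[of q w c] T.hcomp_add[OF _ T.hcomp_smult[OF word_hcomp[OF step(2)]]] by simp
  qed (use assms(2) T.hcomp_zero in blast)
  then show ?thesis by blast
qed

section \<open>Linear extension from words and the universal property of the tensor algebra\<close>

context galgebra
begin

text \<open>The linear extension of a function on words. With products of letter images it gives the
  algebra maps out of the tensor algebra, with \<open>word_deriv\<close> the derivation.\<close>

definition lin :: "('s list \<Rightarrow> 'a) \<Rightarrow> ('s list \<Rightarrow> 'k) \<Rightarrow> 'a" where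
  "lin b p = (\<Oplus>w\<in>{w. p w \<noteq> 0}. p w \<odot> b w)"

context
  fixes S :: "'s set" and b :: "'s list \<Rightarrow> 'a"
  assumes b: "\<And>w. set w \<subseteq> S \<Longrightarrow> b w \<in> carrier A"
begin

text \<open>Sums over exact supports do not add up termwise, since coefficients may cancel; over a
  common finite superset they do.\<close>

lemma lin_superset:
  assumes "finite F" "{w. p w \<noteq> 0} \<subseteq> F" "\<And>w. w \<in> F \<Longrightarrow> set w \<subseteq> S"
  shows "lin b p = (\<Oplus>w\<in>F. p w \<odot> b w)"
  unfolding lin_def
  by (rule add.finprod_mono_neutral_cong_left) (use assms b in auto)

lemma lin_closed: "p \<in> tensor_carrier S \<Longrightarrow> lin b p \<in> carrier A"
  unfolding lin_def tensor_carrier_def using b by (intro finsum_closed) auto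

lemma lin_add:
  assumes "p \<in> tensor_carrier S" "q \<in> tensor_carrier S"
  shows "lin b (p \<oplus>\<^bsub>tensor_algebra S\<^esub> q) = lin b p \<oplus> lin b q"
proof -
  let ?F = "{w. p w \<noteq> 0} \<union> {w. q w \<noteq> 0}"
  have F: "finite ?F" "\<And>w. w \<in> ?F \<Longrightarrow> set w \<subseteq> S" using assms by (auto simp: tensor_carrier_def)
  have "lin b (p \<oplus>\<^bsub>tensor_algebra S\<^esub> q) = (\<Oplus>w\<in>?F. (p w + q w) \<odot> b w)"
    using F by (subst lin_superset[of ?F]) (auto simp: tensor_simps)
  also have "\<dots> = (\<Oplus>w\<in>?F. p w \<odot> b w \<oplus> q w \<odot> b w)"
    using F b by (intro finsum_cong') (auto simp: add_smult)
  also have "\<dots> = (\<Oplus>w\<in>?F. p w \<odot> b w) \<oplus> (\<Oplus>w\<in>?F. q w \<odot> b w)"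
    using F b by (intro finsum_addf) auto
  also have "(\<Oplus>w\<in>?F. p w \<odot> b w) = lin b p"
    by (rule lin_superset[OF F(1) _ F(2), symmetric]) auto
  also have "(\<Oplus>w\<in>?F. q w \<odot> b w) = lin b q"
    by (rule lin_superset[OF F(1) _ F(2), symmetric]) auto
  finally show ?thesis .
qed

lemma lin_smult:
  assumes "p \<in> tensor_carrier S"
  shows "lin b (c \<odot>\<^bsub>tensor_algebra S\<^esub> p) = c \<odot> lin b p"
proof -
  let ?F = "{w. p w \<noteq> 0}"
  have F: "finite ?F" "\<And>w. w \<in> ?F \<Longrightarrow> set w \<subseteq> S" using assms by (auto simp: tensor_carrier_def)
  have "lin b (c \<odot>\<^bsub>tensor_algebra S\<^esub> p) = (\<Oplus>w\<in>?F. (c * p w) \<odot> b w)"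
    using F by (subst lin_superset[of ?F]) (auto simp: tensor_simps)
  also have "\<dots> = (\<Oplus>w\<in>?F. c \<odot> (p w \<odot> b w))"
    using F b by (intro finsum_cong') auto
  also have "\<dots> = c \<odot> lin b p"
    unfolding lin_def using F b by (intro finsum_smult[symmetric]) auto
  finally show ?thesis .
qed

lemma lin_word: "set w \<subseteq> S \<Longrightarrow> lin b (word w) = b w"
  using b by (subst lin_superset[of "{w}"]) (auto simp: word_def)

lemma lin_zero: "lin b \<zero>\<^bsub>tensor_algebra S\<^esub> = \<zero>"
  by (simp add: lin_def tensor_simps)

lemma lin_hcomp:
  assumes "p \<in> hcomp (tensor_algebra S) n" "\<And>w. set w \<subseteq> S \<Longrightarrow> length w = n \<Longrightarrow> b w \<in> hcomp A m"
  shows "lin b p \<in> hcomp A m"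
  unfolding lin_def
  by (rule finsum_additive_closed)
    (use assms in \<open>auto simp: tensor_simps tensor_carrier_def hcomp_zero hcomp_closed intro!: hcomp_smult hcomp_add\<close>)

end

definition wprod :: "('s \<Rightarrow> 'a) \<Rightarrow> 's list \<Rightarrow> 'a" where
  "wprod b w = foldr (\<lambda>s x. b s \<otimes> x) w \<one>"

lemma wprod_simps [simp]: "wprod b [] = \<one>" "wprod b (s # w) = b s \<otimes> wprod b w"
  by (simp_all add: wprod_def)

lemma wprod_hcomp:
  assumes "\<And>s. s \<in> S \<Longrightarrow> b s \<in> hcomp A 1"
  shows "set w \<subseteq> S \<Longrightarrow> wprod b w \<in> hcomp A (length w)"
proof (induction w)
  case (Cons s w)
  then show ?case using hcomp_mult[of "b s" 1 "wprod b w" "length w"] assms by simp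
qed (simp add: one_hcomp)

lemma wprod_append:
  assumes "\<And>s. s \<in> S \<Longrightarrow> b s \<in> carrier A"
  shows "set u \<subseteq> S \<Longrightarrow> set v \<subseteq> S \<Longrightarrow>
    wprod b v \<in> carrier A \<and> wprod b (u @ v) = wprod b u \<otimes> wprod b v \<and> wprod b u \<in> carrier A"
proof (induction u)
  case Nil
  then show ?case using assms by (induction v) auto
next
  case (Cons s u)
  then show ?case using assms by (simp add: m_assoc)
qed

text \<open>Both sides of multiplicativity are bilinear, so it is a matter of words, where it is
  \<open>wprod_append\<close>. Placing the letter images in degree 1 makes word length correspond to
  degree.\<close>

lemma tensor_universal:
  fixes S :: "'s set"
  assumes b: "\<And>s. s \<in> S \<Longrightarrow> b s \<in> hcomp A 1"
  shows "galg_map (tensor_algebra S) A (lin (wprod b))"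
    and "\<And>s. s \<in> S \<Longrightarrow> lin (wprod b) (basis_vec s) = b s"
proof -
  let ?T = "tensor_algebra S :: ('k, 's list \<Rightarrow> 'k) galg"
  interpret T: galgebra ?T by unfold_locales (rule graded_tensor)
  have hc: "\<And>w. set w \<subseteq> S \<Longrightarrow> wprod b w \<in> hcomp A (length w)" by (rule wprod_hcomp[OF b])
  then have c: "\<And>w. set w \<subseteq> S \<Longrightarrow> wprod b w \<in> carrier A" using hcomp_closed by blast
  have bc: "\<And>s. s \<in> S \<Longrightarrow> b s \<in> carrier A" using b hcomp_closed by blast
  note lin = lin_add[where S = S and b = "wprod b", OF c] lin_smult[where S = S and b = "wprod b", OF c]
    lin_word[where S = S and b = "wprod b", OF c] lin_closed[where S = S and b = "wprod b", OF c]
    lin_zero[where S = S and b = "wprod b", OF c]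
  have tc: "x \<in> tensor_carrier S \<longleftrightarrow> x \<in> carrier ?T" for x by (simp add: tensor_simps)
  note lin = lin[unfolded tc]
  have mult: "lin (wprod b) (p \<otimes>\<^bsub>?T\<^esub> q) = lin (wprod b) p \<otimes> lin (wprod b) q"
    if "p \<in> carrier ?T" "q \<in> carrier ?T" for p q
    using that(1)
  proof (induction p rule: tensor_induct)
    case (step p c u)
    have "lin (wprod b) (word u \<otimes>\<^bsub>?T\<^esub> q) = wprod b u \<otimes> lin (wprod b) q"
      using that(2)
    proof (induction q rule: tensor_induct)
      case (step q d v)
      have "word u \<otimes>\<^bsub>?T\<^esub> q \<in> carrier ?T"
        using step \<open>set u \<subseteq> S\<close> by (simp add: word_closed)
      then show ?case
        using step \<open>set u \<subseteq> S\<close> by (simp add: tensor_mult_linear lin word_mult word_closed c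
          T.smult_closed wprod_append[OF bc] r_distr)
    qed (use step in \<open>simp add: lin tensor_mult_linear c\<close>)
    then show ?case
      using step that(2) by (simp add: tensor_mult_linear lin word_closed c l_distr)
  qed (simp add: tensor_mult_linear lin that(2))
  show "galg_map ?T A (lin (wprod b))"
  proof (rule galg_mapI)
    show "lin (wprod b) \<one>\<^bsub>?T\<^esub> = \<one>" by (simp add: tensor_simps(5) lin)
    show "lin (wprod b) p \<in> hcomp A n" if "p \<in> hcomp ?T n" for p n
      by (rule lin_hcomp[where S = S and b = "wprod b", OF c that]) (use hc in auto)
  qed (simp_all add: lin mult)
  show "lin (wprod b) (basis_vec s) = b s" if "s \<in> S" for s
    using that bc by (simp add: basis_vec_eq_word lin)
qed

lemma tensor_map_eq:
  assumes "galg_map (tensor_algebra S) A g" "galg_map (tensor_algebra S) A h"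
    and "\<And>s. s \<in> S \<Longrightarrow> g (basis_vec s) = h (basis_vec s)" "p \<in> carrier (tensor_algebra S)"
  shows "g p = h p"
proof -
  let ?T = "tensor_algebra S :: ('k, 'b list \<Rightarrow> 'k) galg"
  interpret T: galgebra ?T by unfold_locales (rule graded_tensor)
  note gh = galg_mapD[OF assms(1)] galg_mapD[OF assms(2)] galg_map_zero[OF graded_tensor graded assms(1)]
    galg_map_zero[OF graded_tensor graded assms(2)]
  have w: "g (word w) = h (word w)" if "set w \<subseteq> S" for w
    using that
  proof (induction w)
    case Nil
    then show ?case using gh(4,10) by (simp add: tensor_simps)
  next
    case (Cons s w)
    have "word (s # w) = word [s] \<otimes>\<^bsub>?T\<^esub> word w" by (simp add: word_mult)
    then show ?case using Cons gh assms(3) by (simp add: word_closed basis_vec_eq_word)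
  qed
  show ?thesis using assms(4)
    by (induction p rule: tensor_induct) (simp_all add: gh w word_closed)
qed

end

subsection \<open>The derivation of the tensor algebra\<close>

text \<open>The graded Leibniz rule for a leading letter of derivative 1, used as a recursion on
  words. The operations of the tensor algebra do not depend on the letter set, so
  \<open>UNIV\<close> keeps \<open>S\<close> out of the definition.\<close>

primrec word_deriv :: "'s list \<Rightarrow> 's list \<Rightarrow> 'k::field" where
  "word_deriv [] = (\<lambda>w. 0)"
| "word_deriv (s # w) = word w \<oplus>\<^bsub>tensor_algebra UNIV\<^esub>
    (- 1) \<odot>\<^bsub>tensor_algebra UNIV\<^esub> (word [s] \<otimes>\<^bsub>tensor_algebra UNIV\<^esub> word_deriv w)"

text \<open>A named structure for the tensor algebra gives index-free ring syntax and the results of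
  \<open>galgebra\<close>; the \<open>T_\<close> lemmas are the earlier facts folded to it.\<close>

locale tensor_alg =
  fixes S :: "'s set" and T :: "('k::field, 's list \<Rightarrow> 'k) galg" (structure)
  assumes T_def: "T = tensor_algebra S"

sublocale tensor_alg \<subseteq> galgebra T
  unfolding T_def by unfold_locales (rule graded_tensor)

context tensor_alg
begin

lemmas T_simps = tensor_simps[where 's = 's and 'k = 'k and S = S, folded T_def]
lemmas T_word_mult = word_mult[where 's = 's and 'k = 'k and S = S, folded T_def]
lemmas T_word_closed = word_closed[where 's = 's and 'k = 'k and S = S, folded T_def]
lemmas T_word_hcomp = word_hcomp[where 's = 's and 'k = 'k and S = S, folded T_def]
lemmas T_induct [consumes 1, case_names zero step] =
  tensor_induct[where 's = 's and 'k = 'k and S = S, folded T_def]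
lemmas T_hcomp_induct [consumes 1, case_names zero step] =
  tensor_hcomp_induct[where 's = 's and 'k = 'k and S = S, folded T_def]

lemma word_deriv_Cons: "word_deriv (s # w) = word w \<oplus> (- 1) \<odot> (word [s] \<otimes> word_deriv w)"
  by (simp add: tensor_simps T_simps)

lemma word_deriv_Nil: "word_deriv [] = \<zero>"
  by (simp add: T_simps)

lemma word_deriv_closed: "set w \<subseteq> S \<Longrightarrow> word_deriv w \<in> carrier T"
  by (induction w) (auto simp: word_deriv_Cons word_deriv_Nil T_word_closed simp del: word_deriv.simps)

lemma word_deriv_hcomp: "set w \<subseteq> S \<Longrightarrow> length w = Suc n \<Longrightarrow> word_deriv w \<in> hcomp T n"
proof (induction w arbitrary: n)
  case (Cons s w)
  show ?case
  proof (cases n)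
    case 0
    then have "w = []" using Cons.prems by simp
    then show ?thesis using T_word_hcomp[of "[]"] 0 T_word_closed[of "[s]"] Cons.prems
      by (simp add: word_deriv_Cons word_deriv_Nil one_hcomp T_word_closed del: word_deriv.simps)
  next
    case (Suc m)
    then have "word_deriv w \<in> hcomp T m" using Cons by simp
    then have "word [s] \<otimes> word_deriv w \<in> hcomp T n"
      using hcomp_mult[OF T_word_hcomp[of "[s]"]] Cons.prems Suc by fastforce
    then show ?thesis using T_word_hcomp[of w] Cons.prems
      by (simp add: word_deriv_Cons hcomp_add hcomp_smult del: word_deriv.simps)
  qed
qed simp

abbreviation "D \<equiv> lin word_deriv"

lemma T_carrier: "x \<in> tensor_carrier S \<longleftrightarrow> x \<in> carrier T"
  by (simp add: T_simps)

lemma D_closed: "p \<in> carrier T \<Longrightarrow> D p \<in> carrier T"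
  using lin_closed[where S = S and b = word_deriv, OF word_deriv_closed] by (simp add: T_carrier)

lemma D_simps:
  "p \<in> carrier T \<Longrightarrow> q \<in> carrier T \<Longrightarrow> D (p \<oplus> q) = D p \<oplus> D q"
  "p \<in> carrier T \<Longrightarrow> D (c \<odot> p) = c \<odot> D p"
  "set w \<subseteq> S \<Longrightarrow> D (word w) = word_deriv w"
  "D \<zero> = \<zero>"
  using lin_add[where S = S and b = word_deriv, OF word_deriv_closed] lin_smult[where S = S and b = word_deriv, OF word_deriv_closed] lin_word[where S = S and b = word_deriv, OF word_deriv_closed]
    lin_zero[where S = S and b = word_deriv, OF word_deriv_closed]
  by (simp_all add: T_carrier T_def[symmetric])

lemma D_one: "D \<one> = \<zero>"
  by (simp add: T_simps(5) D_simps T_simps(2))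

lemma D_hcomp: "p \<in> hcomp T (Suc n) \<Longrightarrow> D p \<in> hcomp T n"
  by (rule lin_hcomp[where S = S and b = word_deriv, OF word_deriv_closed])
     (auto simp: T_def[symmetric] word_deriv_hcomp)

text \<open>The empty word is the only word of length 0. For a vector \<open>v\<close> of degree 1
  this makes \<open>D v\<close> a scalar, which commutes with \<open>v\<close>; the vanishing of
  \<open>D (v \<otimes> v)\<close> rests on that.\<close>

lemma hcomp_zero_scalar: "p \<in> hcomp T 0 \<Longrightarrow> \<exists>c. p = c \<odot> \<one>"
proof (induction p rule: T_hcomp_induct)
  case zero
  have "\<zero> = 0 \<odot> \<one>" by simp
  then show ?case by blast
next
  case (step q c w)
  then obtain d where "q = d \<odot> \<one>" by blast
  then have "q \<oplus> c \<odot> word w = (d + c) \<odot> \<one>" using step by (simp add: T_simps(5) T_word_closed add_smult)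
  then show ?case by blast
qed

lemma D_hcomp_zero: "p \<in> hcomp T 0 \<Longrightarrow> D p = \<zero>"
  using hcomp_zero_scalar[of p] by (auto simp: D_simps D_one)

text \<open>Linearity in \<open>z\<close> reduces this to a word, where it is the defining recursion
  of \<open>word_deriv\<close>.\<close>

lemma D_Cons:
  assumes "s \<in> S" "z \<in> carrier T"
  shows "D (word [s] \<otimes> z) = z \<oplus> (- 1) \<odot> (word [s] \<otimes> D z)"
  using assms(2)
proof (induction z rule: T_induct)
  case zero
  then show ?case using assms(1) by (simp add: D_simps T_word_closed)
next
  case (step z c w)
  have "D (word [s] \<otimes> word w) = word w \<oplus> (- 1) \<odot> (word [s] \<otimes> D (word w))"
    using step assms(1) by (simp add: T_word_mult D_simps word_deriv_Cons del: word_deriv.simps)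
  then show ?case
    using step assms(1) by (simp add: D_simps D_closed T_word_closed word_deriv_closed r_distr smult_add a_ac mult.commute)
qed

text \<open>For a word the letters are peeled off one by one with \<open>D_Cons\<close>, each
  contributing one sign. Linearity in \<open>x\<close> then finishes, as all words of a homogeneous
  \<open>x\<close> have the same length and hence the same sign.\<close>

lemma D_mult:
  assumes "x \<in> hcomp T m" "y \<in> carrier T"
  shows "D (x \<otimes> y) = D x \<otimes> y \<oplus> (- 1) ^ m \<odot> (x \<otimes> D y)"
proof -
  have word: "D (word w \<otimes> y) = D (word w) \<otimes> y \<oplus> (- 1) ^ length w \<odot> (word w \<otimes> D y)"
    if "set w \<subseteq> S" for w
    using that
  proof (induction w)
    case Nil
    then show ?case using assms(2) D_closed[OF assms(2)] D_one by (simp add: T_simps(5)[symmetric])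
  next
    case (Cons s w)
    have c: "word [s] \<in> carrier T" "word w \<in> carrier T" "D (word w) \<in> carrier T" "D y \<in> carrier T"
      using Cons.prems assms(2) by (auto simp: T_word_closed D_closed)
    have "D (word (s # w) \<otimes> y) = D (word [s] \<otimes> (word w \<otimes> y))"
      using c assms(2) by (simp add: T_word_mult m_assoc[symmetric])
    also have "\<dots> = word w \<otimes> y \<oplus> (- 1) \<odot> (word [s] \<otimes> D (word w \<otimes> y))"
      using Cons.prems c assms(2) by (intro D_Cons) auto
    also have "\<dots> = (word w \<oplus> (- 1) \<odot> (word [s] \<otimes> D (word w))) \<otimes> y
        \<oplus> (- 1) ^ length (s # w) \<odot> ((word [s] \<otimes> word w) \<otimes> D y)"
      using Cons c assms(2) by (simp add: r_distr l_distr smult_add a_assoc m_assoc)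
    also have "word w \<oplus> (- 1) \<odot> (word [s] \<otimes> D (word w)) = D (word (s # w))"
      using Cons.prems by (simp add: D_simps word_deriv_Cons del: word_deriv.simps)
    finally show ?case by (simp add: T_word_mult)
  qed
  show ?thesis
    using assms(1)
  proof (induction x rule: T_hcomp_induct)
    case (step q c w)
    then show ?case using assms(2) D_closed[of q] D_closed[of "word w"] D_closed[OF assms(2)] word[of w]
      by (simp add: D_simps(1,2) T_word_closed hcomp_closed l_distr smult_add a_ac mult.commute)
  qed (use assms(2) D_closed[OF assms(2)] in \<open>simp add: D_simps\<close>)
qed

end

section \<open>The exterior algebra\<close>

context tensor_alg
begin

definition squares :: "('s list \<Rightarrow> 'k) set" where
  "squares = {v \<otimes> v |v. v \<in> hcomp T 1}"

sublocale ext: homog_quotient T squares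
proof
  fix u assume "u \<in> squares"
  then show "\<exists>k. u \<in> hcomp T k" unfolding squares_def using hcomp_mult by blast
qed

lemma square_in_I: "v \<in> hcomp T 1 \<Longrightarrow> v \<otimes> v \<in> ext.I"
  by (rule ext.gens_in_I) (auto simp: squares_def)

text \<open>For a generator,
  \<open>D (v \<otimes> v) = D v \<otimes> v - v \<otimes> D v = 0\<close> because
  \<open>D v\<close> is a scalar. The Leibniz rule then leaves a generator as a factor in every term
  of \<open>D (a \<otimes> u \<otimes> b)\<close>.\<close>

lemma D_ext_ideal: "x \<in> ext.I \<Longrightarrow> D x \<in> ext.I"
proof (induction x rule: ext.I_induct)
  case (step x u k a m b n)
  obtain v where v: "v \<in> hcomp T 1" "u = v \<otimes> v" using step by (auto simp: squares_def)
  obtain c where c: "D v = c \<odot> \<one>" using hcomp_zero_scalar[OF D_hcomp] v(1) by fastforce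
  have vc: "v \<in> carrier T" using v(1) hcomp_closed by blast
  have "D u = \<zero>"
    unfolding v(2) D_mult[OF v(1) vc] c using vc
    by (simp add: add_smult[symmetric])
  have car: "x \<in> carrier T" "u \<in> carrier T" "a \<in> carrier T" "b \<in> carrier T"
    using step hcomp_closed ext.I_closed by blast+
  have uI: "u \<in> ext.I" using square_in_I v by simp
  \<comment> \<open>\<open>u\<close> has even degree, so no sign appears when \<open>D\<close>
    passes it.\<close>
  have u2: "u \<in> hcomp T 2" using hcomp_mult[OF v(1) v(1)] v(2) by (simp add: numeral_2_eq_2)
  have "D (a \<otimes> u \<otimes> b) = D a \<otimes> (u \<otimes> b) \<oplus> (- 1) ^ m \<odot> (a \<otimes> D (u \<otimes> b))"
    using D_mult[OF \<open>a \<in> hcomp T m\<close>, of "u \<otimes> b"] car by (simp add: m_assoc)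
  also have "D (u \<otimes> b) = u \<otimes> D b"
    using D_mult[OF u2 car(4)] \<open>D u = \<zero>\<close> car D_closed by simp
  also have "D a \<otimes> (u \<otimes> b) \<oplus> (- 1) ^ m \<odot> (a \<otimes> (u \<otimes> D b)) \<in> ext.I"
    using car D_closed uI ext.I.I_l_closed ext.I.I_r_closed ext.I_smult by simp
  finally show ?case using step.IH car D_closed by (simp add: D_simps)
qed (simp add: D_simps)

end

locale ext_alg = T: tensor_alg S T for S :: "'s set" and T :: "('k::field, 's list \<Rightarrow> 'k) galg" +
  fixes E :: "('k, ('s list \<Rightarrow> 'k) set) galg" (structure)
  assumes E_def: "E = ext_algebra S"
begin

definition proj :: "('s list \<Rightarrow> 'k) \<Rightarrow> ('s list \<Rightarrow> 'k) set" where
  "proj v = T.ext.proj v"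

lemma E_quot: "E = T.ext.Q"
  by (simp add: E_def ext_algebra_def ext_ideal_def T.squares_def T.T_def[symmetric])

lemma ext_ideal_eq: "ext_ideal S = T.ext.I"
  by (simp add: ext_ideal_def T.squares_def T.T_def[symmetric])

lemmas E_simps = T.ext.quot_simps[folded E_quot proj_def]

lemma proj_hom:
  "proj \<zero>\<^bsub>T\<^esub> = \<zero>" "proj \<one>\<^bsub>T\<^esub> = \<one>"
  "x \<in> carrier T \<Longrightarrow> y \<in> carrier T \<Longrightarrow> proj (x \<oplus>\<^bsub>T\<^esub> y) = proj x \<oplus> proj y"
  "x \<in> carrier T \<Longrightarrow> y \<in> carrier T \<Longrightarrow> proj (x \<otimes>\<^bsub>T\<^esub> y) = proj x \<otimes> proj y"
  "x \<in> carrier T \<Longrightarrow> proj (c \<odot>\<^bsub>T\<^esub> x) = c \<odot> proj x"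
  using T.ext.quot_smult[folded E_quot proj_def] by (simp_all add: E_simps)

lemma graded_E: "graded_algebra E"
  using T.ext.graded_quot by (simp add: E_quot)

end

sublocale ext_alg \<subseteq> galgebra E
  by unfold_locales (rule graded_E)

context ext_alg
begin

lemma proj_closed [simp, intro]: "p \<in> carrier T \<Longrightarrow> proj p \<in> carrier E"
  by (simp add: E_simps)

lemma proj_hcomp: "p \<in> hcomp T n \<Longrightarrow> proj p \<in> hcomp E n"
  by (simp add: E_simps)

lemma ext_vec_eq: "ext_vec S v = proj v"
  by (simp add: ext_vec_def ext_ideal_eq proj_def T.T_def[symmetric])

abbreviation e :: "'s list \<Rightarrow> ('s list \<Rightarrow> 'k) set" where
  "e \<equiv> ext_prod S"

lemma ext_prod_eq: "set xs \<subseteq> S \<Longrightarrow> e xs = proj (word xs)"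
proof (induction xs)
  case Nil
  then show ?case by (simp add: ext_prod_def E_def[symmetric] proj_hom(2)[symmetric] T.T_simps(5))
next
  case (Cons s xs)
  have "e (s # xs) = ext_vec S (basis_vec s) \<otimes> e xs" by (simp add: ext_prod_def E_def)
  also have "\<dots> = proj (word [s] \<otimes>\<^bsub>T\<^esub> word xs)"
    using Cons by (simp add: ext_vec_eq basis_vec_eq_word proj_hom T.T_word_closed)
  finally show ?case by (simp add: T.T_word_mult)
qed

lemma e_hcomp: "set xs \<subseteq> S \<Longrightarrow> e xs \<in> hcomp E (length xs)"
  using proj_hcomp T.T_word_hcomp by (simp add: ext_prod_eq)

lemma e_closed [simp, intro]: "set xs \<subseteq> S \<Longrightarrow> e xs \<in> carrier E"
  using hcomp_closed e_hcomp by blast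

lemma e_Nil: "e [] = \<one>"
  by (simp add: ext_prod_def E_def)

lemma e_append: "set xs \<subseteq> S \<Longrightarrow> set ys \<subseteq> S \<Longrightarrow> e (xs @ ys) = e xs \<otimes> e ys"
  by (simp add: ext_prod_eq T.T_word_closed proj_hom(4)[symmetric] T.T_word_mult)

lemma e_Cons: "s \<in> S \<Longrightarrow> set xs \<subseteq> S \<Longrightarrow> e (s # xs) = e [s] \<otimes> e xs"
  using e_append[of "[s]" xs] by simp

lemma ext_vec_basis: "s \<in> S \<Longrightarrow> ext_vec S (basis_vec s) = e [s]"
  by (simp add: ext_vec_eq ext_prod_eq basis_vec_eq_word)

lemma degree_one_square:
  assumes "x \<in> hcomp E 1"
  shows "x \<otimes> x = \<zero>"
proof -
  obtain v where v: "v \<in> hcomp T 1" "x = proj v" using assms by (auto simp: E_simps)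
  then have "x \<otimes> x = proj (v \<otimes>\<^bsub>T\<^esub> v)" using T.hcomp_closed by (simp add: proj_hom)
  then show ?thesis
    using T.square_in_I[OF v(1)] T.ext.proj_eq_zero_iff T.hcomp_closed[OF v(1)]
    by (simp add: proj_hom(1)[symmetric] proj_def T.ext.proj_zero)
qed

text \<open>Polarisation: the ideal is generated by squares, and anticommutation comes from
  expanding the square of \<open>x \<oplus> y\<close>.\<close>

lemma degree_one_anticomm:
  assumes "x \<in> hcomp E 1" "y \<in> hcomp E 1"
  shows "x \<otimes> y = (- 1) \<odot> (y \<otimes> x)"
proof -
  have c: "x \<in> carrier E" "y \<in> carrier E" using assms hcomp_closed by auto
  have "\<zero> = (x \<oplus> y) \<otimes> (x \<oplus> y)"
    using degree_one_square[OF hcomp_add[OF assms]] by simp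
  also have "\<dots> = x \<otimes> y \<oplus> y \<otimes> x"
    using c degree_one_square[OF assms(1)] degree_one_square[OF assms(2)] by (simp add: l_distr r_distr a_comm)
  finally have "x \<otimes> y = \<ominus> (y \<otimes> x)" using c by (metis m_closed minus_equality)
  then show ?thesis using c by (simp add: minus_one_smult)
qed

lemma e_commute_one:
  assumes "s \<in> S"
  shows "set xs \<subseteq> S \<Longrightarrow> e [s] \<otimes> e xs = (- 1) ^ length xs \<odot> (e xs \<otimes> e [s])"
proof (induction xs)
  case (Cons t xs)
  have c: "e [s] \<in> carrier E" "e [t] \<in> carrier E" "e xs \<in> carrier E" using Cons assms by auto
  have "e [s] \<otimes> e (t # xs) = (e [s] \<otimes> e [t]) \<otimes> e xs"
    using Cons.prems c by (simp add: e_Cons[of t xs] m_assoc)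
  also have "e [s] \<otimes> e [t] = (- 1) \<odot> (e [t] \<otimes> e [s])"
    using degree_one_anticomm[of "e [s]" "e [t]"] e_hcomp[of "[s]"] e_hcomp[of "[t]"] assms Cons.prems by simp
  also have "\<dots> \<otimes> e xs = (- 1) \<odot> (e [t] \<otimes> (e [s] \<otimes> e xs))"
    using c by (simp add: m_assoc)
  also have "\<dots> = (- 1) ^ length (t # xs) \<odot> (e [t] \<otimes> e xs \<otimes> e [s])"
    using Cons c by (simp add: m_assoc)
  finally show ?case using Cons.prems by (simp add: e_Cons[of t xs])
qed (use assms in \<open>simp add: e_Nil\<close>)

lemma e_commute:
  assumes "set ys \<subseteq> S"
  shows "set xs \<subseteq> S \<Longrightarrow> e xs \<otimes> e ys = (- 1) ^ (length xs * length ys) \<odot> (e ys \<otimes> e xs)"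
proof (induction xs)
  case (Cons s xs)
  have c: "e [s] \<in> carrier E" "e ys \<in> carrier E" "e xs \<in> carrier E" using Cons assms by auto
  have "e (s # xs) \<otimes> e ys = e [s] \<otimes> (e xs \<otimes> e ys)"
    using Cons.prems c by (simp add: e_Cons[of s xs] m_assoc)
  also have "\<dots> = (- 1) ^ (length xs * length ys) \<odot> ((e [s] \<otimes> e ys) \<otimes> e xs)"
    using Cons c by (simp add: m_assoc)
  also have "e [s] \<otimes> e ys = (- 1) ^ length ys \<odot> (e ys \<otimes> e [s])"
    using e_commute_one assms Cons.prems by simp
  finally show ?case
    using c Cons.prems by (simp add: e_Cons[of s xs] m_assoc power_add mult.commute)
qed (use assms in \<open>simp add: e_Nil\<close>)

text \<open>On fixed degrees the identity is linear in each argument, so it reduces to words of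
  lengths \<open>m\<close> and \<open>n\<close>. Moving each letter of one past each letter of the
  other costs \<open>m * n\<close> signs.\<close>

lemma graded_comm_E: "graded_comm_algebra E"
  unfolding graded_comm_algebra_def
proof (intro conjI allI ballI)
  fix m n x y assume "x \<in> hcomp E m" "y \<in> hcomp E n"
  then obtain p q where pq: "p \<in> hcomp T m" "q \<in> hcomp T n" "x = proj p" "y = proj q"
    by (auto simp: E_simps)
  have c: "p \<in> carrier T" "q \<in> carrier T" using pq T.hcomp_closed by auto
  have "proj p \<otimes> proj q = (- 1) ^ (m * n) \<odot> (proj q \<otimes> proj p)"
    using pq(1)
  proof (induction p rule: T.T_hcomp_induct)
    case zero
    then show ?case using c(2) by (simp add: proj_hom)
  next
    case (step p a u)
    have "proj (word u) \<otimes> proj q = (- 1) ^ (m * n) \<odot> (proj q \<otimes> proj (word u))"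
      using pq(2)
    proof (induction q rule: T.T_hcomp_induct)
      case zero
      then show ?case
        using step T.T_word_closed[of u] by (simp add: proj_hom)
    next
      case (step q b v)
      have "proj (word u) \<otimes> proj (word v) = (- 1) ^ (m * n) \<odot> (proj (word v) \<otimes> proj (word u))"
        using e_commute[of v u] step \<open>set u \<subseteq> S\<close> \<open>length u = m\<close> by (simp add: ext_prod_eq)
      then show ?case
        using step T.hcomp_closed[OF step(1)] \<open>set u \<subseteq> S\<close>
        by (simp add: proj_hom T.T_word_closed r_distr l_distr smult_add mult.commute)
    qed
    then show ?case
      using step T.hcomp_closed[OF step(1)] c(2)
      by (simp add: proj_hom T.T_word_closed r_distr l_distr smult_add mult.commute)
  qed
  then show "x \<otimes> y = (- 1) ^ (m * n) \<odot> (y \<otimes> x)" using pq by simp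
qed (rule graded_E)

text \<open>Vanishing squares in degree 1 are a separate assumption on the target: over a field of
  characteristic 2 graded commutativity does not imply them. They make the map on the tensor algebra
  kill all generators of the ideal.\<close>

lemma ext_universal:
  assumes B: "graded_algebra B" "\<And>x. x \<in> hcomp B 1 \<Longrightarrow> x \<otimes>\<^bsub>B\<^esub> x = \<zero>\<^bsub>B\<^esub>"
    and b: "\<And>s. s \<in> S \<Longrightarrow> b s \<in> hcomp B 1"
  obtains g where "g \<in> galg_hom E B" "\<And>s. s \<in> S \<Longrightarrow> g (e [s]) = b s"
proof -
  interpret B: galgebra B by unfold_locales fact
  note h = B.tensor_universal[OF b, of S, folded T.T_def]
  obtain g where g: "g \<in> galg_hom T.ext.Q B" "\<And>x. x \<in> carrier T \<Longrightarrow> g (T.ext.proj x) = B.lin (B.wprod b) x"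
  proof (rule T.ext.quot_universal[OF B(1) h(1)])
    fix u assume "u \<in> T.squares"
    then obtain v where v: "v \<in> hcomp T 1" "u = v \<otimes>\<^bsub>T\<^esub> v" by (auto simp: T.squares_def)
    then show "B.lin (B.wprod b) u = \<zero>\<^bsub>B\<^esub>"
      using galg_mapD(3,6)[OF h(1)] T.hcomp_closed B(2) by simp
  qed auto
  show ?thesis
  proof (rule that)
    show "g \<in> galg_hom E B" using g(1) by (simp add: E_quot)
    show "g (e [s]) = b s" if "s \<in> S" for s
      using g(2)[of "basis_vec s"] h(2)[OF _ that] that b
      by (simp add: ext_prod_eq basis_vec_eq_word T.T_word_closed proj_def)
  qed
qed

end

section \<open>The derivation of the exterior algebra and relations between monomials\<close>

context ext_alg
begin

lemma carrier_E: "x \<in> carrier E \<longleftrightarrow> (\<exists>p\<in>carrier T. x = proj p)"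
  by (auto simp: E_simps(1))

text \<open>\<open>D\<close> preserves the ideal of squares and so descends to cosets; every law is
  then checked on representatives.\<close>

lemma ex_derivation: "\<exists>d. graded_derivation E d \<and> (\<forall>s\<in>S. d (e [s]) = \<one>)"
proof -
  have "proj (T.D x) = proj (T.D y)" if "x \<in> carrier T" "y \<in> carrier T" "x \<ominus>\<^bsub>T\<^esub> y \<in> T.ext.I" for x y
  proof -
    have "x \<ominus>\<^bsub>T\<^esub> y = x \<oplus>\<^bsub>T\<^esub> (- 1) \<odot>\<^bsub>T\<^esub> y"
      using that by (simp add: T.minus_eq T.minus_one_smult)
    then have "T.D (x \<ominus>\<^bsub>T\<^esub> y) = T.D x \<ominus>\<^bsub>T\<^esub> T.D y"
      using that by (simp add: T.D_simps T.D_closed T.minus_eq T.minus_one_smult[symmetric])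
    then show ?thesis
      using T.D_ext_ideal[OF that(3)] that by (simp add: proj_def T.ext.proj_eq_iff T.D_closed)
  qed
  then obtain d where d: "\<And>x. x \<in> carrier T \<Longrightarrow> d (proj x) = proj (T.D x)" "d \<in> extensional (carrier E)"
    using T.ext.ex_quot_fun[of "\<lambda>x. proj (T.D x)"] unfolding E_quot proj_def by metis
  have "graded_derivation E d"
    unfolding graded_derivation_def
  proof (intro conjI allI ballI)
    show "d \<in> carrier E \<rightarrow>\<^sub>E carrier E"
      using d by (auto simp: E_simps(1) PiE_def T.D_closed)
    show "d ` hcomp E 0 \<subseteq> {\<zero>}"
      using d(1) T.hcomp_closed T.D_hcomp_zero by (auto simp: E_simps(4) proj_hom)
    show "d ` hcomp E (Suc n) \<subseteq> hcomp E n" for n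
      using d(1) T.hcomp_closed T.D_hcomp by (auto simp: E_simps(4))
    show "d (x \<oplus> y) = d x \<oplus> d y" if "x \<in> carrier E" "y \<in> carrier E" for x y
      using that by (auto simp: carrier_E proj_hom(3)[symmetric] d(1) T.D_simps T.D_closed)
    show "d (c \<odot> x) = c \<odot> d x" if "x \<in> carrier E" for c x
      using that by (auto simp: carrier_E proj_hom(5)[symmetric] d(1) T.D_simps T.D_closed)
    show "d (x \<otimes> y) = d x \<otimes> y \<oplus> (- 1) ^ m \<odot> (x \<otimes> d y)"
      if xy: "x \<in> hcomp E m" "y \<in> carrier E" for m x y
    proof -
      obtain p q where p: "p \<in> hcomp T m" "x = proj p" "q \<in> carrier T" "y = proj q"
        using xy by (auto simp: E_simps(1,4))
      then show ?thesis
        using T.hcomp_closed[OF p(1)]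
        by (simp add: proj_hom(3-5)[symmetric] d(1) T.D_mult T.D_closed)
    qed
  qed
  moreover have "d (e [s]) = \<one>" if "s \<in> S" for s
    using that T.D_Cons[OF that T.one_closed]
    by (simp add: ext_prod_eq d(1) T.T_word_closed T.T_simps(5) T.T_word_mult T.D_one[unfolded T.T_simps(5)]
        proj_hom(2)[symmetric])
  ultimately show ?thesis by blast
qed

lemma derivation_e_Cons:
  assumes "graded_derivation E d" "d (e [s]) = \<one>" "s \<in> S" "set xs \<subseteq> S"
  shows "d (e (s # xs)) = e xs \<oplus> (- 1) \<odot> (e [s] \<otimes> d (e xs))"
  using assms e_hcomp[of "[s]"] unfolding graded_derivation_def by (simp add: e_Cons[of s xs])

lemma derivation_hcomp:
  assumes "graded_derivation E d"
  shows "x \<in> hcomp E 0 \<Longrightarrow> d x = \<zero>" "x \<in> hcomp E (Suc n) \<Longrightarrow> d x \<in> hcomp E n"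
proof -
  have "d ` hcomp E 0 \<subseteq> {\<zero>}" "d ` hcomp E (Suc n) \<subseteq> hcomp E n"
    using assms unfolding graded_derivation_def by (elim conjE, simp)+
  then show "x \<in> hcomp E 0 \<Longrightarrow> d x = \<zero>" "x \<in> hcomp E (Suc n) \<Longrightarrow> d x \<in> hcomp E n" by auto
qed

text \<open>Degree reasons force the value at 1 to be zero, and the recursion
  \<open>derivation_e_Cons\<close> then fixes the values on all monomials, which span. As
  \<open>ext_deriv\<close> is a definite description, nothing can be said about it before
  this.\<close>

lemma derivation_unique:
  assumes d: "graded_derivation E d" "\<forall>s\<in>S. d (e [s]) = \<one>"
    and d': "graded_derivation E d'" "\<forall>s\<in>S. d' (e [s]) = \<one>"
  shows "d = d'"
proof (rule extensionalityI)
  show "d \<in> extensional (carrier E)" "d' \<in> extensional (carrier E)"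
    using d d' unfolding graded_derivation_def PiE_def by blast+
  have w: "d (e xs) = d' (e xs)" if "set xs \<subseteq> S" for xs
    using that
  proof (induction xs)
    case Nil
    have "d \<one> = \<zero>" "d' \<one> = \<zero>" using derivation_hcomp(1)[OF d(1) one_hcomp] derivation_hcomp(1)[OF d'(1) one_hcomp] .
    then show ?case by (simp add: e_Nil)
  next
    case (Cons s xs)
    then show ?case using derivation_e_Cons[OF d(1), of s xs] derivation_e_Cons[OF d'(1), of s xs] d d' by simp
  qed
  fix x assume "x \<in> carrier E"
  then obtain p where p: "p \<in> carrier T" "x = proj p" by (auto simp: E_simps(1))
  have lin: "d (u \<oplus> c \<odot> v) = d u \<oplus> c \<odot> d v" "d' (u \<oplus> c \<odot> v) = d' u \<oplus> c \<odot> d' v"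
    if "u \<in> carrier E" "v \<in> carrier E" for u v c
    using d d' that smult_closed unfolding graded_derivation_def by metis+
  have "d (proj p) = d' (proj p)"
    using p(1)
  proof (induction p rule: T.T_induct)
    case zero
    have "d \<zero> = \<zero>" "d' \<zero> = \<zero>" using derivation_hcomp(1)[OF d(1) hcomp_zero] derivation_hcomp(1)[OF d'(1) hcomp_zero] .
    then show ?case by (simp add: proj_hom)
  next
    case (step q c u)
    then show ?case
      using lin[of "proj q" "proj (word u)" c] w[of u]
      by (simp add: proj_hom T.T_word_closed ext_prod_eq)
  qed
  then show "d x = d' x" using p by simp
qed

abbreviation d where "d \<equiv> ext_deriv S"

lemma ext_deriv_spec: "graded_derivation E d \<and> (\<forall>s\<in>S. d (e [s]) = \<one>)"
proof -
  have ex1: "\<exists>!d. graded_derivation E d \<and> (\<forall>s\<in>S. d (e [s]) = \<one>)"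
    using ex_derivation derivation_unique by blast
  have "d = (THE d. graded_derivation E d \<and> (\<forall>s\<in>S. d (e [s]) = \<one>))"
    unfolding ext_deriv_def E_def[symmetric] by (simp add: ext_vec_basis cong: ball_cong)
  then show ?thesis using theI'[OF ex1] by simp
qed

lemma ext_deriv_derivation: "graded_derivation E d"
  using ext_deriv_spec by blast

lemma d_e_single: "s \<in> S \<Longrightarrow> d (e [s]) = \<one>"
  using ext_deriv_spec by blast

lemma d_closed [simp, intro]: "x \<in> carrier E \<Longrightarrow> d x \<in> carrier E"
  and d_smult: "x \<in> carrier E \<Longrightarrow> d (c \<odot> x) = c \<odot> d x"
  and d_mult: "x \<in> hcomp E m \<Longrightarrow> y \<in> carrier E \<Longrightarrow> d (x \<otimes> y) = d x \<otimes> y \<oplus> (- 1) ^ m \<odot> (x \<otimes> d y)"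
  using ext_deriv_derivation unfolding graded_derivation_def by auto

lemma d_hcomp: "x \<in> hcomp E (Suc n) \<Longrightarrow> d x \<in> hcomp E n"
  using derivation_hcomp(2)[OF ext_deriv_derivation] .

lemma d_hcomp_zero: "x \<in> hcomp E 0 \<Longrightarrow> d x = \<zero>"
  using derivation_hcomp(1)[OF ext_deriv_derivation] .

lemma d_zero: "d \<zero> = \<zero>" and d_one: "d \<one> = \<zero>"
  using d_hcomp_zero hcomp_zero one_hcomp by auto

lemma d_e_Cons:
  "s \<in> S \<Longrightarrow> set xs \<subseteq> S \<Longrightarrow> d (e (s # xs)) = e xs \<oplus> (- 1) \<odot> (e [s] \<otimes> d (e xs))"
  using derivation_e_Cons ext_deriv_derivation d_e_single by blast

lemma d_e_append:
  "set xs \<subseteq> S \<Longrightarrow> set ys \<subseteq> S \<Longrightarrow>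
    d (e (xs @ ys)) = d (e xs) \<otimes> e ys \<oplus> (- 1) ^ length xs \<odot> (e xs \<otimes> d (e ys))"
  using d_mult[OF e_hcomp] by (simp add: e_append)

text \<open>Homogeneity of the circuit derivatives, as \<open>homog_quotient\<close> requires it.
  The degree is existential because the empty monomial has derivative zero, which lies in every
  degree.\<close>

lemma d_e_hcomp: "set xs \<subseteq> S \<Longrightarrow> \<exists>k. d (e xs) \<in> hcomp E k"
  using d_hcomp[of "e xs"] e_hcomp[of xs] d_one hcomp_zero by (cases xs) (auto simp: e_Nil)

text \<open>The letter \<open>s\<close> is moved, with signs, next to its copy in \<open>xs\<close>,
  and the square of a letter vanishes.\<close>

lemma e_mult_member:
  assumes "s \<in> set xs" "set xs \<subseteq> S"
  shows "e [s] \<otimes> e xs = \<zero>"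
  using assms
proof (induction xs)
  case (Cons t xs)
  have c: "e [s] \<in> carrier E" "e [t] \<in> carrier E" "e xs \<in> carrier E" using Cons.prems by auto
  have "e [s] \<otimes> e (t # xs) = (e [s] \<otimes> e [t]) \<otimes> e xs"
    using Cons.prems c by (simp add: e_Cons[of t xs] m_assoc)
  also have "\<dots> = \<zero>"
  proof (cases "s = t")
    case True
    then show ?thesis using degree_one_square[of "e [s]"] e_hcomp[of "[s]"] Cons.prems c by simp
  next
    case False
    have "e [s] \<otimes> e [t] = (- 1) \<odot> (e [t] \<otimes> e [s])"
      using degree_one_anticomm[of "e [s]" "e [t]"] e_hcomp[of "[s]"] e_hcomp[of "[t]"] Cons.prems by auto
    then show ?thesis using False Cons c by (simp add: m_assoc)
  qed
  finally show ?case .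
qed simp

lemma e_not_distinct:
  assumes "\<not> distinct xs" "set xs \<subseteq> S"
  shows "e xs = \<zero>"
  using assms
proof (induction xs)
  case (Cons s xs)
  then show ?case
    using e_mult_member[of s xs] by (cases "s \<in> set xs") (auto simp: e_Cons[of s xs])
qed simp

text \<open>Applying \<open>d\<close> to \<open>e [s] \<otimes> e xs = \<zero>\<close> gives
  \<open>e xs - e [s] \<otimes> d (e xs) = \<zero>\<close>. Through this identity the monomials of
  circuits themselves lie in the ideal generated by their derivatives.\<close>

lemma e_eq_mult_d:
  assumes "s \<in> set xs" "set xs \<subseteq> S"
  shows "e xs = e [s] \<otimes> d (e xs)"
proof -
  have c: "e [s] \<in> carrier E" "e xs \<in> carrier E" "s \<in> S" using assms by auto
  have "\<zero> = d (e [s] \<otimes> e xs)" using e_mult_member[OF assms] d_zero by simp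
  also have "\<dots> = e xs \<oplus> (- 1) \<odot> (e [s] \<otimes> d (e xs))"
    using d_e_Cons[of s xs] c assms by (simp add: e_Cons[of s xs])
  finally show ?thesis
    using c by (metis add.inv_solve_right d_closed l_zero m_closed minus_eq minus_one_smult zero_closed
      a_minus_def add.inv_closed r_right_minus_eq)
qed

lemma e_swap:
  assumes "s \<in> S" "set xs \<subseteq> S" "set ys \<subseteq> S"
  shows "e (xs @ s # ys) = (- 1) ^ length xs \<odot> e (s # xs @ ys)"
proof -
  have c: "e [s] \<in> carrier E" "e xs \<in> carrier E" "e ys \<in> carrier E" using assms by auto
  have "e (s # xs @ ys) = (e [s] \<otimes> e xs) \<otimes> e ys"
    using assms c by (simp add: e_Cons[of s "xs @ ys"] e_append m_assoc)
  also have "\<dots> = (- 1) ^ length xs \<odot> e (xs @ s # ys)"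
    using assms c by (simp add: e_commute_one e_append e_Cons[of s ys] m_assoc)
  finally show ?thesis
    using assms by (simp add: power_mult_distrib[symmetric])
qed

text \<open>The scalar arising here is a product of the signs from moving letters to the front. Only
  membership in an ideal is at stake later, so it is left unspecified.\<close>

lemma e_perm:
  assumes "mset xs = mset ys" "set xs \<subseteq> S"
  shows "\<exists>c. e xs = c \<odot> e ys"
  using assms
proof (induction xs arbitrary: ys)
  case Nil
  then show ?case by (auto intro!: exI[of _ 1])
next
  case (Cons s xs)
  then have "s \<in> set ys" by (metis list.set_intros(1) set_mset_mset)
  then obtain us vs where ys: "ys = us @ s # vs" by (meson split_list)
  have sub: "set us \<subseteq> S" "set vs \<subseteq> S" "s \<in> S" "set xs \<subseteq> S"
    using mset_eq_setD[OF Cons.prems(1)] Cons.prems(2) ys by auto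
  have "mset xs = mset (us @ vs)" using Cons.prems ys by simp
  then obtain c where "e xs = c \<odot> e (us @ vs)" using Cons.IH sub by blast
  then have "e (s # xs) = c \<odot> e (s # us @ vs)"
    using sub by (simp add: e_Cons[of s xs] e_Cons[of s "us @ vs"])
  also have "e (s # us @ vs) = (- 1) ^ length us \<odot> e ys"
    using e_swap[OF sub(3,1,2)] sub ys by (simp add: power_mult_distrib[symmetric])
  finally show ?case using sub ys by auto
qed

end

section \<open>Orlik--Solomon algebras\<close>

lemma dependent_contains_circuit:
  assumes "finite Y" "Y \<subseteq> ground M" "Y \<notin> indeps M"
  shows "\<exists>C\<subseteq>Y. C \<in> circuits M"
  using assms
proof (induction Y rule: finite_psubset_induct)
  case (psubset Y)
  show ?case
  proof (cases "\<forall>D. D \<subset> Y \<longrightarrow> D \<in> indeps M")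
    case True
    then have "Y \<in> circuits M" using psubset.prems by (auto simp: circuits_def)
    then show ?thesis by blast
  next
    case False
    then obtain D where D: "D \<subset> Y" "D \<notin> indeps M" by blast
    then have "\<exists>C\<subseteq>D. C \<in> circuits M" using psubset.IH[of D] psubset.prems by blast
    then show ?thesis using D by (meson order.trans psubset_imp_subset)
  qed
qed

locale os_alg = E: ext_alg "ground M" T E
  for M :: "'s matroid" and T :: "('k::field, 's list \<Rightarrow> 'k) galg" and E +
  fixes A :: "('k, ('s list \<Rightarrow> 'k) set set) galg" (structure)
  assumes A_def: "A = os_algebra M"
begin

definition circuit_gens :: "('s list \<Rightarrow> 'k) set set" where
  "circuit_gens = {E.d (E.e xs) |xs. distinct xs \<and> set xs \<in> circuits M}"

sublocale os: homog_quotient E circuit_gens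
proof
  fix u assume "u \<in> circuit_gens"
  then show "\<exists>k. u \<in> hcomp E k"
    unfolding circuit_gens_def circuits_def using E.d_e_hcomp by blast
qed

definition pr :: "('s list \<Rightarrow> 'k) set \<Rightarrow> ('s list \<Rightarrow> 'k) set set" where
  "pr x = os.proj x"

lemma os_ideal_eq: "os_ideal M = os.I"
  by (simp add: os_ideal_def circuit_gens_def E.E_def[symmetric])

lemma A_quot: "A = os.Q"
  by (simp add: A_def os_algebra_def os_ideal_eq E.E_def)

lemmas A_simps = os.quot_simps[folded A_quot pr_def]

lemma graded_comm_A: "graded_comm_algebra A"
  unfolding A_quot by (rule os.graded_comm_quot[OF E.graded_comm_E])

lemma graded_A: "graded_algebra A"
  using graded_comm_A by (simp add: graded_comm_algebra_def)

lemma pr_galg_map: "galg_map E A pr"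
  using os.proj_galg_map by (simp add: A_quot pr_def[abs_def])

end

sublocale os_alg \<subseteq> galgebra A
  by unfold_locales (rule graded_A)

context os_alg
begin

lemmas pr_hom = galg_mapD[OF pr_galg_map]

lemma pr_zero: "pr \<zero>\<^bsub>E\<^esub> = \<zero>"
  by (rule galg_map_zero[OF E.graded_E graded_A pr_galg_map])

lemma pr_eq_zero: "x \<in> os.I \<Longrightarrow> pr x = \<zero>"
  by (metis pr_def pr_zero os.I.a_rcos_const os.proj_zero)

text \<open>Inherited from the exterior algebra; it admits an Orlik--Solomon algebra as the target
  in \<open>ext_universal\<close>.\<close>

lemma degree_one_square:
  assumes "x \<in> hcomp A 1"
  shows "x \<otimes> x = \<zero>"
proof -
  obtain y where y: "y \<in> hcomp E 1" "x = pr y" using assms by (auto simp: A_simps)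
  then have "x \<otimes> x = pr (y \<otimes>\<^bsub>E\<^esub> y)" using E.hcomp_closed pr_hom(3) by simp
  then show ?thesis using E.degree_one_square[OF y(1)] pr_zero by simp
qed

lemma os_vec_eq: "os_vec M v = pr (E.proj v)"
  by (simp add: os_vec_def pr_def os_ideal_eq E.ext_vec_eq E.E_def[symmetric])

lemma os_gen_Some: "s \<in> ground M \<Longrightarrow> os_gen M (Some s) = pr (E.e [s])"
  by (simp add: os_gen_def os_vec_eq E.ext_prod_eq basis_vec_eq_word)

lemma os_gen_None: "os_gen M None = \<zero>"
  by (simp add: os_gen_def A_def)

text \<open>Zero lies in every degree, so elements sent to the added loop also receive an admissible
  value of degree 1.\<close>

lemma os_gen_hcomp:
  assumes "x \<in> ground (add_loop M)"
  shows "os_gen M x \<in> hcomp A 1"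
proof (cases x)
  case None
  then show ?thesis by (simp add: os_gen_None hcomp_zero)
next
  case (Some s)
  then have "s \<in> ground M" using assms by (auto simp: add_loop_def)
  then show ?thesis using Some pr_hom(6)[OF E.e_hcomp[of "[s]"]] by (simp add: os_gen_Some)
qed

lemma os_vec_galg_map: "galg_map T A (os_vec M)"
proof -
  have "galg_map T E E.proj"
    using E.T.ext.proj_galg_map by (simp add: E.E_quot E.proj_def[abs_def])
  then show ?thesis using galg_map_comp[OF _ pr_galg_map] by (simp add: os_vec_eq[abs_def])
qed

lemma A_eq_os_vec: "x \<in> carrier A \<Longrightarrow> \<exists>p\<in>carrier T. x = os_vec M p"
  by (auto simp: A_simps(1) E.E_simps(1) os_vec_eq)

text \<open>The composite of the two projections is a surjective homomorphism from the tensor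
  algebra, and there the basis vectors determine everything.\<close>

lemma os_map_eq:
  assumes "graded_algebra B" "galg_map A B g" "galg_map A B h"
    and "\<And>s. s \<in> ground M \<Longrightarrow> g (os_gen M (Some s)) = h (os_gen M (Some s))" "x \<in> carrier A"
  shows "g x = h x"
proof -
  interpret B: galgebra B by unfold_locales fact
  obtain p where p: "p \<in> carrier T" "x = os_vec M p" using A_eq_os_vec assms by blast
  have "g (os_vec M p) = h (os_vec M p)"
    by (rule B.tensor_map_eq[where S = "ground M"])
      (use galg_map_comp[OF os_vec_galg_map assms(2)] galg_map_comp[OF os_vec_galg_map assms(3)] assms(4) p
        in \<open>simp_all add: E.T.T_def os_gen_def\<close>)
  then show ?thesis using p by simp
qed

text \<open>With a circuit of the set moved to the front, the Leibniz rule gives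
  \<open>d (e cs) \<otimes> e rs\<close> and, up to sign, \<open>e cs \<otimes> d (e rs)\<close>;
  both \<open>d (e cs)\<close> and \<open>e cs\<close> lie in the ideal.\<close>

lemma dependent_deriv_in_ideal:
  assumes "{} \<in> indeps M" "distinct xs" "set xs \<subseteq> ground M" "set xs \<notin> indeps M"
  shows "pr (E.d (E.e xs)) = \<zero>"
proof -
  obtain C where C: "C \<subseteq> set xs" "C \<in> circuits M"
    using dependent_contains_circuit[of "set xs" M] assms by blast
  then have "finite C" by (metis List.finite_set finite_subset)
  then obtain cs where cs: "set cs = C" "distinct cs" using finite_distinct_list by blast
  define rs where "rs = filter (\<lambda>x. x \<notin> C) xs"
  have sub: "set cs \<subseteq> ground M" "set rs \<subseteq> ground M" using assms C cs by (auto simp: rs_def)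
  have "mset xs = mset (cs @ rs)"
  proof (rule set_eq_iff_mset_eq_distinct[THEN iffD1])
    show "distinct (cs @ rs)" using assms cs by (auto simp: rs_def)
    show "set xs = set (cs @ rs)" using C cs by (auto simp: rs_def)
  qed (use assms in auto)
  then obtain c where c: "E.e xs = c \<odot>\<^bsub>E\<^esub> E.e (cs @ rs)" using E.e_perm assms by blast
  have gen: "E.d (E.e cs) \<in> os.I"
    by (rule os.gens_in_I) (use cs C in \<open>auto simp: circuit_gens_def\<close>)
  \<comment> \<open>A circuit is nonempty because the empty set is independent, so it has a letter
    to which \<open>e_eq_mult_d\<close> applies.\<close>
  have "E.e cs \<in> os.I"
  proof (cases cs)
    case Nil
    then show ?thesis using cs C assms(1) by (simp add: circuits_def)
  next
    case (Cons a as)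
    then have a: "a \<in> set cs" by simp
    then show ?thesis
      using E.e_eq_mult_d[OF a sub(1)] os.I.I_l_closed[OF gen, of "E.e [a]"] sub by fastforce
  qed
  then have "E.d (E.e (cs @ rs)) \<in> os.I"
    using gen sub by (simp add: E.d_e_append os.I.I_r_closed os.I_smult os.I.a_closed E.d_closed E.e_closed)
  then have "E.d (E.e xs) \<in> os.I"
    using c sub by (simp add: E.d_smult os.I_smult)
  then show ?thesis by (rule pr_eq_zero)
qed

end

lemma os_alg_self:
  "os_alg M (tensor_algebra (ground M)) (ext_algebra (ground M)) (os_algebra M)"
  by unfold_locales simp_all

section \<open>The algebra map of a complete weak map\<close>

lemma weak_map_ground:
  assumes "weak_map M1 M2 f" "s \<in> ground M1"
  shows "f (Some s) \<in> ground (add_loop M2)"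
  using assms unfolding weak_map_def by (auto simp: add_loop_def)

lemma ex_os_induced:
  fixes M1 :: "'s matroid" and M2 :: "'t matroid"
  assumes M2: "is_matroid M2" and f: "weak_map M1 M2 f" and complete: "complete_map M1 f"
  shows "\<exists>h :: ('s list \<Rightarrow> 'k::field) set set \<Rightarrow> ('t list \<Rightarrow> 'k) set set. os_induced M1 M2 f h"
proof -
  let ?E = "ext_algebra (ground M1) :: ('k, ('s list \<Rightarrow> 'k) set) galg"
  let ?A = "os_algebra M2 :: ('k, ('t list \<Rightarrow> 'k) set set) galg"
  interpret M1: os_alg M1 "tensor_algebra (ground M1) :: ('k, 's list \<Rightarrow> 'k) galg" ?E "os_algebra M1"
    by (rule os_alg_self)
  interpret M2: os_alg M2 "tensor_algebra (ground M2) :: ('k, 't list \<Rightarrow> 'k) galg" "ext_algebra (ground M2)" ?A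
    by (rule os_alg_self)
  define b where "b = (\<lambda>s. os_gen M2 (f (Some s)) :: ('t list \<Rightarrow> 'k) set set)"
  have b: "b s \<in> hcomp ?A 1" if "s \<in> ground M1" for s
    unfolding b_def using weak_map_ground[OF f that] by (rule M2.os_gen_hcomp)
  \<comment> \<open>On the exterior algebra any values of degree 1 extend to a homomorphism, since
    squares of degree 1 vanish in the target. The conditions on dependent sets enter in
    \<open>kill\<close>.\<close>
  obtain g where g: "g \<in> galg_hom ?E ?A" "\<And>s. s \<in> ground M1 \<Longrightarrow> g (M1.E.e [s]) = b s"
  proof (rule M1.E.ext_universal[where b = b, OF M2.graded_A])
    show "x \<otimes>\<^bsub>?A\<^esub> x = \<zero>\<^bsub>?A\<^esub>" if "x \<in> hcomp ?A 1" for x by (rule M2.degree_one_square[OF that])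
  qed (use b in auto)
  then have gmap: "galg_map ?E ?A g" by (simp add: galg_hom_iff)
  note gD = galg_mapD[OF gmap]
  note g_zero = galg_map_zero[OF M1.E.graded_E M2.graded_A gmap]
  have bc: "\<And>s. s \<in> ground M1 \<Longrightarrow> b s \<in> carrier ?A" using b M2.hcomp_closed by blast
  have g_Cons: "g (M1.E.e (s # xs)) = b s \<otimes>\<^bsub>?A\<^esub> g (M1.E.e xs)"
    if "s \<in> ground M1" "set xs \<subseteq> ground M1" for s xs
    using that by (simp add: M1.E.e_Cons[of s xs] gD(3) g(2))
  \<comment> \<open>The composite of \<open>g\<close> with \<open>d\<close> obeys the recursion of a
    derivation along \<open>g\<close>, so images of circuit derivatives are computed without a
    derivation on the target.\<close>
  have gd_Cons: "g (M1.E.d (M1.E.e (s # xs))) =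
      g (M1.E.e xs) \<oplus>\<^bsub>?A\<^esub> (- 1) \<odot>\<^bsub>?A\<^esub> (b s \<otimes>\<^bsub>?A\<^esub> g (M1.E.d (M1.E.e xs)))"
    if "s \<in> ground M1" "set xs \<subseteq> ground M1" for s xs
    using that by (simp add: M1.E.d_e_Cons gD(2,3,5) g(2) del: M1.E.smult_smult)
  have b_None: "b s = \<zero>\<^bsub>?A\<^esub>" if "f (Some s) = None" for s
    using that by (simp add: b_def M2.os_gen_None)
  have killed1: "g (M1.E.e xs) = \<zero>\<^bsub>?A\<^esub>"
    if "s \<in> set xs" "f (Some s) = None" "set xs \<subseteq> ground M1" for s xs
    using that
  proof (induction xs)
    case (Cons t xs)
    then show ?case using g_Cons[of t xs] b_None[of s] bc[of t] gD(1) by (cases "t = s") auto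
  qed simp
  \<comment> \<open>By the recursion: if the leading letter is killed, the second term is zero and
    the other killed letter annihilates the first. If it survives, the first term still contains
    killed letters and the second is zero by induction.\<close>
  have killed2: "g (M1.E.d (M1.E.e xs)) = \<zero>\<^bsub>?A\<^esub>"
    if "2 \<le> length (filter (\<lambda>s. f (Some s) = None) xs)" "set xs \<subseteq> ground M1" for xs
    using that
  proof (induction xs)
    case (Cons s xs)
    then have sub: "s \<in> ground M1" "set xs \<subseteq> ground M1" by auto
    show ?case
    proof (cases "f (Some s) = None")
      case True
      then have "filter (\<lambda>s. f (Some s) = None) xs \<noteq> []" using Cons.prems by auto
      then obtain t where "t \<in> set xs" "f (Some t) = None" by (auto simp: filter_empty_conv)
      then have "g (M1.E.e xs) = \<zero>\<^bsub>?A\<^esub>" using killed1 sub by blast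
      then show ?thesis using gd_Cons[OF sub] b_None[OF True] gD(1)[of "M1.E.d (M1.E.e xs)"] sub by simp
    next
      case False
      then have two: "2 \<le> length (filter (\<lambda>s. f (Some s) = None) xs)" using Cons.prems(1) by auto
      then have "filter (\<lambda>s. f (Some s) = None) xs \<noteq> []" by auto
      then obtain t where "t \<in> set xs" "f (Some t) = None" by (auto simp: filter_empty_conv)
      then have "g (M1.E.e xs) = \<zero>\<^bsub>?A\<^esub>" using killed1 sub by blast
      then show ?thesis using gd_Cons[OF sub] Cons.IH[OF two sub(2)] bc[OF sub(1)] by simp
    qed
  qed simp
  \<comment> \<open>Meaningful on the letters that \<open>f\<close> does not send to the added loop,
    the only ones to which the facts below apply it.\<close>
  define \<phi> where "\<phi> = (\<lambda>s. the (f (Some s)))"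
  \<comment> \<open>The claims about \<open>e\<close> and about its derivative are proved together,
    since the derivative of \<open>e (s # xs)\<close> involves both \<open>e xs\<close> and
    \<open>d (e xs)\<close>.\<close>
  have alive: "g (M1.E.e xs) = M2.pr (M2.E.e (map \<phi> xs)) \<and>
      g (M1.E.d (M1.E.e xs)) = M2.pr (M2.E.d (M2.E.e (map \<phi> xs))) \<and> \<phi> ` set xs \<subseteq> ground M2"
    if "\<And>s. s \<in> set xs \<Longrightarrow> f (Some s) \<noteq> None" "set xs \<subseteq> ground M1" for xs
    using that
  proof (induction xs)
    case Nil
    show ?case
      by (simp add: M1.E.e_Nil M2.E.e_Nil gD(4) M2.pr_hom(4) M1.E.d_one M2.E.d_one g_zero M2.pr_zero)
  next
    case (Cons s xs)
    then have sub: "s \<in> ground M1" "set xs \<subseteq> ground M1" by auto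
    have fs: "f (Some s) = Some (\<phi> s)" using Cons.prems by (auto simp: \<phi>_def)
    then have \<phi>s: "\<phi> s \<in> ground M2" using weak_map_ground[OF f sub(1)] by (auto simp: add_loop_def)
    have bs: "b s = M2.pr (M2.E.e [\<phi> s])" using \<phi>s fs by (simp add: b_def M2.os_gen_Some)
    have IH: "g (M1.E.e xs) = M2.pr (M2.E.e (map \<phi> xs))"
      "g (M1.E.d (M1.E.e xs)) = M2.pr (M2.E.d (M2.E.e (map \<phi> xs)))" "\<phi> ` set xs \<subseteq> ground M2"
      using Cons.IH Cons.prems by auto
    have "g (M1.E.e (s # xs)) = M2.pr (M2.E.e (map \<phi> (s # xs)))"
      using IH \<phi>s by (simp add: g_Cons[OF sub] bs M2.E.e_Cons[of "\<phi> s" "map \<phi> xs"] M2.pr_hom(3))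
    moreover have "g (M1.E.d (M1.E.e (s # xs))) = M2.pr (M2.E.d (M2.E.e (map \<phi> (s # xs))))"
      using IH \<phi>s by (simp add: gd_Cons[OF sub] bs M2.E.d_e_Cons[of "\<phi> s" "map \<phi> xs"] M2.pr_hom(2,3,5))
    ultimately show ?case using IH(3) \<phi>s by auto
  qed
  have kill: "g u = \<zero>\<^bsub>?A\<^esub>" if u: "u \<in> M1.circuit_gens" for u
  proof -
    obtain xs where xs: "u = M1.E.d (M1.E.e xs)" "distinct xs" "set xs \<in> circuits M1"
      using u by (auto simp: M1.circuit_gens_def)
    then have sub: "set xs \<subseteq> ground M1" and dep: "set xs \<notin> indeps M1" by (auto simp: circuits_def)
    have "card {s \<in> set xs. f (Some s) = None} = length (filter (\<lambda>s. f (Some s) = None) xs)"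
      using xs(2) by (metis distinct_card distinct_filter set_filter)
    then have "length (filter (\<lambda>s. f (Some s) = None) xs) \<noteq> 1"
      using complete xs(3) unfolding complete_map_def by auto
    then consider "2 \<le> length (filter (\<lambda>s. f (Some s) = None) xs)" | "filter (\<lambda>s. f (Some s) = None) xs = []"
      by (metis One_nat_def Suc_1 length_0_conv less_one nat_less_le not_less_eq_eq le_antisym)
    then show ?thesis
    proof cases
      case 1
      then show ?thesis using killed2 sub xs(1) by simp
    next
      case 2
      then have nk: "\<And>s. s \<in> set xs \<Longrightarrow> f (Some s) \<noteq> None" by (auto simp: filter_empty_conv)
      note al = alive[OF nk sub]
      show ?thesis
      proof (cases "distinct (map \<phi> xs)")
        case False
        then have "M2.E.e (map \<phi> xs) = \<zero>\<^bsub>ext_algebra (ground M2)\<^esub>"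
          using M2.E.e_not_distinct al by auto
        then show ?thesis using al xs(1) M2.E.d_zero M2.pr_zero by simp
      next
        case True
        have fx: "f (Some s) = Some (\<phi> s)" if "s \<in> set xs" for s using nk[OF that] by (auto simp: \<phi>_def)
        have "inj_on f (Some ` set xs)"
          using True fx by (auto simp: distinct_map inj_on_def)
        moreover have img: "f ` Some ` set xs = Some ` \<phi> ` set xs"
          using fx by (auto simp: image_image)
        \<comment> \<open>The contrapositive of the weak map condition: \<open>f\<close> is
          injective on the dependent set \<open>set xs\<close> and kills none of it, so the image is
          dependent.\<close>
        ultimately have "\<phi> ` set xs \<notin> indeps M2"
          using f dep sub unfolding weak_map_def add_loop_def by auto
        then have "M2.pr (M2.E.d (M2.E.e (map \<phi> xs))) = \<zero>\<^bsub>?A\<^esub>"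
          using M2 True al by (intro M2.dependent_deriv_in_ideal) (auto simp: is_matroid_def)
        then show ?thesis using al xs(1) by simp
      qed
    qed
  qed
  obtain h where h: "h \<in> galg_hom M1.os.Q ?A" "\<And>x. x \<in> carrier ?E \<Longrightarrow> h (M1.os.proj x) = g x"
    using M1.os.quot_universal[OF M2.graded_A gmap kill] by blast
  have "h (os_gen M1 (Some s)) = os_gen M2 (f (Some s))" if "s \<in> ground M1" for s
    using h(2)[of "M1.E.e [s]"] that by (simp add: M1.os_gen_Some M1.pr_def g(2) b_def)
  then have "os_induced M1 M2 f h" using h(1) by (simp add: os_induced_def M1.A_quot)
  then show ?thesis by blast
qed

section \<open>Uniqueness of induced homomorphisms and the functor laws\<close>

lemma os_induced_unique:
  fixes h h' :: "('s list \<Rightarrow> 'k::field) set set \<Rightarrow> ('t list \<Rightarrow> 'k) set set"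
  assumes "os_induced M1 M2 f h" "os_induced M1 M2 f h'"
  shows "h = h'"
proof -
  interpret M1: os_alg M1 "tensor_algebra (ground M1) :: ('k, 's list \<Rightarrow> 'k) galg" "ext_algebra (ground M1)" "os_algebra M1"
    by (rule os_alg_self)
  interpret M2: os_alg M2 "tensor_algebra (ground M2) :: ('k, 't list \<Rightarrow> 'k) galg" "ext_algebra (ground M2)" "os_algebra M2"
    by (rule os_alg_self)
  show ?thesis
  proof (rule extensionalityI)
    show "h \<in> extensional (carrier (os_algebra M1))" "h' \<in> extensional (carrier (os_algebra M1))"
      using assms by (auto simp: os_induced_def galg_hom_iff)
    show "h x = h' x" if "x \<in> carrier (os_algebra M1)" for x
      by (rule M1.os_map_eq[OF M2.graded_A _ _ _ that]) (use assms in \<open>auto simp: os_induced_def galg_hom_iff\<close>)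
  qed
qed

text \<open>Evaluates the definite description once a single induced homomorphism is exhibited.
  Identities and composites are treated this way, including composites of complete maps that are not
  complete themselves.\<close>

lemma os_map_eqI: "os_induced M1 M2 f h \<Longrightarrow> os_map M1 M2 f = h"
  unfolding os_map_def using os_induced_unique by (intro the_equality) auto

lemma os_map_induced:
  assumes "is_matroid M2" "weak_map M1 M2 f" "complete_map M1 f"
  shows "os_induced M1 M2 f (os_map M1 M2 f)"
  using ex_os_induced[OF assms] os_map_eqI by metis

lemma galg_map_id: "galg_map A A (\<lambda>x. x)"
  by (rule galg_mapI) auto

lemma galg_hom_id:
  assumes "graded_algebra A"
  shows "restrict (\<lambda>x. x) (carrier A) \<in> galg_hom A A"
  using galg_map_cong[OF galg_map_id assms, of "restrict (\<lambda>x. x) (carrier A)"] by (simp add: galg_hom_iff)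

lemma galg_hom_compose:
  assumes "graded_algebra A" "f \<in> galg_hom A B" "g \<in> galg_hom B C"
  shows "compose (carrier A) g f \<in> galg_hom A C"
  using galg_map_cong[OF galg_map_comp[of A B f C g] assms(1), of "compose (carrier A) g f"] assms(2,3)
  by (simp add: galg_hom_iff compose_eq)

lemma gca_cat_simps:
  "Obj gca_cat = {A. graded_comm_algebra A}" "Hom gca_cat = galg_hom"
  "Id gca_cat A = restrict (\<lambda>x. x) (carrier A)" "Comp gca_cat A B C g f = compose (carrier A) g f"
  by (simp_all add: gca_cat_def)

lemma compose_restrict_id:
  assumes "f \<in> extensional A"
  shows "compose A f (restrict (\<lambda>x. x) A) = f"
  using assms by (auto simp: compose_def restrict_def extensional_def)

lemma compose_id_restrict:
  assumes "f \<in> extensional A" "\<And>x. x \<in> A \<Longrightarrow> f x \<in> B"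
  shows "compose A (restrict (\<lambda>x. x) B) f = f"
  using assms by (auto simp: compose_def restrict_def extensional_def)

lemma compose_compose:
  assumes "\<And>x. x \<in> A \<Longrightarrow> f x \<in> B"
  shows "compose A (compose B h g) f = compose A h (compose A g f)"
  using assms by (auto simp: compose_def restrict_def)

lemma category_gca: "is_category (gca_cat :: (('k::field, 'a) galg, 'a \<Rightarrow> 'a) cat)"
  unfolding is_category_def gca_cat_simps
proof (intro conjI ballI)
  fix a b c d :: "('k, 'a) galg" and f g h :: "'a \<Rightarrow> 'a"
  assume o: "a \<in> {A. graded_comm_algebra A}" "b \<in> {A. graded_comm_algebra A}"
  then have gr: "graded_algebra a" "graded_algebra b" by (auto simp: graded_comm_algebra_def)
  show "restrict (\<lambda>x. x) (carrier a) \<in> galg_hom a a" using galg_hom_id[OF gr(1)] .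
  assume f: "f \<in> galg_hom a b"
  show "compose (carrier a) f (restrict (\<lambda>x. x) (carrier a)) = f"
    using f by (intro compose_restrict_id) (simp add: galg_hom_iff)
  show "compose (carrier a) (restrict (\<lambda>x. x) (carrier b)) f = f"
    using f galg_mapD(1) by (intro compose_id_restrict) (auto simp: galg_hom_iff)
  assume g: "g \<in> galg_hom b c"
  show "compose (carrier a) g f \<in> galg_hom a c" by (rule galg_hom_compose[OF gr(1) f g])
  show "compose (carrier a) (compose (carrier b) h g) f = compose (carrier a) h (compose (carrier a) g f)"
    using f galg_mapD(1) by (intro compose_compose) (auto simp: galg_hom_iff)
qed

lemma matroid_cat_simps:
  "Obj matroid_cat = {M. is_matroid M}"
  "Hom matroid_cat = (\<lambda>M1 M2. {f. weak_map M1 M2 f \<and> complete_map M1 f})"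
  "Id matroid_cat M = restrict (\<lambda>x. x) (ground (add_loop M))"
  "Comp matroid_cat M1 M2 M3 g f = compose (ground (add_loop M1)) g f"
  by (simp_all add: matroid_cat_def)

lemma matroid_nd_cat_simps:
  "Obj matroid_nd_cat = {M. is_matroid M}"
  "Hom matroid_nd_cat = (\<lambda>M1 M2. {f. weak_map M1 M2 f \<and> nondegenerate M1 f})"
  "Id matroid_nd_cat M = restrict (\<lambda>x. x) (ground (add_loop M))"
  "Comp matroid_nd_cat M1 M2 M3 g f = compose (ground (add_loop M1)) g f"
  by (simp_all add: matroid_nd_cat_def matroid_cat_def)

lemma nondegenerate_Some: "nondegenerate M f \<Longrightarrow> s \<in> ground M \<Longrightarrow> f (Some s) \<noteq> None"
  unfolding nondegenerate_def add_loop_def by auto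

lemma nondegenerate_complete: "nondegenerate M f \<Longrightarrow> complete_map M f"
  unfolding complete_map_def
proof
  fix C assume "nondegenerate M f" "C \<in> circuits M"
  then have "{s \<in> C. f (Some s) = None} = {}" using nondegenerate_Some[of M f] by (auto simp: circuits_def)
  then show "card {s \<in> C. f (Some s) = None} \<noteq> 1" by (metis card.empty zero_neq_one)
qed

lemma os_induced_id:
  "os_induced M M (restrict (\<lambda>x. x) (ground (add_loop M)))
    (restrict (\<lambda>x. x) (carrier (os_algebra M :: ('k::field, ('s list \<Rightarrow> 'k) set set) galg)))"
proof -
  interpret os_alg M "tensor_algebra (ground M) :: ('k, 's list \<Rightarrow> 'k) galg" "ext_algebra (ground M)" "os_algebra M"
    by (rule os_alg_self)
  show ?thesis
    unfolding os_induced_def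
    using galg_hom_id[OF graded_A] os_gen_hcomp hcomp_closed by (auto simp: add_loop_def)
qed

text \<open>Existence for the composite map comes from its two factors. \<open>ex_os_induced\<close>
  cannot supply it in general, as the composite may fail to be complete.\<close>

lemma os_induced_compose:
  fixes h :: "('s list \<Rightarrow> 'k::field) set set \<Rightarrow> ('t list \<Rightarrow> 'k) set set"
    and k :: "('t list \<Rightarrow> 'k) set set \<Rightarrow> ('u list \<Rightarrow> 'k) set set"
  assumes "os_induced M1 M2 f h" "os_induced M2 M3 g k" "weak_map M1 M2 f" "weak_map M2 M3 g"
  shows "os_induced M1 M3 (compose (ground (add_loop M1)) g f) (compose (carrier (os_algebra M1)) k h)"
proof -
  interpret M1: os_alg M1 "tensor_algebra (ground M1) :: ('k, 's list \<Rightarrow> 'k) galg" "ext_algebra (ground M1)" "os_algebra M1"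
    by (rule os_alg_self)
  interpret M2: os_alg M2 "tensor_algebra (ground M2) :: ('k, 't list \<Rightarrow> 'k) galg" "ext_algebra (ground M2)" "os_algebra M2"
    by (rule os_alg_self)
  interpret M3: os_alg M3 "tensor_algebra (ground M3) :: ('k, 'u list \<Rightarrow> 'k) galg" "ext_algebra (ground M3)" "os_algebra M3"
    by (rule os_alg_self)
  have h: "h \<in> galg_hom (os_algebra M1) (os_algebra M2)"
    "\<And>s. s \<in> ground M1 \<Longrightarrow> h (os_gen M1 (Some s)) = os_gen M2 (f (Some s))"
    using assms(1) by (auto simp: os_induced_def)
  have k: "k \<in> galg_hom (os_algebra M2) (os_algebra M3)"
    "\<And>s. s \<in> ground M2 \<Longrightarrow> k (os_gen M2 (Some s)) = os_gen M3 (g (Some s))"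
    using assms(2) by (auto simp: os_induced_def)
  \<comment> \<open>An element may be sent by \<open>f\<close> to the added loop, so
    \<open>k\<close> must be controlled at \<open>None\<close> too, where both sides are
    zero.\<close>
  have k_gen: "k (os_gen M2 x) = os_gen M3 (g x)" if "x \<in> ground (add_loop M2)" for x
  proof (cases x)
    case None
    then show ?thesis
      using assms(4) galg_map_zero[OF M2.graded_A M3.graded_A, of k] k(1)
      by (simp add: M2.os_gen_None M3.os_gen_None weak_map_def galg_hom_iff)
  next
    case (Some t)
    then show ?thesis using that k(2) by (auto simp: add_loop_def)
  qed
  show ?thesis
    unfolding os_induced_def
  proof (intro conjI ballI)
    show "compose (carrier (os_algebra M1)) k h \<in> galg_hom (os_algebra M1) (os_algebra M3)"
      by (rule galg_hom_compose[OF M1.graded_A h(1) k(1)])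
    fix s assume s: "s \<in> ground M1"
    then have "Some s \<in> ground (add_loop M1)" by (simp add: add_loop_def)
    then show "compose (carrier (os_algebra M1)) k h (os_gen M1 (Some s)) =
        os_gen M3 (compose (ground (add_loop M1)) g f (Some s))"
      using M1.hcomp_closed[OF M1.os_gen_hcomp] h(2)[OF s] k_gen[OF weak_map_ground[OF assms(3) s]]
      by (simp add: compose_eq)
  qed
qed

lemma functor_laws_os:
  "functor_laws (matroid_cat :: ('s matroid, _) cat)
    (gca_cat :: (('k::field, ('s list \<Rightarrow> 'k) set set) galg, _) cat) os_algebra os_map"
  unfolding functor_laws_def matroid_cat_simps gca_cat_simps
proof (intro conjI ballI)
  fix M1 M2 M3 :: "'s matroid" and f g
  show "(os_algebra M1 :: ('k, ('s list \<Rightarrow> 'k) set set) galg) \<in> {A. graded_comm_algebra A}"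
    using os_alg.graded_comm_A[OF os_alg_self] by simp
  show "os_map M1 M1 (restrict (\<lambda>x. x) (ground (add_loop M1))) =
      restrict (\<lambda>x. x) (carrier (os_algebra M1 :: ('k, ('s list \<Rightarrow> 'k) set set) galg))"
    by (rule os_map_eqI) (rule os_induced_id)
  assume M: "M2 \<in> {M. is_matroid M}" and f: "f \<in> {f. weak_map M1 M2 f \<and> complete_map M1 f}"
  then have f': "os_induced M1 M2 f (os_map M1 M2 f :: ('s list \<Rightarrow> 'k) set set \<Rightarrow> _)"
    using os_map_induced by blast
  then show "os_map M1 M2 f \<in> galg_hom (os_algebra M1 :: ('k, ('s list \<Rightarrow> 'k) set set) galg) (os_algebra M2)"
    by (simp add: os_induced_def)
  assume M3: "M3 \<in> {M. is_matroid M}" and g: "g \<in> {f. weak_map M2 M3 f \<and> complete_map M2 f}"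
  then have "os_induced M2 M3 g (os_map M2 M3 g :: ('s list \<Rightarrow> 'k) set set \<Rightarrow> _)"
    using os_map_induced by blast
  then show "os_map M1 M3 (compose (ground (add_loop M1)) g f) =
      compose (carrier (os_algebra M1 :: ('k, ('s list \<Rightarrow> 'k) set set) galg)) (os_map M2 M3 g) (os_map M1 M2 f)"
    using f g by (intro os_map_eqI os_induced_compose[OF f']) auto
qed

section \<open>Reduced Orlik--Solomon algebras\<close>

text \<open>Isolates the record update in \<open>reduced_os_algebra\<close>, so that the grading of
  a subalgebra can be studied in an arbitrary graded algebra.\<close>

definition galg_restrict :: "('k, 'a) galg \<Rightarrow> 'a set \<Rightarrow> ('k, 'a) galg" where
  "galg_restrict A H = A\<lparr>carrier := H, hcomp := (\<lambda>n. H \<inter> hcomp A n)\<rparr>"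

lemma galg_restrict_simps [simp]:
  "carrier (galg_restrict A H) = H" "hcomp (galg_restrict A H) n = H \<inter> hcomp A n"
  "x \<oplus>\<^bsub>galg_restrict A H\<^esub> y = x \<oplus>\<^bsub>A\<^esub> y" "x \<otimes>\<^bsub>galg_restrict A H\<^esub> y = x \<otimes>\<^bsub>A\<^esub> y"
  "\<zero>\<^bsub>galg_restrict A H\<^esub> = \<zero>\<^bsub>A\<^esub>" "\<one>\<^bsub>galg_restrict A H\<^esub> = \<one>\<^bsub>A\<^esub>"
  "c \<odot>\<^bsub>galg_restrict A H\<^esub> x = c \<odot>\<^bsub>A\<^esub> x"
  by (simp_all add: galg_restrict_def)

section \<open>Subalgebras generated by homogeneous elements\<close>

context galgebra
begin

definition subalgebra :: "'a set \<Rightarrow> bool" where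
  "subalgebra H \<longleftrightarrow> subring H A \<and> (\<forall>c. \<forall>x\<in>H. c \<odot> x \<in> H)"

lemma subalgebraI:
  assumes "H \<subseteq> carrier A" "\<one> \<in> H" "\<And>x y. x \<in> H \<Longrightarrow> y \<in> H \<Longrightarrow> x \<otimes> y \<in> H"
    and "\<And>x y. x \<in> H \<Longrightarrow> y \<in> H \<Longrightarrow> x \<oplus> y \<in> H" "\<And>c x. x \<in> H \<Longrightarrow> c \<odot> x \<in> H"
  shows "subalgebra H"
  unfolding subalgebra_def
proof (intro conjI ballI allI)
  show "subring H A"
  proof (rule subringI)
    show "\<ominus> x \<in> H" if "x \<in> H" for x
      using assms(5)[OF that, of "- 1"] assms(1) that minus_one_smult by auto
  qed (use assms in auto)
qed (use assms in auto)

lemma subalgebraE: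
  assumes "subalgebra H"
  shows "H \<subseteq> carrier A" "\<zero> \<in> H" "\<one> \<in> H" "\<And>x y. x \<in> H \<Longrightarrow> y \<in> H \<Longrightarrow> x \<otimes> y \<in> H"
    and "\<And>x y. x \<in> H \<Longrightarrow> y \<in> H \<Longrightarrow> x \<oplus> y \<in> H" "\<And>c x. x \<in> H \<Longrightarrow> c \<odot> x \<in> H"
  using assms subringE[of H A] unfolding subalgebra_def by auto

lemma subalgebra_gen_eq: "subalgebra_gen A U = \<Inter>{H. subalgebra H \<and> U \<subseteq> H}"
  unfolding subalgebra_gen_def subalgebra_def by (simp add: conj_assoc)

lemma subalgebra_gen_minimal: "subalgebra H \<Longrightarrow> U \<subseteq> H \<Longrightarrow> subalgebra_gen A U \<subseteq> H"
  unfolding subalgebra_gen_eq by blast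

lemma subalgebra_carrier: "subalgebra (carrier A)"
  by (rule subalgebraI) auto

lemma subalgebra_gen_contains: "U \<subseteq> subalgebra_gen A U"
  unfolding subalgebra_gen_eq by blast

lemma subalgebra_gen_subalgebra:
  assumes "U \<subseteq> carrier A"
  shows "subalgebra (subalgebra_gen A U)"
proof (rule subalgebraI)
  show "subalgebra_gen A U \<subseteq> carrier A" by (rule subalgebra_gen_minimal[OF subalgebra_carrier assms])
qed (auto simp: subalgebra_gen_eq intro: subalgebraE)

lemma homog_sums_finsum:
  assumes "subalgebra H" "\<And>i. i < N \<Longrightarrow> f i \<in> homog_sums H"
  shows "(\<Oplus>i\<in>{..<N::nat}. f i) \<in> homog_sums H"
  by (rule finsum_additive_closed)
    (use assms subalgebraE[OF assms(1)] homog_sums_closed homog_sums_single[OF _ hcomp_zero] in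
      \<open>auto intro!: homog_sums_add\<close>)

text \<open>Products distribute over both decompositions, and a product of homogeneous members of
  \<open>H\<close> is again one. Minimality of a generated subalgebra turns this into its
  grading.\<close>

lemma subalgebra_homog_sums:
  assumes H: "subalgebra H"
  shows "subalgebra (homog_sums H)"
proof (rule subalgebraI)
  note HE = subalgebraE[OF H]
  \<comment> \<open>The case of a homogeneous left factor; a general left factor is a sum of such
    cases.\<close>
  have one_homog: "x \<otimes> y \<in> homog_sums H" if x: "x \<in> H \<inter> hcomp A m" and y: "y \<in> homog_sums H" for x y m
  proof -
    obtain q K where q: "\<And>n. q n \<in> H \<inter> hcomp A n" "y = (\<Oplus>n\<in>{..<K::nat}. q n)"
      using y unfolding homog_sums_def by blast
    have qc: "\<And>n. q n \<in> carrier A" using q hcomp_closed by blast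
    have "x \<otimes> y = (\<Oplus>n\<in>{..<K}. x \<otimes> q n)"
      unfolding q(2) using x hcomp_closed qc by (intro finsum_rdistr) auto
    also have "\<dots> \<in> homog_sums H"
      by (rule homog_sums_finsum[OF H], rule homog_sums_single[OF _ hcomp_mult])
        (use x q(1) HE in auto)
    finally show ?thesis .
  qed
  show "x \<otimes> y \<in> homog_sums H" if x: "x \<in> homog_sums H" and y: "y \<in> homog_sums H" for x y
  proof -
    obtain p N where p: "\<And>n. p n \<in> H \<inter> hcomp A n" "x = (\<Oplus>n\<in>{..<N::nat}. p n)"
      using x unfolding homog_sums_def by blast
    have pc: "\<And>n. p n \<in> carrier A" using p hcomp_closed by blast
    have "x \<otimes> y = (\<Oplus>n\<in>{..<N}. p n \<otimes> y)"
      unfolding p(2) using homog_sums_closed[OF y] pc by (intro finsum_ldistr) auto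
    also have "\<dots> \<in> homog_sums H"
      by (rule homog_sums_finsum[OF H]) (rule one_homog[OF p(1) y])
    finally show ?thesis .
  qed
  show "x \<oplus> y \<in> homog_sums H" if "x \<in> homog_sums H" "y \<in> homog_sums H" for x y
    using that HE by (intro homog_sums_add)
  show "c \<odot> x \<in> homog_sums H" if "x \<in> homog_sums H" for c x
  proof -
    obtain p N where p: "\<And>n. p n \<in> H \<inter> hcomp A n" "x = (\<Oplus>n\<in>{..<N::nat}. p n)"
      using \<open>x \<in> _\<close> unfolding homog_sums_def by blast
    have "c \<odot> x = (\<Oplus>n\<in>{..<N}. c \<odot> p n)"
      unfolding p(2) using p(1) hcomp_closed by (intro finsum_smult) auto
    also have "\<dots> \<in> homog_sums H"
      by (rule homog_sums_finsum[OF H], rule homog_sums_single[OF _ hcomp_smult]) (use p(1) HE in auto)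
    finally show ?thesis .
  qed
qed (use homog_sums_closed homog_sums_single[OF _ one_hcomp] subalgebraE[OF H] in auto)

lemma graded_subalgebra:
  assumes H: "subalgebra H" "H \<subseteq> homog_sums H"
  shows "graded_algebra (galg_restrict A H)"
proof -
  let ?B = "galg_restrict A H"
  note HE = subalgebraE[OF H(1)]
  have Hc: "\<And>x. x \<in> H \<Longrightarrow> x \<in> carrier A" using HE(1) by blast
  have 1: "abelian_group ?B"
  proof (rule abelian_groupI)
    fix x assume "x \<in> carrier ?B"
    then show "\<exists>y\<in>carrier ?B. y \<oplus>\<^bsub>?B\<^esub> x = \<zero>\<^bsub>?B\<^esub>"
      using HE(6)[of x "- 1"] Hc by (intro bexI[of _ "(- 1) \<odot> x"]) (auto simp: minus_one_smult l_neg)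
  qed (use HE Hc in \<open>auto simp: a_ac\<close>)
  have 2: "monoid ?B" by (rule monoidI) (use HE Hc in \<open>auto simp: m_assoc\<close>)
  have ring: "ring ?B" by (rule ringI[OF 1 2]) (use Hc in \<open>auto simp: l_distr r_distr\<close>)
  interpret B: ring ?B by fact
  \<comment> \<open>\<open>finsum\<close> depends on the structure, so sums formed in the restricted
    structure have to be identified with sums in \<open>A\<close>.\<close>
  have fs: "(\<Oplus>\<^bsub>?B\<^esub>n\<in>{..<N}. p n) = (\<Oplus>n\<in>{..<N}. p n)" if "\<And>n. p n \<in> H" for p and N :: nat
    using finsum_hom[OF B.abelian_monoid_axioms abelian_monoid_axioms, of "{..<N}" p "\<lambda>x. x"] that Hc by simp
  show ?thesis
  proof (rule graded_algebraI[OF ring])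
    fix x assume "x \<in> carrier ?B"
    then have "x \<in> homog_sums H" using H(2) by auto
    then obtain p N where "\<And>n. p n \<in> H \<inter> hcomp A n" "x = (\<Oplus>n\<in>{..<N::nat}. p n)"
      unfolding homog_sums_def by blast
    then show "\<exists>p N. (\<forall>n. p n \<in> hcomp ?B n) \<and> x = (\<Oplus>\<^bsub>?B\<^esub>n\<in>{..<N::nat}. p n)"
      using fs[of p N] by (intro exI[of _ p] exI[of _ N]) auto
  next
    fix p N and n :: nat
    assume p: "\<And>n. p n \<in> hcomp ?B n" "(\<Oplus>\<^bsub>?B\<^esub>n\<in>{..<N}. p n) = \<zero>\<^bsub>?B\<^esub>" "n < N"
    have "(\<Oplus>n\<in>{..<N}. p n) = \<zero>" using fs[of p N] p(1,2) by simp
    moreover have "(\<Oplus>n\<in>{..<N}. \<zero>) = \<zero>" by (rule finsum_zero)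
    ultimately have "p n = \<zero>"
      by (intro decomp_unique[of p "\<lambda>_. \<zero>" N n]) (use p hcomp_zero in \<open>auto simp del: finsum_zero\<close>)
    then show "p n = \<zero>\<^bsub>?B\<^esub>" by simp
  qed (use HE Hc one_hcomp hcomp_zero hcomp_add hcomp_smult hcomp_mult in
      \<open>auto simp: add_smult smult_add\<close>)
qed

text \<open>The homogeneous sums of the generated subalgebra form a subalgebra that contains the
  generators. By minimality it contains the whole generated subalgebra, which is therefore
  graded.\<close>

lemma graded_subalgebra_gen:
  assumes U: "\<And>u. u \<in> U \<Longrightarrow> \<exists>n. u \<in> hcomp A n"
  shows "graded_algebra (galg_restrict A (subalgebra_gen A U))"
proof (rule graded_subalgebra)
  have Uc: "U \<subseteq> carrier A" using U hcomp_closed by blast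
  show H: "subalgebra (subalgebra_gen A U)" by (rule subalgebra_gen_subalgebra[OF Uc])
  show "subalgebra_gen A U \<subseteq> homog_sums (subalgebra_gen A U)"
  proof (rule subalgebra_gen_minimal[OF subalgebra_homog_sums[OF H]], rule subsetI)
    fix u assume u: "u \<in> U"
    then obtain n where "u \<in> hcomp A n" using U by blast
    then show "u \<in> homog_sums (subalgebra_gen A U)"
      using u subalgebra_gen_contains[of U] subalgebraE(2)[OF H] by (intro homog_sums_single) auto
  qed
qed

lemma graded_comm_restrict:
  assumes "graded_algebra (galg_restrict A H)" "graded_comm_algebra A"
  shows "graded_comm_algebra (galg_restrict A H)"
  using assms unfolding graded_comm_algebra_def by simp

end

definition reduced_carrier :: "'s matroid \<Rightarrow> ('s list \<Rightarrow> 'k::field) set set set" where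
  "reduced_carrier M = subalgebra_gen (os_algebra M) (os_vec M ` reduced_space M)"

lemma reduced_os_algebra_eq: "reduced_os_algebra M = galg_restrict (os_algebra M) (reduced_carrier M)"
  by (simp add: reduced_os_algebra_def galg_restrict_def reduced_carrier_def Let_def)

context os_alg
begin

lemma reduced_vec_hcomp: "v \<in> reduced_space M \<Longrightarrow> os_vec M v \<in> hcomp A 1"
  using galg_mapD(6)[OF os_vec_galg_map] by (auto simp: reduced_space_def E.T.T_def)

lemma reduced_carrier_subalgebra: "subalgebra (reduced_carrier M)"
  unfolding reduced_carrier_def A_def[symmetric]
  using reduced_vec_hcomp hcomp_closed by (intro subalgebra_gen_subalgebra) blast

lemma graded_comm_reduced: "graded_comm_algebra (reduced_os_algebra M :: ('k, _) galg)"
  unfolding reduced_os_algebra_eq A_def[symmetric]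
proof (rule graded_comm_restrict[OF _ graded_comm_A])
  show "graded_algebra (galg_restrict A (reduced_carrier M))"
    unfolding reduced_carrier_def A_def[symmetric]
    by (rule graded_subalgebra_gen) (use reduced_vec_hcomp in blast)
qed

end

section \<open>Nondegenerate maps and the reduced subalgebra\<close>

lemma sum_add_word:
  assumes "finite S" "a \<in> S"
  shows "(\<Sum>s\<in>S. u [s] + c * word [a] [s]) = (\<Sum>s\<in>S. u [s]) + c"
  using assms by (simp add: sum.distrib word_def sum_distrib_left[symmetric])

text \<open>\<open>f\<close> kills no element, so each generator goes to a generator and the sum of
  coordinates is preserved; a killed element would lose its coordinate. All vectors are covered,
  because the induction adds one term at a time and leaves the reduced space on the way.\<close>

lemma os_induced_reduced_vec:
  fixes h :: "('s list \<Rightarrow> 'k::field) set set \<Rightarrow> ('t list \<Rightarrow> 'k) set set"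
  assumes "is_matroid M1" "is_matroid M2" and f: "weak_map M1 M2 f" "nondegenerate M1 f"
    and h: "os_induced M1 M2 f h" and v: "v \<in> hcomp (tensor_algebra (ground M1)) 1"
  shows "\<exists>v'\<in>hcomp (tensor_algebra (ground M2)) 1. h (os_vec M1 v) = os_vec M2 v' \<and>
    (\<Sum>t\<in>ground M2. v' [t]) = (\<Sum>s\<in>ground M1. v [s])"
proof -
  let ?T1 = "tensor_algebra (ground M1) :: ('k, 's list \<Rightarrow> 'k) galg"
  let ?T2 = "tensor_algebra (ground M2) :: ('k, 't list \<Rightarrow> 'k) galg"
  interpret M1: os_alg M1 ?T1 "ext_algebra (ground M1)" "os_algebra M1" by (rule os_alg_self)
  interpret M2: os_alg M2 ?T2 "ext_algebra (ground M2)" "os_algebra M2" by (rule os_alg_self)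
  have hm: "galg_map (os_algebra M1) (os_algebra M2) h"
    "\<And>s. s \<in> ground M1 \<Longrightarrow> h (os_gen M1 (Some s)) = os_gen M2 (f (Some s))"
    using h by (auto simp: os_induced_def galg_hom_iff)
  note m = galg_mapD[OF galg_map_comp[OF M1.os_vec_galg_map hm(1)]] galg_mapD[OF M2.os_vec_galg_map]
  have fin: "finite (ground M1)" "finite (ground M2)" using assms(1,2) by (auto simp: is_matroid_def)
  show ?thesis using v
  proof (induction v rule: tensor_hcomp_induct)
    case zero
    have "h (os_vec M1 \<zero>\<^bsub>?T1\<^esub>) = os_vec M2 \<zero>\<^bsub>?T2\<^esub>"
      using galg_map_zero[OF graded_tensor M1.graded_A M1.os_vec_galg_map]
        galg_map_zero[OF M1.graded_A M2.graded_A hm(1)]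
        galg_map_zero[OF graded_tensor M2.graded_A M2.os_vec_galg_map] by simp
    then show ?case
      by (intro bexI[of _ "\<zero>\<^bsub>?T2\<^esub>"] conjI) (simp_all add: tensor_simps(2) M2.E.T.hcomp_zero[unfolded tensor_simps(2)])
  next
    case (step q c w)
    then obtain s where w: "w = [s]" "s \<in> ground M1" by (cases w) auto
    obtain v' where v': "v' \<in> hcomp ?T2 1" "h (os_vec M1 q) = os_vec M2 v'"
      "(\<Sum>t\<in>ground M2. v' [t]) = (\<Sum>s\<in>ground M1. q [s])" using step.IH by blast
    obtain t where t: "f (Some s) = Some t" using nondegenerate_Some[OF f(2) w(2)] by blast
    then have tg: "t \<in> ground M2" using weak_map_ground[OF f(1) w(2)] by (auto simp: add_loop_def)
    have c: "q \<in> carrier ?T1" "v' \<in> carrier ?T2" "word [s] \<in> carrier ?T1" "word [t] \<in> carrier ?T2"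
      using M1.E.T.hcomp_closed[OF step(1)] M2.E.T.hcomp_closed[OF v'(1)] w tg by (auto intro: word_closed)
    have hs: "h (os_vec M1 (word [s])) = os_vec M2 (word [t])"
      using hm(2)[OF w(2)] t by (simp add: os_gen_def basis_vec_eq_word)
    let ?v = "v' \<oplus>\<^bsub>?T2\<^esub> c \<odot>\<^bsub>?T2\<^esub> word [t]"
    have "?v \<in> hcomp ?T2 1"
      using M2.E.T.hcomp_add[OF v'(1) M2.E.T.hcomp_smult[of "word [t]" 1 c]] word_hcomp[of "[t]" "ground M2"] tg
      by simp
    moreover have "h (os_vec M1 (q \<oplus>\<^bsub>?T1\<^esub> c \<odot>\<^bsub>?T1\<^esub> word w)) = os_vec M2 ?v"
      using c by (simp add: m w v'(2) hs)
    moreover have "(\<Sum>t\<in>ground M2. ?v [t]) = (\<Sum>s\<in>ground M1. (q \<oplus>\<^bsub>?T1\<^esub> c \<odot>\<^bsub>?T1\<^esub> word w) [s])"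
      using v'(3) fin tg w by (simp add: tensor_simps(3,4) sum_add_word)
    ultimately show ?case by blast
  qed
qed

lemma os_induced_reduced:
  fixes h :: "('s list \<Rightarrow> 'k::field) set set \<Rightarrow> ('t list \<Rightarrow> 'k) set set"
  assumes "is_matroid M1" "is_matroid M2" "weak_map M1 M2 f" "nondegenerate M1 f" "os_induced M1 M2 f h"
    and x: "x \<in> reduced_carrier M1"
  shows "h x \<in> reduced_carrier M2"
proof -
  interpret M1: os_alg M1 "tensor_algebra (ground M1) :: ('k, 's list \<Rightarrow> 'k) galg" "ext_algebra (ground M1)" "os_algebra M1"
    by (rule os_alg_self)
  interpret M2: os_alg M2 "tensor_algebra (ground M2) :: ('k, 't list \<Rightarrow> 'k) galg" "ext_algebra (ground M2)" "os_algebra M2"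
    by (rule os_alg_self)
  have hm: "galg_map (os_algebra M1) (os_algebra M2) h"
    using assms(5) by (auto simp: os_induced_def galg_hom_iff)
  \<comment> \<open>The preimage of the target subalgebra is a subalgebra, so it is enough that it
    contains the generators.\<close>
  let ?K = "{x \<in> carrier (os_algebra M1). h x \<in> reduced_carrier M2}"
  have K: "M1.subalgebra ?K"
    by (rule M1.subalgebraI)
      (use M2.subalgebraE[OF M2.reduced_carrier_subalgebra] in \<open>auto simp: galg_mapD[OF hm]\<close>)
  have gens: "os_vec M1 ` reduced_space M1 \<subseteq> ?K"
  proof
    fix y :: "('s list \<Rightarrow> 'k) set set" assume "y \<in> os_vec M1 ` reduced_space M1"
    then obtain v where v: "v \<in> reduced_space M1" "y = os_vec M1 v" by blast
    obtain v' where v': "v' \<in> hcomp (tensor_algebra (ground M2)) 1" "h (os_vec M1 v) = os_vec M2 v'"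
      "(\<Sum>t\<in>ground M2. v' [t]) = (\<Sum>s\<in>ground M1. v [s])"
      using os_induced_reduced_vec[OF assms(1-5), of v] v(1) unfolding reduced_space_def by blast
    then have "v' \<in> reduced_space M2" using v(1) unfolding reduced_space_def by simp
    then have "h y \<in> reduced_carrier M2"
      using subsetD[OF M2.subalgebra_gen_contains imageI] v'(2) v(2) unfolding reduced_carrier_def by metis
    then show "y \<in> ?K" using v M1.hcomp_closed[OF M1.reduced_vec_hcomp] by simp
  qed
  show ?thesis
    using M1.subalgebra_gen_minimal[OF K gens] x unfolding reduced_carrier_def by blast
qed

section \<open>Weak maps and their composition\<close>

lemma weak_map_PiE: "weak_map M1 M2 f \<Longrightarrow> f \<in> ground (add_loop M1) \<rightarrow>\<^sub>E ground (add_loop M2)"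
  unfolding weak_map_def by blast

lemma weak_map_extensional: "weak_map M1 M2 f \<Longrightarrow> f \<in> extensional (ground (add_loop M1))"
  using weak_map_PiE[of M1 M2 f] by (simp add: PiE_def)

lemma weak_map_closed: "weak_map M1 M2 f \<Longrightarrow> x \<in> ground (add_loop M1) \<Longrightarrow> f x \<in> ground (add_loop M2)"
  using weak_map_PiE[of M1 M2 f] by blast

lemma weak_map_None: "weak_map M1 M2 f \<Longrightarrow> f None = None"
  unfolding weak_map_def by blast

lemma Some_indep_iff: "Some ` I \<in> indeps (add_loop M) \<longleftrightarrow> I \<in> indeps M"
  by (auto simp: add_loop_def inj_image_eq_iff)

lemma weak_map_id: "is_matroid M \<Longrightarrow> weak_map M M (restrict (\<lambda>x. x) (ground (add_loop M)))"
proof -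
  have "restrict (\<lambda>x. x) (ground (add_loop M)) ` Some ` I = Some ` I" if "I \<subseteq> ground M" for I
    using that by (force simp: add_loop_def)
  then show ?thesis unfolding weak_map_def by (auto simp: Some_indep_iff) (auto simp: add_loop_def)
qed

lemma nondegenerate_id: "nondegenerate M (restrict (\<lambda>x. x) (ground (add_loop M)))"
  unfolding nondegenerate_def by (auto simp: add_loop_def)

text \<open>An independent image of \<open>I\<close> avoids the added loop, so \<open>f\<close>
  avoids it on \<open>I\<close> as well and maps \<open>I\<close> onto a genuine subset
  \<open>J\<close> of \<open>M2\<close>. The condition on \<open>g\<close> makes \<open>J\<close>
  independent, then the condition on \<open>f\<close> makes \<open>I\<close> independent.
  Injectivity of the composite gives it for \<open>f\<close> on \<open>I\<close> and for
  \<open>g\<close> on the image.\<close>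

lemma weak_map_compose:
  assumes f: "weak_map M1 M2 f" and g: "weak_map M2 M3 g"
  shows "weak_map M1 M3 (compose (ground (add_loop M1)) g f)"
  unfolding weak_map_def
proof (intro conjI allI impI)
  let ?h = "compose (ground (add_loop M1)) g f"
  show "?h \<in> ground (add_loop M1) \<rightarrow>\<^sub>E ground (add_loop M3)"
    using weak_map_closed[OF f] weak_map_closed[OF g] by (auto simp: compose_def)
  show "?h None = None" using weak_map_None[OF f] weak_map_None[OF g] by (simp add: compose_def add_loop_def)
  fix I assume I: "I \<subseteq> ground M1 \<and> inj_on ?h (Some ` I) \<and> ?h ` Some ` I \<in> indeps (add_loop M3)"
  then have eq: "?h x = g (f x)" if "x \<in> Some ` I" for x
    using that by (auto simp: compose_def add_loop_def)
  then have img: "?h ` Some ` I = g ` f ` Some ` I" by (auto simp: image_image intro!: image_cong)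
  have "None \<notin> ?h ` Some ` I" using I by (auto simp: add_loop_def)
  then have "f x \<noteq> None" if "x \<in> Some ` I" for x
    using weak_map_None[OF g] img that by (metis imageI)
  moreover have "f x \<in> insert None (Some ` ground M2)" if "x \<in> Some ` I" for x
    using that I weak_map_ground[OF f] by (auto simp: add_loop_def)
  ultimately have "f ` Some ` I \<subseteq> Some ` ground M2" by blast
  then obtain J where J: "J \<subseteq> ground M2" "f ` Some ` I = Some ` J" by (meson subset_imageE)
  have inj: "inj_on (\<lambda>x. g (f x)) (Some ` I)" using I eq by (auto simp: inj_on_def)
  then have "inj_on g (f ` Some ` I)" by (auto simp: inj_on_def)
  then have "J \<in> indeps M2"
    using g J I img unfolding weak_map_def by metis
  moreover have "inj_on f (Some ` I)" using inj by (auto simp: inj_on_def)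
  ultimately show "I \<in> indeps M1"
    using f I J Some_indep_iff unfolding weak_map_def by metis
qed

lemma nondegenerate_compose:
  assumes f: "weak_map M1 M2 f" "nondegenerate M1 f" and g: "weak_map M2 M3 g" "nondegenerate M2 g"
  shows "nondegenerate M1 (compose (ground (add_loop M1)) g f)"
proof -
  have nonzero: "g (f (Some s)) \<noteq> None" if "s \<in> ground M1" for s
    using nondegenerate_Some[OF f(2) that] weak_map_ground[OF f(1) that] nondegenerate_Some[OF g(2)]
    by (auto simp: add_loop_def)
  have "x = None" if "x \<in> ground (add_loop M1)" "g (f x) = None" for x
    using that nonzero by (cases x) (simp, fastforce simp: add_loop_def)
  then show ?thesis
    using weak_map_None[OF f(1)] weak_map_None[OF g(1)]
    unfolding nondegenerate_def by (auto simp: compose_def) (simp add: add_loop_def)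
qed

lemma category_matroid_nd: "is_category (matroid_nd_cat :: ('s matroid, _) cat)"
  unfolding is_category_def matroid_nd_cat_simps
proof (intro conjI ballI)
  fix M1 M2 M3 M4 :: "'s matroid" and f g h :: "'s option \<Rightarrow> 's option"
  assume M1: "M1 \<in> {M. is_matroid M}"
  show "restrict (\<lambda>x. x) (ground (add_loop M1)) \<in> {f. weak_map M1 M1 f \<and> nondegenerate M1 f}"
    using M1 weak_map_id nondegenerate_id by auto
  assume f: "f \<in> {f. weak_map M1 M2 f \<and> nondegenerate M1 f}"
  show "compose (ground (add_loop M1)) f (restrict (\<lambda>x. x) (ground (add_loop M1))) = f"
    using f weak_map_extensional by (intro compose_restrict_id) blast
  show "compose (ground (add_loop M1)) (restrict (\<lambda>x. x) (ground (add_loop M2))) f = f"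
    using f weak_map_extensional weak_map_closed by (intro compose_id_restrict) blast+
  show "compose (ground (add_loop M1)) (compose (ground (add_loop M2)) h g) f =
      compose (ground (add_loop M1)) h (compose (ground (add_loop M1)) g f)"
    using f weak_map_closed by (intro compose_compose) blast
  assume g: "g \<in> {f. weak_map M2 M3 f \<and> nondegenerate M2 f}"
  show "compose (ground (add_loop M1)) g f \<in> {f. weak_map M1 M3 f \<and> nondegenerate M1 f}"
    using f g weak_map_compose nondegenerate_compose by blast
qed

text \<open>Everything is inherited by restriction: \<open>os_map\<close> respects identities and
  composites, and \<open>os_induced_reduced\<close> keeps its values inside the reduced
  carriers.\<close>

lemma functor_reduced_os:
  "is_functor (matroid_nd_cat :: ('s matroid, _) cat)
    (gca_cat :: (('k::field, ('s list \<Rightarrow> 'k) set set) galg, _) cat) reduced_os_algebra reduced_os_map"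
  unfolding is_functor_def
proof (intro conjI category_matroid_nd category_gca)
  show "functor_laws (matroid_nd_cat :: ('s matroid, _) cat)
    (gca_cat :: (('k::field, ('s list \<Rightarrow> 'k) set set) galg, _) cat) reduced_os_algebra reduced_os_map"
    unfolding functor_laws_def matroid_nd_cat_simps gca_cat_simps
  proof (intro conjI ballI)
    fix M1 M2 M3 :: "'s matroid" and f g
    let ?R = "\<lambda>M. reduced_os_algebra M :: ('k, ('s list \<Rightarrow> 'k) set set) galg"
    let ?A = "\<lambda>M. os_algebra M :: ('k, ('s list \<Rightarrow> 'k) set set) galg"
    interpret M1: os_alg M1 "tensor_algebra (ground M1) :: ('k, 's list \<Rightarrow> 'k) galg" "ext_algebra (ground M1)" "?A M1"
      by (rule os_alg_self)
    have R_carrier: "carrier (?R M) = reduced_carrier M" for M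
      by (simp add: reduced_os_algebra_eq)
    have RA: "x \<in> carrier (?A M1)" if "x \<in> reduced_carrier M1" for x
      using that M1.subalgebraE(1)[OF M1.reduced_carrier_subalgebra] by blast
    show "?R M1 \<in> {A. graded_comm_algebra A}" using M1.graded_comm_reduced by simp
    show "reduced_os_map M1 M1 (restrict (\<lambda>x. x) (ground (add_loop M1))) = restrict (\<lambda>x. x) (carrier (?R M1))"
      unfolding reduced_os_map_def os_map_eqI[OF os_induced_id] R_carrier
      by (rule restrict_ext) (simp add: RA)
    assume M: "M1 \<in> {M. is_matroid M}" "M2 \<in> {M. is_matroid M}"
      and f: "f \<in> {f. weak_map M1 M2 f \<and> nondegenerate M1 f}"
    then have f': "os_induced M1 M2 f (os_map M1 M2 f :: ('s list \<Rightarrow> 'k) set set \<Rightarrow> _)"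
      using os_map_induced nondegenerate_complete by blast
    then have fm: "galg_map (?A M1) (?A M2) (os_map M1 M2 f)"
      by (simp add: os_induced_def galg_hom_iff)
    have fR: "os_map M1 M2 f x \<in> reduced_carrier M2" if "x \<in> reduced_carrier M1" for x :: "('s list \<Rightarrow> 'k) set set"
      using os_induced_reduced[OF _ _ _ _ f' that] M f by blast
    have "galg_map (?R M1) (?R M2) (os_map M1 M2 f)"
      by (rule galg_mapI) (auto simp: reduced_os_algebra_eq fR RA galg_mapD[OF fm])
    then have "galg_map (?R M1) (?R M2) (reduced_os_map M1 M2 f)"
      by (rule galg_map_cong)
        (use M1.graded_comm_reduced in \<open>auto simp: graded_comm_algebra_def reduced_os_map_def\<close>)
    then show "reduced_os_map M1 M2 f \<in> galg_hom (?R M1) (?R M2)"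
      by (simp add: galg_hom_iff reduced_os_map_def)
    assume M3: "M3 \<in> {M. is_matroid M}" and g: "g \<in> {f. weak_map M2 M3 f \<and> nondegenerate M2 f}"
    then have g': "os_induced M2 M3 g (os_map M2 M3 g :: ('s list \<Rightarrow> 'k) set set \<Rightarrow> _)"
      using os_map_induced nondegenerate_complete by blast
    have comp: "os_map M1 M3 (compose (ground (add_loop M1)) g f) = compose (carrier (?A M1)) (os_map M2 M3 g) (os_map M1 M2 f)"
      using f g by (intro os_map_eqI os_induced_compose[OF f' g']) auto
    show "reduced_os_map M1 M3 (compose (ground (add_loop M1)) g f) =
        compose (carrier (?R M1)) (reduced_os_map M2 M3 g) (reduced_os_map M1 M2 f)"
      unfolding reduced_os_map_def comp R_carrier
      unfolding compose_def
      by (rule restrict_ext) (simp add: RA fR)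
  qed
qed

section \<open>Epimorphisms\<close>

lemma epimorphism_surj:
  fixes M1 M2 :: "'s matroid"
  assumes inf: "infinite (UNIV :: 's set)" and epi: "epimorphism matroid_cat M1 M2 f" and t: "t \<in> ground M2"
  shows "\<exists>s\<in>ground M1. f (Some s) = Some t"
proof (rule ccontr)
  assume no: "\<not> ?thesis"
  \<comment> \<open>The test matroid has to live on the same element type, which supplies two
    distinct elements because it is infinite.\<close>
  obtain a b :: 's where ab: "a \<noteq> b"
    by (metis (full_types) UNIV_eq_I finite.emptyI finite.insertI inf insertI1 singletonI)
  define N where "N = \<lparr>ground = {a, b}, indeps = {{}}\<rparr>"
  have N: "is_matroid N" by (auto simp: is_matroid_def N_def)
  \<comment> \<open>No element of \<open>M2\<close> is sent to the added loop, which makes both test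
    maps nondegenerate and hence complete. Away from \<open>t\<close> they share the value
    \<open>a\<close>.\<close>
  define g where "g = (\<lambda>c. restrict (\<lambda>x. if x = None then None else if x = Some t then Some c else Some a) (ground (add_loop M2)))"
  have M2: "is_matroid M2" and f: "weak_map M1 M2 f"
    and test: "\<And>g h. g \<in> Hom matroid_cat M2 N \<Longrightarrow> h \<in> Hom matroid_cat M2 N \<Longrightarrow>
      compose (ground (add_loop M1)) g f = compose (ground (add_loop M1)) h f \<Longrightarrow> g = h"
    using epi N unfolding epimorphism_def matroid_cat_simps by auto
  have hom: "g c \<in> Hom matroid_cat M2 N" if "c \<in> {a, b}" for c
  proof -
    have "I = {}" if "g c ` Some ` I \<in> indeps (add_loop N)" for I
      using that by (auto simp: N_def add_loop_def)
    then have "weak_map M2 N (g c)"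
      using that M2 unfolding weak_map_def g_def
      by (auto simp: add_loop_def N_def is_matroid_def)
    moreover have "nondegenerate M2 (g c)" by (auto simp: nondegenerate_def g_def add_loop_def)
    ultimately show ?thesis using nondegenerate_complete by (simp add: matroid_cat_simps)
  qed
  have "f x \<noteq> Some t" if "x \<in> ground (add_loop M1)" for x
    using that no weak_map_None[OF f] by (auto simp: add_loop_def)
  then have "compose (ground (add_loop M1)) (g a) f = compose (ground (add_loop M1)) (g b) f"
    using weak_map_closed[OF f] by (auto simp: compose_def g_def restrict_def)
  then have "g a = g b" using test hom by blast
  then have "g a (Some t) = g b (Some t)" by simp
  then show False using t ab by (simp add: g_def add_loop_def)
qed

text \<open>Every generator of the target is hit, so homomorphisms that agree after composition
  agree on generators and hence everywhere. The argument does not look inside the third algebra,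
  whose carrier may have any type \<open>'c\<close>.\<close>

lemma os_map_epimorphism:
  fixes M1 M2 :: "'s matroid"
  assumes "infinite (UNIV :: 's set)" "epimorphism matroid_cat M1 M2 f"
  shows "gca_epimorphism TYPE('c) (os_algebra M1 :: ('k::field, ('s list \<Rightarrow> 'k) set set) galg)
    (os_algebra M2) (os_map M1 M2 f)"
proof -
  let ?A = "\<lambda>M. os_algebra M :: ('k, ('s list \<Rightarrow> 'k) set set) galg"
  interpret M1: os_alg M1 "tensor_algebra (ground M1) :: ('k, 's list \<Rightarrow> 'k) galg" "ext_algebra (ground M1)" "?A M1"
    by (rule os_alg_self)
  interpret M2: os_alg M2 "tensor_algebra (ground M2) :: ('k, 's list \<Rightarrow> 'k) galg" "ext_algebra (ground M2)" "?A M2"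
    by (rule os_alg_self)
  have f: "os_induced M1 M2 f (os_map M1 M2 f :: ('s list \<Rightarrow> 'k) set set \<Rightarrow> _)"
    using assms(2) by (intro os_map_induced) (auto simp: epimorphism_def matroid_cat_simps)
  show ?thesis
    unfolding gca_epimorphism_def
  proof (intro conjI allI impI ballI M1.graded_comm_A M2.graded_comm_A)
    show "os_map M1 M2 f \<in> galg_hom (?A M1) (?A M2)" using f by (simp add: os_induced_def)
    fix C :: "('k, 'c) galg" and g h
    assume C: "graded_comm_algebra C" and g: "g \<in> galg_hom (?A M2) C" and h: "h \<in> galg_hom (?A M2) C"
      and eq: "compose (carrier (?A M1)) g (os_map M1 M2 f) = compose (carrier (?A M1)) h (os_map M1 M2 f)"
    have gens: "g (os_gen M2 (Some t)) = h (os_gen M2 (Some t))" if "t \<in> ground M2" for t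
    proof -
      obtain s where s: "s \<in> ground M1" "f (Some s) = Some t"
        using epimorphism_surj[OF assms \<open>t \<in> ground M2\<close>] by blast
      have "os_gen M1 (Some s) \<in> carrier (?A M1)"
        using M1.hcomp_closed[OF M1.os_gen_hcomp] s by (simp add: add_loop_def)
      then have "g (os_map M1 M2 f (os_gen M1 (Some s))) = h (os_map M1 M2 f (os_gen M1 (Some s)))"
        using fun_cong[OF eq, of "os_gen M1 (Some s)"] by (simp add: compose_eq)
      moreover have "os_map M1 M2 f (os_gen M1 (Some s) :: ('s list \<Rightarrow> 'k) set set) = os_gen M2 (Some t)"
        using f s by (simp add: os_induced_def)
      ultimately show ?thesis by simp
    qed
    show "g = h"
    proof (rule extensionalityI)
      show "g \<in> extensional (carrier (?A M2))" "h \<in> extensional (carrier (?A M2))"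
        using g h by (auto simp: galg_hom_iff)
      show "g x = h x" if "x \<in> carrier (?A M2)" for x
        by (rule M2.os_map_eq[where B = C and g = g and h = h])
          (use g h C gens that in \<open>auto simp: galg_hom_iff graded_comm_algebra_def\<close>)
    qed
  qed
qed

text \<open>The unique existence in the first conjunct ensures that the definite description
  \<open>os_map\<close> denotes the induced homomorphism, so that the functor statements speak about
  it.\<close>

theorem theorem2p6:
  assumes "infinite (UNIV :: 's set)"
  shows
    "(\<forall>M1 M2 :: 's matroid. \<forall>f. is_matroid M1 \<and> is_matroid M2 \<and> f \<in> Hom matroid_cat M1 M2 \<longrightarrow>
        (\<exists>!h :: ('s list \<Rightarrow> 'k::field) set set \<Rightarrow> ('s list \<Rightarrow> 'k) set set. os_induced M1 M2 f h)) \<and>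
     is_category (gca_cat :: (('k, ('s list \<Rightarrow> 'k) set set) galg, _) cat) \<and>
     functor_laws (matroid_cat :: ('s matroid, _) cat)
       (gca_cat :: (('k, ('s list \<Rightarrow> 'k) set set) galg, _) cat) os_algebra os_map \<and>
     is_functor (matroid_nd_cat :: ('s matroid, _) cat)
       (gca_cat :: (('k, ('s list \<Rightarrow> 'k) set set) galg, _) cat) reduced_os_algebra reduced_os_map \<and>
     (\<forall>M1 M2 :: 's matroid. \<forall>f. epimorphism matroid_cat M1 M2 f \<longrightarrow>
        gca_epimorphism TYPE('c) (os_algebra M1 :: ('k, ('s list \<Rightarrow> 'k) set set) galg)
          (os_algebra M2) (os_map M1 M2 f))"
proof (intro conjI allI impI)
  fix M1 M2 :: "'s matroid" and f
  assume "is_matroid M1 \<and> is_matroid M2 \<and> f \<in> Hom matroid_cat M1 M2"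
  then have "is_matroid M2" "weak_map M1 M2 f" "complete_map M1 f" by (auto simp: matroid_cat_simps)
  then show "\<exists>!h :: ('s list \<Rightarrow> 'k) set set \<Rightarrow> ('s list \<Rightarrow> 'k) set set. os_induced M1 M2 f h"
    using ex_os_induced os_induced_unique by metis
qed (use category_gca functor_laws_os functor_reduced_os os_map_epimorphism[OF assms] in auto)

end
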